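(* Let $-1<\alpha<0$, and let $\varphi$ and $\psi$ be nonconstant linear fractional self-maps of $\mathbb D$. Let $\tau$ be the Krein adjoint of $\psi$. Then, for every fixed $r>0$, $$\|C_\psi^*C_\varphi\|_{e,\mathcal D_\alpha}^2\asymp\limsup_{|z|\to1^-}\frac{\displaystyle\int_{D(z,r)\cap(\varphi\circ\tau)(\mathbb D)}N_{\varphi\circ\tau,\alpha}(w)\,dA(w)}{A_\alpha(D(z,r))}.$$
   Context: $\mathbb D$ is the open unit disk in $\mathbb C$ and $dA$ is the normalized area measure on $\mathbb D$. For $\alpha>-1$, $dA_\alpha(z)=(1+\alpha)(1-|z|^2)^\alpha\,dA(z)$ and $A_\alpha(E)=\int_E dA_\alpha$ for measurable $E\subset\mathbb D$. The weighted Dirichlet space $\mathcal D_\alpha$ is the Hilbert space of analytic functions $f$ on $\mathbb D$ with $\|f\|_{\mathcal D_\alpha}^2=|f(0)|^2+\int_{\mathbb D}|f'(z)|^2\,dA_\alpha(z)<\infty$, with the associated inner product. A nonconstant linear fractional self-map of $\mathbb D$ is a map $\psi(z)=\frac{az+b}{cz+d}$ with $ad-bc\neq0$ and $\psi(\mathbb D)\subset\mathbb D$. Its Krein adjoint is $\tau(z)=\frac{\overline a z-\overline c}{-\overline b z+\overline d}$, which is again a linear fractional self-map of $\mathbb D$. The composition operator is $C_\varphi f=f\circ\varphi$; for such $\varphi$ it is bounded on $\mathcal D_\alpha$. $C_\psi^*$ is the Hilbert space adjoint of $C_\psi$ on $\mathcal D_\alpha$. For an analytic self-map $\eta$ of $\mathbb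 D$, $N_{\eta,\alpha}(w)=\sum_{\eta(z)=w}(1-|z|^2)^\alpha$ is the generalized Nevanlinna counting function (preimages in $\mathbb D$ counted with multiplicity), with $N_{\eta,\alpha}(w)=0$ for $w\notin\eta(\mathbb D)$. For $z,w\in\mathbb D$, $\rho(z,w)=\left|\frac{z-w}{1-\overline z w}\right|$, $\beta(z,w)=\frac12\log\frac{1+\rho(z,w)}{1-\rho(z,w)}$, and $D(z,r)=\{w\in\mathbb D:\beta(z,w)<r\}$. For a bounded operator $T$ on a Hilbert space $\mathcal H$, the essential norm is $\|T\|_{e,\mathcal H}=\inf\{\|T-K\|:K\text{ compact on }\mathcal H\}$. $X\asymp Y$ means that there exist positive constants $c$ and $C$ (here independent of $z$; $\alpha,\varphi,\psi,r$ are fixed) such that $cY\le X\le CY$. *)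

theory Defs
  imports "HOL-Complex_Analysis.Complex_Analysis"
begin

section \<open>Complex Hilbert spaces of functions\<close>

text \<open>A space is given by its carrier and its inner product (linear in the first argument);
  the vector space operations are the pointwise ones.\<close>

record 'a fun_hilbert =
  hcarrier :: "('a \<Rightarrow> complex) set"
  hinner :: "('a \<Rightarrow> complex) \<Rightarrow> ('a \<Rightarrow> complex) \<Rightarrow> complex"

type_synonym 'a fun_op = "('a \<Rightarrow> complex) \<Rightarrow> ('a \<Rightarrow> complex)"

definition hnorm :: "'a fun_hilbert \<Rightarrow> ('a \<Rightarrow> complex) \<Rightarrow> real" where
  "hnorm H f = sqrt (Re (hinner H f f))"

definition linear_op :: "'a fun_hilbert \<Rightarrow> 'a fun_op \<Rightarrow> bool" where
  "linear_op H T \<longleftrightarrow>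
     (\<forall>f\<in>hcarrier H. T f \<in> hcarrier H) \<and>
     (\<forall>f\<in>hcarrier H. \<forall>g\<in>hcarrier H. T (\<lambda>x. f x + g x) = (\<lambda>x. T f x + T g x)) \<and>
     (\<forall>c. \<forall>f\<in>hcarrier H. T (\<lambda>x. c * f x) = (\<lambda>x. c * T f x))"

text \<open>The value is \<open>\<infinity>\<close> for an unbounded operator.\<close>

definition op_norm :: "'a fun_hilbert \<Rightarrow> 'a fun_op \<Rightarrow> ennreal" where
  "op_norm H T = (SUP f\<in>{f \<in> hcarrier H. hnorm H f \<le> 1}. ennreal (hnorm H (T f)))"

definition compact_op :: "'a fun_hilbert \<Rightarrow> 'a fun_op \<Rightarrow> bool" where
  "compact_op H K \<longleftrightarrow> linear_op H K \<and>
     (\<forall>F :: nat \<Rightarrow> 'a \<Rightarrow> complex.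
        (\<forall>n. F n \<in> hcarrier H) \<and> (\<exists>B. \<forall>n. hnorm H (F n) \<le> B) \<longrightarrow>
        (\<exists>s g. strict_mono s \<and> g \<in> hcarrier H \<and>
           (\<lambda>n. hnorm H (\<lambda>x. K (F (s n)) x - g x)) \<longlonglongrightarrow> 0))"

definition ess_norm :: "'a fun_hilbert \<Rightarrow> 'a fun_op \<Rightarrow> ennreal" where
  "ess_norm H T = (INF K\<in>{K. compact_op H K}. op_norm H (\<lambda>f x. T f x - K f x))"

definition adjoint_op :: "'a fun_hilbert \<Rightarrow> 'a fun_op \<Rightarrow> 'a fun_op" where
  "adjoint_op H T g =
     (THE h. h \<in> hcarrier H \<and> (\<forall>f\<in>hcarrier H. hinner H (T f) g = hinner H f h))"


section \<open>Weighted Dirichlet spaces on the unit disc\<close>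

abbreviation unit_disc :: "complex set" where
  "unit_disc \<equiv> ball 0 1"

definition area_measure :: "complex measure" where
  "area_measure = uniform_measure lborel unit_disc"

definition weighted_area :: "real \<Rightarrow> complex measure" where
  "weighted_area \<alpha> =
     density area_measure (\<lambda>z. ennreal ((1 + \<alpha>) * (1 - (cmod z)\<^sup>2) powr \<alpha>))"

text \<open>An analytic function on the disc is represented by its extension by \<open>0\<close> to the whole
  plane, so that equality of elements is equality on the disc.\<close>

definition dirichlet_space :: "real \<Rightarrow> complex fun_hilbert" where
  "dirichlet_space \<alpha> =
     \<lparr> hcarrier = {f. f holomorphic_on unit_disc \<and> (\<forall>z. z \<notin> unit_disc \<longrightarrow> f z = 0) \<and>
                     set_integrable (weighted_area \<alpha>) unit_disc (\<lambda>z. (cmod (deriv f z))\<^sup>2)},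
       hinner = (\<lambda>f g. f 0 * cnj (g 0) +
                     (LINT z:unit_disc|weighted_area \<alpha>. deriv f z * cnj (deriv g z))) \<rparr>"

lemma hnorm_dirichlet_space:
  "(hnorm (dirichlet_space \<alpha>) f)\<^sup>2 =
     (cmod (f 0))\<^sup>2 + (LINT z:unit_disc|weighted_area \<alpha>. (cmod (deriv f z))\<^sup>2)"
proof -
  let ?I = "LINT z:unit_disc|weighted_area \<alpha>. (cmod (deriv f z))\<^sup>2"
  have "(LINT z:unit_disc|weighted_area \<alpha>. deriv f z * cnj (deriv f z)) = complex_of_real ?I"
    unfolding set_lebesgue_integral_def integral_complex_of_real [symmetric]
    by (intro Bochner_Integration.integral_cong)
       (simp_all only: real_scaleR_def of_real_mult complex_norm_square, simp_all only: scaleR_conv_of_real)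
  then have "hinner (dirichlet_space \<alpha>) f f = complex_of_real ((cmod (f 0))\<^sup>2 + ?I)"
    by (simp add: dirichlet_space_def complex_norm_square del: of_real_power)
  moreover have "?I \<ge> 0"
    unfolding set_lebesgue_integral_def by (intro Bochner_Integration.integral_nonneg) auto
  ultimately show ?thesis
    by (simp add: hnorm_def)
qed

definition composition_op :: "(complex \<Rightarrow> complex) \<Rightarrow> complex fun_op" where
  "composition_op \<phi> f = (\<lambda>z. if z \<in> unit_disc then f (\<phi> z) else 0)"


section \<open>Linear fractional self-maps, counting function, hyperbolic discs\<close>

text \<open>Since \<open>x / 0 = 0\<close>, the absence of a pole in the disc is stated explicitly.\<close>

definition moebius_self_map :: "complex \<Rightarrow> complex \<Rightarrow> complex \<Rightarrow> complex \<Rightarrow> bool" where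
  "moebius_self_map a b c d \<longleftrightarrow> a * d - b * c \<noteq> 0 \<and>
     (\<forall>z\<in>unit_disc. c * z + d \<noteq> 0) \<and> moebius a b c d ` unit_disc \<subseteq> unit_disc"

definition krein_adjoint :: "complex \<Rightarrow> complex \<Rightarrow> complex \<Rightarrow> complex \<Rightarrow> complex \<Rightarrow> complex" where
  "krein_adjoint a b c d = moebius (cnj a) (- cnj c) (- cnj b) (cnj d)"

text \<open>The multiplicity of a preimage \<open>z\<close> of \<open>w\<close> is the order of the zero of \<open>\<eta> - w\<close> at \<open>z\<close>,
  for nonconstant \<open>\<eta>\<close>.\<close>

definition nevanlinna :: "(complex \<Rightarrow> complex) \<Rightarrow> real \<Rightarrow> complex \<Rightarrow> ennreal" where
  "nevanlinna \<eta> \<alpha> w =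
     (\<Sum>\<^sub>\<infinity>z\<in>{z \<in> unit_disc. \<eta> z = w}.
        ennreal (of_int (zorder (\<lambda>u. \<eta> u - w) z) * (1 - (cmod z)\<^sup>2) powr \<alpha>))"

definition pseudo_hyp_dist :: "complex \<Rightarrow> complex \<Rightarrow> real" where
  "pseudo_hyp_dist z w = cmod ((z - w) / (1 - cnj z * w))"

definition bergman_dist :: "complex \<Rightarrow> complex \<Rightarrow> real" where
  "bergman_dist z w = 1/2 * ln ((1 + pseudo_hyp_dist z w) / (1 - pseudo_hyp_dist z w))"

definition bergman_disc :: "complex \<Rightarrow> real \<Rightarrow> complex set" where
  "bergman_disc z r = {w \<in> unit_disc. bergman_dist z w < r}"

end

theory Submission
  imports Defs
begin

text \<open>The constants of the comparison may depend on \<open>\<alpha>\<close>, \<open>\<phi>\<close>, \<open>\<psi>\<close> and \<open>r\<close>. With \<open>E\<close> the essential norm and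
  \<open>L\<close> the upper limit of the local averages it therefore says that \<open>E\<close> and \<open>L\<close> are finite and that
  \<open>E\<close> vanishes if and only if \<open>L\<close> does (\<open>ennreal_comparable\<close>). Both vanish unless there is a
  \<^emph>\<open>common contact\<close>: a point \<open>\<omega>\<close> of the unit circle with \<open>\<bar>\<phi> \<omega>\<bar> = \<bar>\<psi> \<omega>\<bar> = 1\<close>. On the circle the
  Krein adjoint \<open>\<tau>\<close> inverts \<open>\<psi>\<close> (\<open>krein_inverse_circle\<close>), so a common contact exists if and only if
  \<open>\<eta> = \<phi> \<circ> \<tau>\<close> maps some point \<open>\<xi>\<close> of the circle into the circle; then \<open>\<xi> = \<psi> \<omega>\<close>.

  \<^bold>\<open>Finiteness.\<close> A Euclidean ball of radius \<open>t\<close> has weighted area at most \<open>C t\<^sup>2\<^sup>+\<^sup>\<alpha>\<close>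
  (\<open>weight_integral_ball_le\<close>). Combined with the mean value inequality for \<open>\<bar>f'\<bar>\<^sup>2\<close> and Tonelli's
  theorem this bounds composition operators (\<open>pullback_integral_le\<close>, \<open>composition_bounded\<close>), hence
  \<open>T = C\<^sub>\<psi>\<^sup>* C\<^sub>\<phi>\<close>. The image of the disc under \<open>\<eta>\<close> is again a disc, and the counting function of \<open>\<eta>\<close> is
  at most a constant times the power \<open>\<alpha>\<close> of the distance to its boundary; the same estimate of
  areas bounds \<open>L\<close> (\<open>nevanlinna_integral_ball_le\<close>).

  \<^bold>\<open>No common contact.\<close> Then \<open>min \<bar>\<phi>\<bar> \<bar>\<psi>\<bar> \<le> R < 1\<close> on the disc, which thus splits into a part that
  \<open>\<psi>\<close> maps into \<open>\<bar>w\<bar> \<le> R\<close> and a part that \<open>\<phi>\<close> maps there. If \<open>h\<^sub>n\<close> is bounded and tends to \<open>0\<close>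
  locally uniformly, then, along a subsequence, \<open>(C\<^sub>\<psi> T h\<^sub>n)'\<close> converges uniformly on the first part
  and \<open>(C\<^sub>\<phi> h\<^sub>n)'\<close> tends to \<open>0\<close> uniformly on the second, so that \<open>\<parallel>T h\<^sub>n\<parallel>\<^sup>2 = \<langle>C\<^sub>\<psi> T h\<^sub>n, C\<^sub>\<phi> h\<^sub>n\<rangle>\<close> tends
  to \<open>0\<close>. With Montel's theorem this makes \<open>T\<close> compact (\<open>T_compact\<close>). As for \<open>L\<close>, \<open>\<eta>\<close> maps the
  disc into a smaller concentric disc, and the averages vanish near the circle.

  \<^bold>\<open>Common contact.\<close> Let \<open>h\<^sub>\<delta>\<close> be the function with a simple pole at \<open>(1 + \<delta>) \<omega>\<close>, scaled so that its
  norm is bounded below. Since \<open>\<phi>\<close> has a nonzero radial derivative at \<open>\<omega>\<close> (\<open>exterior_rate\<close>), the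
  linear fractional function \<open>f\<^sub>\<delta> = h\<^sub>\<delta> \<circ> \<phi>\<inverse>\<close> has its pole at distance at least \<open>\<kappa> \<delta>\<close> from the disc,
  and its norm stays bounded (\<open>peak_preimage\<close>). In the same way \<open>h\<^sub>\<delta> = C\<^sub>\<psi> g\<^sub>\<delta>\<close> with bounded \<open>g\<^sub>\<delta>\<close>. For
  \<open>\<delta>\<^sub>n \<rightarrow> 0\<close> the functions \<open>h\<^sub>n\<close> tend weakly to \<open>0\<close>, so that
  \<open>\<langle>g\<^sub>n, T (f\<^sub>n - f\<^sub>m)\<rangle> = \<langle>h\<^sub>n, h\<^sub>n\<rangle> - \<langle>h\<^sub>n, h\<^sub>m\<rangle>\<close> stays away from \<open>0\<close> for large \<open>n\<close>. A compact
  perturbation cannot destroy this separation, and \<open>E > 0\<close> (\<open>T_ess_norm_pos\<close>). For the averages take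
  \<open>z = \<eta> (t \<xi>)\<close> with \<open>t \<rightarrow> 1\<close>: the hyperbolic disc about \<open>z\<close> contains a ball of radius comparable to
  \<open>1 - t\<close> on which the counting function is at least \<open>c (1 - t)\<^sup>\<alpha>\<close>, whence \<open>L > 0\<close>
  (\<open>local_average_Limsup_pos\<close>).\<close>

section \<open>Hilbert spaces of functions\<close>

lemma linear_opD:
  assumes "linear_op H T" "f \<in> hcarrier H"
  shows linear_op_closed: "T f \<in> hcarrier H"
    and linear_op_add: "g \<in> hcarrier H \<Longrightarrow> T (\<lambda>x. f x + g x) = (\<lambda>x. T f x + T g x)"
    and linear_op_scale: "T (\<lambda>x. k * f x) = (\<lambda>x. k * T f x)"
  using assms by (auto simp: linear_op_def)

text \<open>A semidefinite form suffices for the Cauchy-Schwarz inequality and for all statements on essential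
  norms; definiteness and completeness are needed only for adjoints.\<close>

locale fun_inner_space =
  fixes H :: "'a fun_hilbert"
  assumes zero_closed: "(\<lambda>x. 0) \<in> hcarrier H"
    and add_closed: "\<lbrakk>f \<in> hcarrier H; g \<in> hcarrier H\<rbrakk> \<Longrightarrow> (\<lambda>x. f x + g x) \<in> hcarrier H"
    and scale_closed: "f \<in> hcarrier H \<Longrightarrow> (\<lambda>x. k * f x) \<in> hcarrier H"
    and inner_add_left: "\<lbrakk>f \<in> hcarrier H; g \<in> hcarrier H; h \<in> hcarrier H\<rbrakk> \<Longrightarrow>
      hinner H (\<lambda>x. f x + g x) h = hinner H f h + hinner H g h"
    and inner_scale_left: "\<lbrakk>f \<in> hcarrier H; h \<in> hcarrier H\<rbrakk> \<Longrightarrow>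
      hinner H (\<lambda>x. k * f x) h = k * hinner H f h"
    and inner_commute: "\<lbrakk>f \<in> hcarrier H; g \<in> hcarrier H\<rbrakk> \<Longrightarrow> hinner H g f = cnj (hinner H f g)"
    and inner_nonneg: "f \<in> hcarrier H \<Longrightarrow> 0 \<le> Re (hinner H f f)"
begin

lemma diff_closed:
  assumes "f \<in> hcarrier H" "g \<in> hcarrier H"
  shows "(\<lambda>x. f x - g x) \<in> hcarrier H"
  using add_closed[OF assms(1) scale_closed[OF assms(2), of "-1"]] by simp

lemma inner_diff_left:
  assumes "f \<in> hcarrier H" "g \<in> hcarrier H" "h \<in> hcarrier H"
  shows "hinner H (\<lambda>x. f x - g x) h = hinner H f h - hinner H g h"
  using inner_add_left[OF assms(1) scale_closed[OF assms(2), of "-1"] assms(3)]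
    inner_scale_left[OF assms(2,3), of "-1"] by simp

lemma inner_add_right:
  assumes "f \<in> hcarrier H" "g \<in> hcarrier H" "h \<in> hcarrier H"
  shows "hinner H h (\<lambda>x. f x + g x) = hinner H h f + hinner H h g"
  using assms by (simp add: inner_commute[of _ h] add_closed inner_add_left)

lemma inner_scale_right:
  assumes "f \<in> hcarrier H" "h \<in> hcarrier H"
  shows "hinner H h (\<lambda>x. k * f x) = cnj k * hinner H h f"
  using assms by (simp add: inner_commute[of _ h] scale_closed inner_scale_left)

lemma inner_diff_right:
  assumes "f \<in> hcarrier H" "g \<in> hcarrier H" "h \<in> hcarrier H"
  shows "hinner H h (\<lambda>x. f x - g x) = hinner H h f - hinner H h g"
  using assms by (simp add: inner_commute[of _ h] diff_closed inner_diff_left)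

lemma hnorm_nonneg: "f \<in> hcarrier H \<Longrightarrow> 0 \<le> hnorm H f"
  by (simp add: hnorm_def inner_nonneg)

lemma hnorm_sq: "f \<in> hcarrier H \<Longrightarrow> (hnorm H f)\<^sup>2 = Re (hinner H f f)"
  by (simp add: hnorm_def inner_nonneg)

lemma inner_self:
  assumes "f \<in> hcarrier H"
  shows "hinner H f f = of_real ((hnorm H f)\<^sup>2)"
  using inner_commute[OF assms assms] hnorm_sq[OF assms] by (simp add: complex_eq_iff)

lemma hnorm_zero: "hnorm H (\<lambda>x. 0) = 0"
  using inner_scale_left[OF zero_closed zero_closed, of 0] by (simp add: hnorm_def)

lemma hnorm_scale:
  assumes "f \<in> hcarrier H"
  shows "hnorm H (\<lambda>x. k * f x) = cmod k * hnorm H f"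
proof -
  have "hinner H (\<lambda>x. k * f x) (\<lambda>x. k * f x) = (k * cnj k) * hinner H f f"
    using assms by (simp add: inner_scale_left inner_scale_right scale_closed)
  also have "\<dots> = of_real ((cmod k * hnorm H f)\<^sup>2)"
    by (simp add: inner_self[OF assms] power_mult_distrib complex_norm_square[symmetric] flip: of_real_power)
  finally show ?thesis
    using hnorm_nonneg[OF assms] by (simp only: hnorm_def[of H "\<lambda>x. k * f x"] Re_complex_of_real) simp
qed

lemma hnorm_sq_add_scale:
  assumes f: "f \<in> hcarrier H" and g: "g \<in> hcarrier H"
  shows "(hnorm H (\<lambda>x. f x + k * g x))\<^sup>2
    = (hnorm H f)\<^sup>2 + 2 * Re (cnj k * hinner H f g) + (cmod k)\<^sup>2 * (hnorm H g)\<^sup>2"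
proof -
  have kg: "(\<lambda>x. k * g x) \<in> hcarrier H" by (rule scale_closed[OF g])
  have "hinner H (\<lambda>x. f x + k * g x) (\<lambda>x. f x + k * g x)
      = hinner H f f + cnj k * hinner H f g + cnj (cnj k * hinner H f g) + hinner H (\<lambda>x. k * g x) (\<lambda>x. k * g x)"
    using f g kg
    by (simp add: inner_add_left inner_add_right add_closed inner_scale_left inner_scale_right
        inner_commute[OF f g])
  then show ?thesis
    unfolding hnorm_sq[OF add_closed[OF f kg]]
    by (simp add: inner_self f kg hnorm_scale g power_mult_distrib)
qed

lemma hnorm_sq_diff:
  assumes f: "f \<in> hcarrier H" and g: "g \<in> hcarrier H"
  shows "(hnorm H (\<lambda>x. f x - g x))\<^sup>2 = (hnorm H f)\<^sup>2 - 2 * Re (hinner H f g) + (hnorm H g)\<^sup>2"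
  using hnorm_sq_add_scale[OF assms, of "-1"] by simp

lemma hnorm_sq_add:
  assumes f: "f \<in> hcarrier H" and g: "g \<in> hcarrier H"
  shows "(hnorm H (\<lambda>x. f x + g x))\<^sup>2 = (hnorm H f)\<^sup>2 + 2 * Re (hinner H f g) + (hnorm H g)\<^sup>2"
  using hnorm_sq_add_scale[OF assms, of 1] by simp

lemma hnorm_minus_commute:
  assumes f: "f \<in> hcarrier H" and g: "g \<in> hcarrier H"
  shows "hnorm H (\<lambda>x. f x - g x) = hnorm H (\<lambda>x. g x - f x)"
  using hnorm_scale[OF diff_closed[OF g f], of "-1"] by simp

text \<open>The polynomial \<open>t \<mapsto> \<parallel>f - t \<langle>f, g\<rangle> g\<parallel>\<^sup>2\<close> is nonnegative. The case \<open>\<parallel>g\<parallel> = 0\<close> is separate because the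
  form may be degenerate.\<close>

lemma Cauchy_Schwarz:
  assumes f: "f \<in> hcarrier H" and g: "g \<in> hcarrier H"
  shows "cmod (hinner H f g) \<le> hnorm H f * hnorm H g"
proof -
  define s where "s = cmod (hinner H f g)"
  have ineq: "2 * t * s\<^sup>2 \<le> (hnorm H f)\<^sup>2 + t\<^sup>2 * s\<^sup>2 * (hnorm H g)\<^sup>2" for t :: real
  proof -
    define k where "k = - of_real t * hinner H f g"
    have "Re (cnj k * hinner H f g) = - t * s\<^sup>2"
      unfolding k_def s_def cmod_power2 by (simp add: power2_eq_square algebra_simps)
    moreover have "(cmod k)\<^sup>2 = t\<^sup>2 * s\<^sup>2" by (simp add: k_def s_def norm_mult power_mult_distrib)
    ultimately show ?thesis
      using hnorm_sq_add_scale[OF f g, of k] zero_le_power2[of "hnorm H (\<lambda>x. f x + k * g x)"] by simp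
  qed
  show ?thesis
  proof (cases "hnorm H g = 0")
    case True
    have "s = 0"
    proof (rule ccontr)
      assume "s \<noteq> 0"
      then show False
        using ineq[of "((hnorm H f)\<^sup>2 + 1) / (2 * s\<^sup>2)"] True by simp
    qed
    then show ?thesis using True by (simp add: s_def)
  next
    case False
    define N where "N = (hnorm H g)\<^sup>2"
    have N: "0 < N" using False by (simp add: N_def)
    have "2 * (s\<^sup>2 / N) \<le> (hnorm H f)\<^sup>2 + s\<^sup>2 / N"
    proof -
      have "2 * (1 / N) * s\<^sup>2 \<le> (hnorm H f)\<^sup>2 + (1 / N)\<^sup>2 * s\<^sup>2 * N"
        using ineq[of "1 / N"] by (simp only: N_def)
      also have "(1 / N)\<^sup>2 * s\<^sup>2 * N = s\<^sup>2 / N" using N by (simp add: power2_eq_square)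
      finally show ?thesis by simp
    qed
    then have "s\<^sup>2 \<le> (hnorm H f)\<^sup>2 * (hnorm H g)\<^sup>2"
      using N by (simp add: field_simps flip: N_def)
    then have "s\<^sup>2 \<le> (hnorm H f * hnorm H g)\<^sup>2" by (simp add: power_mult_distrib)
    then show ?thesis unfolding s_def by (rule power2_le_imp_le) (simp add: hnorm_nonneg f g)
  qed
qed

lemma hnorm_triangle:
  assumes f: "f \<in> hcarrier H" and g: "g \<in> hcarrier H"
  shows "hnorm H (\<lambda>x. f x + g x) \<le> hnorm H f + hnorm H g"
proof (rule power2_le_imp_le)
  have "Re (hinner H f g) \<le> hnorm H f * hnorm H g"
    using Cauchy_Schwarz[OF f g] complex_Re_le_cmod order_trans by blast
  then show "(hnorm H (\<lambda>x. f x + g x))\<^sup>2 \<le> (hnorm H f + hnorm H g)\<^sup>2"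
    by (simp add: hnorm_sq_add[OF f g] power2_sum)
qed (simp add: hnorm_nonneg f g)

lemma hnorm_triangle_diff:
  assumes f: "f \<in> hcarrier H" and g: "g \<in> hcarrier H"
  shows "hnorm H f \<le> hnorm H g + hnorm H (\<lambda>x. f x - g x)"
  using hnorm_triangle[OF g diff_closed[OF f g]] by simp

lemma hnorm_triangle_diff_le:
  assumes f: "f \<in> hcarrier H" and g: "g \<in> hcarrier H"
  shows "hnorm H (\<lambda>x. f x - g x) \<le> hnorm H f + hnorm H g"
  using hnorm_triangle[OF f scale_closed[OF g, of "-1"]] hnorm_scale[OF g, of "-1"] by simp

lemma linear_op_diff:
  assumes T: "linear_op H T" and f: "f \<in> hcarrier H" and g: "g \<in> hcarrier H"
  shows "T (\<lambda>x. f x - g x) = (\<lambda>x. T f x - T g x)"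
proof -
  have "T (\<lambda>x. f x + (- 1) * g x) = (\<lambda>x. T f x + T (\<lambda>x. (- 1) * g x) x)"
    by (rule linear_op_add[OF T f scale_closed[OF g]])
  also have "T (\<lambda>x. (- 1) * g x) = (\<lambda>x. (- 1) * T g x)"
    by (rule linear_op_scale[OF T g])
  finally show ?thesis by simp
qed

lemma compact_op_zero: "compact_op H (\<lambda>f x. 0)"
  unfolding compact_op_def
proof (intro conjI allI impI)
  show "linear_op H (\<lambda>f x. 0)" by (simp add: linear_op_def zero_closed)
  show "\<exists>(s :: nat \<Rightarrow> nat) g. strict_mono s \<and> g \<in> hcarrier H \<and> (\<lambda>n. hnorm H (\<lambda>x. 0 - g x)) \<longlonglongrightarrow> 0"
    using zero_closed hnorm_zero strict_mono_id
    by (intro exI[of _ "id :: nat \<Rightarrow> nat"] exI[of _ "\<lambda>x. 0 :: complex"]) auto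
qed

lemma ess_norm_finite:
  assumes bound: "\<And>f. f \<in> hcarrier H \<Longrightarrow> hnorm H (T f) \<le> B * hnorm H f" and "0 \<le> B"
  shows "ess_norm H T < \<infinity>"
proof -
  have "ess_norm H T \<le> op_norm H (\<lambda>f x. T f x - 0)"
    unfolding ess_norm_def by (rule INF_lower) (simp add: compact_op_zero)
  also have "\<dots> \<le> ennreal B"
    unfolding op_norm_def
  proof (rule SUP_least)
    fix f assume "f \<in> {f \<in> hcarrier H. hnorm H f \<le> 1}"
    then have f: "f \<in> hcarrier H" "hnorm H f \<le> 1" by auto
    have "hnorm H (T f) \<le> B * 1"
      using bound[OF f(1)] mult_left_mono[OF f(2) \<open>0 \<le> B\<close>] by linarith
    then show "ennreal (hnorm H (\<lambda>x. T f x - 0)) \<le> ennreal B" by (simp add: ennreal_leI)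
  qed
  also have "\<dots> < \<infinity>" by simp
  finally show ?thesis .
qed

lemma ess_norm_compact:
  assumes "compact_op H T"
  shows "ess_norm H T = 0"
proof -
  have "ess_norm H T \<le> op_norm H (\<lambda>f x. T f x - T f x)"
    unfolding ess_norm_def by (rule INF_lower) (simp add: assms)
  also have "\<dots> = 0" by (simp add: op_norm_def hnorm_zero SUP_constant bot_ennreal)
  finally show ?thesis by simp
qed

lemma hnorm_le_op_norm:
  assumes T: "linear_op H T" and f: "f \<in> hcarrier H" "hnorm H f \<le> R" and R: "0 < R"
    and finite: "op_norm H T = ennreal \<nu>" "0 \<le> \<nu>"
  shows "hnorm H (T f) \<le> R * \<nu>"
proof -
  define g where "g = (\<lambda>x. of_real (1 / R) * f x)"
  have g: "g \<in> hcarrier H" unfolding g_def by (rule scale_closed[OF f(1)])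
  have "hnorm H g = hnorm H f / R"
    unfolding g_def hnorm_scale[OF f(1)] norm_of_real using R by simp
  then have "hnorm H g \<le> 1" using f R by simp
  then have "ennreal (hnorm H (T g)) \<le> op_norm H T"
    unfolding op_norm_def using g by (intro SUP_upper) auto
  then have le: "hnorm H (T g) \<le> \<nu>" using finite by (simp add: ennreal_le_iff)
  have "T g = (\<lambda>x. of_real (1 / R) * T f x)"
    unfolding g_def by (rule linear_op_scale[OF T f(1)])
  moreover have "T f \<in> hcarrier H" by (rule linear_op_closed[OF T f(1)])
  ultimately have "hnorm H (T g) = hnorm H (T f) / R"
    using R by (simp only: hnorm_scale norm_of_real) simp
  then show ?thesis using le R by (simp add: divide_le_eq mult.commute)
qed

text \<open>A compact operator maps two members of a bounded sequence, with arbitrarily large indices, to nearby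
  vectors. On their difference, of norm at most \<open>2 B\<close>, \<open>T - K\<close> therefore acts almost like \<open>T\<close>.\<close>

lemma ess_norm_pos:
  fixes F :: "nat \<Rightarrow> 'a \<Rightarrow> complex"
  assumes T: "linear_op H T" and F: "\<And>n. F n \<in> hcarrier H" "\<And>n. hnorm H (F n) \<le> B"
    and c: "0 < c" and B: "0 < B"
    and sep: "\<And>m. eventually (\<lambda>n. c \<le> hnorm H (\<lambda>x. T (F n) x - T (F m) x)) sequentially"
  shows "0 < ess_norm H T"
proof -
  have "ennreal (c / (4 * B)) \<le> ess_norm H T"
    unfolding ess_norm_def
  proof (rule INF_greatest)
    fix K assume "K \<in> {K. compact_op H K}"
    then have K: "compact_op H K" "linear_op H K" by (auto simp: compact_op_def)
    have TF: "T (F n) \<in> hcarrier H" and KF: "K (F n) \<in> hcarrier H" for n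
      using T K(2) F(1) by (auto simp: linear_op_def)
    obtain s g where s: "strict_mono s" "g \<in> hcarrier H"
      and lim: "(\<lambda>n. hnorm H (\<lambda>x. K (F (s n)) x - g x)) \<longlonglongrightarrow> 0"
      using K(1) F unfolding compact_op_def by blast
    have "eventually (\<lambda>n. hnorm H (\<lambda>x. K (F (s n)) x - g x) < c / 4) sequentially"
      using order_tendstoD(2)[OF lim, of "c / 4"] c by simp
    then obtain m where m: "hnorm H (\<lambda>x. K (F (s n)) x - g x) < c / 4" if "n \<ge> m" for n
      unfolding eventually_sequentially by auto
    have "eventually (\<lambda>n. c \<le> hnorm H (\<lambda>x. T (F (s n)) x - T (F (s m)) x)) sequentially"
      using sep[of "s m"] filterlim_subseq[OF s(1)] unfolding filterlim_iff by blast
    then have "eventually (\<lambda>n. n \<ge> m \<and> c \<le> hnorm H (\<lambda>x. T (F (s n)) x - T (F (s m)) x)) sequentially"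
      using eventually_ge_at_top eventually_conj by blast
    then obtain n where n: "n \<ge> m" "c \<le> hnorm H (\<lambda>x. T (F (s n)) x - T (F (s m)) x)"
      by (auto simp: eventually_sequentially)
    define f where "f = (\<lambda>x. F (s n) x - F (s m) x)"
    have f: "f \<in> hcarrier H" unfolding f_def by (rule diff_closed[OF F(1) F(1)])
    have normf: "hnorm H f \<le> 2 * B"
      using hnorm_triangle_diff_le[OF F(1) F(1), of "s n" "s m"] F(2)[of "s n"] F(2)[of "s m"]
      by (simp add: f_def)
    have Tf: "T f = (\<lambda>x. T (F (s n)) x - T (F (s m)) x)"
      unfolding f_def by (rule linear_op_diff[OF T F(1) F(1)])
    have Kf: "K f = (\<lambda>x. K (F (s n)) x - K (F (s m)) x)"
      unfolding f_def by (rule linear_op_diff[OF K(2) F(1) F(1)])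
    have TfH: "T f \<in> hcarrier H" and KfH: "K f \<in> hcarrier H"
      using T K(2) f by (auto simp: linear_op_def)
    have "hnorm H (K f) = hnorm H (\<lambda>x. (K (F (s n)) x - g x) - (K (F (s m)) x - g x))"
      by (simp add: Kf)
    also have "\<dots> \<le> hnorm H (\<lambda>x. K (F (s n)) x - g x) + hnorm H (\<lambda>x. K (F (s m)) x - g x)"
      by (intro hnorm_triangle_diff_le diff_closed KF s)
    also have "\<dots> \<le> c / 2" using m[OF n(1)] m[of m] by simp
    finally have "hnorm H (K f) \<le> c / 2" .
    then have "c / 2 \<le> hnorm H (\<lambda>x. T f x - K f x)"
      using hnorm_triangle_diff[OF TfH KfH] n(2) Tf by simp
    have "linear_op H (\<lambda>f x. T f x - K f x)"
      using T K(2) unfolding linear_op_def by (auto simp: diff_closed algebra_simps)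
    have le: "c / 2 \<le> 2 * B * \<nu>" if "op_norm H (\<lambda>f x. T f x - K f x) = ennreal \<nu>" "0 \<le> \<nu>" for \<nu>
    proof -
      have lin: "linear_op H (\<lambda>f x. T f x - K f x)" by fact
      have "hnorm H (\<lambda>x. T f x - K f x) \<le> 2 * B * \<nu>"
        using hnorm_le_op_norm[OF lin f normf _ that] B by simp
      then show ?thesis using \<open>c / 2 \<le> hnorm H (\<lambda>x. T f x - K f x)\<close> by simp
    qed
    show "ennreal (c / (4 * B)) \<le> op_norm H (\<lambda>f x. T f x - K f x)"
    proof (cases "op_norm H (\<lambda>f x. T f x - K f x)")
      case (real \<nu>)
      have "c / (4 * B) \<le> \<nu>" using le[OF real(2,1)] B by (simp add: divide_le_eq mult_ac)
      then show ?thesis by (simp add: real ennreal_leI)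
    qed simp
  qed
  moreover have "0 < c / (4 * B)" using c B by simp
  ultimately show ?thesis by (metis ennreal_less_zero_iff less_le_trans)
qed

end

locale fun_hilbert_space = fun_inner_space +
  assumes definite: "\<lbrakk>f \<in> hcarrier H; hnorm H f = 0\<rbrakk> \<Longrightarrow> f = (\<lambda>x. 0)"
    and complete: "\<And>F :: nat \<Rightarrow> 'a \<Rightarrow> complex. \<lbrakk>\<And>n. F n \<in> hcarrier H;
        \<And>e. 0 < e \<Longrightarrow> \<exists>N. \<forall>m\<ge>N. \<forall>n\<ge>N. hnorm H (\<lambda>x. F m x - F n x) < e\<rbrakk> \<Longrightarrow>
      \<exists>g\<in>hcarrier H. (\<lambda>n. hnorm H (\<lambda>x. F n x - g x)) \<longlonglongrightarrow> 0"
begin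

text \<open>The representing vector minimises \<open>J f = \<parallel>f\<parallel>\<^sup>2 - 2 Re (l f)\<close>: by the parallelogram law minimising
  sequences are Cauchy, and comparing \<open>J\<close> at the minimiser \<open>h\<close> and at \<open>h + k f\<close> gives \<open>l f = \<langle>f, h\<rangle>\<close>.\<close>

lemma Riesz_representation:
  fixes l :: "('a \<Rightarrow> complex) \<Rightarrow> complex"
  assumes add: "\<And>f g. \<lbrakk>f \<in> hcarrier H; g \<in> hcarrier H\<rbrakk> \<Longrightarrow> l (\<lambda>x. f x + g x) = l f + l g"
    and scale: "\<And>k f. f \<in> hcarrier H \<Longrightarrow> l (\<lambda>x. k * f x) = k * l f"
    and bound: "\<And>f. f \<in> hcarrier H \<Longrightarrow> cmod (l f) \<le> B * hnorm H f"
  shows "\<exists>h\<in>hcarrier H. \<forall>f\<in>hcarrier H. l f = hinner H f h"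
proof -
  define J where "J f = (hnorm H f)\<^sup>2 - 2 * Re (l f)" for f
  have J_ge: "- B\<^sup>2 \<le> J f" if "f \<in> hcarrier H" for f
  proof -
    have "Re (l f) \<le> B * hnorm H f"
      using bound[OF that] complex_Re_le_cmod order_trans by blast
    moreover have "0 \<le> (hnorm H f - B)\<^sup>2" by simp
    ultimately show ?thesis by (simp add: J_def power2_diff algebra_simps)
  qed
  define I where "I = Inf (J ` hcarrier H)"
  have bdd: "bdd_below (J ` hcarrier H)" using J_ge by (auto simp: bdd_below_def)
  have I_le: "I \<le> J f" if "f \<in> hcarrier H" for f
    unfolding I_def using bdd that by (intro cInf_lower) auto
  have "\<exists>f\<in>hcarrier H. J f < I + 1 / Suc n" for n
  proof -
    have "\<exists>x\<in>J ` hcarrier H. x < I + 1 / Suc n"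
      unfolding I_def using zero_closed bdd by (subst cInf_less_iff[symmetric]) auto
    then show ?thesis by auto
  qed
  then obtain F where F: "\<And>n. F n \<in> hcarrier H" and JF: "\<And>n. J (F n) < I + 1 / Suc n" by metis
  have par: "(hnorm H (\<lambda>x. f x - g x))\<^sup>2 \<le> 2 * (J f - I) + 2 * (J g - I)"
    if f: "f \<in> hcarrier H" and g: "g \<in> hcarrier H" for f g
  proof -
    define h where "h = (\<lambda>x. (1/2) * (f x + g x))"
    have h: "h \<in> hcarrier H" unfolding h_def by (rule scale_closed[OF add_closed[OF f g]])
    have "l h = (1/2) * (l f + l g)"
      unfolding h_def using scale[OF add_closed[OF f g]] add[OF f g] by metis
    moreover have "hnorm H h = (1/2) * hnorm H (\<lambda>x. f x + g x)"
      unfolding h_def hnorm_scale[OF add_closed[OF f g]] by simp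
    ultimately have "4 * J h = (hnorm H (\<lambda>x. f x + g x))\<^sup>2 - 4 * Re (l f) - 4 * Re (l g)"
    proof -
      have "Re (l h) = (1/2) * (Re (l f) + Re (l g))" unfolding \<open>l h = _\<close> by simp
      then show ?thesis
        unfolding J_def \<open>hnorm H h = _\<close> power_mult_distrib by (simp add: power2_eq_square[of "1/2 :: real"])
    qed
    then show ?thesis
      using I_le[OF h] hnorm_sq_add[OF f g] hnorm_sq_diff[OF f g] by (simp add: J_def)
  qed
  have "\<exists>N. \<forall>m\<ge>N. \<forall>n\<ge>N. hnorm H (\<lambda>x. F m x - F n x) < e" if e: "0 < e" for e
  proof -
    obtain N :: nat where N: "4 / e\<^sup>2 < N" using reals_Archimedean2 by blast
    have "hnorm H (\<lambda>x. F m x - F n x) < e" if mn: "m \<ge> N" "n \<ge> N" for m n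
    proof (rule power2_less_imp_less)
      have N0: "0 < real N" using N e by (smt (verit) divide_nonneg_nonneg zero_le_power2)
      have J_le: "J (F k) - I < 1 / N" if "k \<ge> N" for k
      proof -
        have "1 / real (Suc k) \<le> 1 / real N" using that N0 by (intro divide_left_mono) auto
        then show ?thesis using JF[of k] by simp
      qed
      have "(hnorm H (\<lambda>x. F m x - F n x))\<^sup>2 < 4 / N"
        using par[OF F F, of m n] J_le[OF mn(1)] J_le[OF mn(2)] by simp
      also have "\<dots> < e\<^sup>2" using N N0 e by (simp add: field_simps)
      finally show "(hnorm H (\<lambda>x. F m x - F n x))\<^sup>2 < e\<^sup>2" .
    qed (use e in auto)
    then show ?thesis by blast
  qed
  from complete[OF F this] obtain h where h: "h \<in> hcarrier H"
    and lim: "(\<lambda>n. hnorm H (\<lambda>x. F n x - h x)) \<longlonglongrightarrow> 0" by auto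
  have l_diff: "l (\<lambda>x. f x - g x) = l f - l g" if "f \<in> hcarrier H" "g \<in> hcarrier H" for f g
    using add[OF that(1) scale_closed[OF that(2), of "-1"]] scale[OF that(2), of "-1"] by simp
  have "(\<lambda>n. J (F n)) \<longlonglongrightarrow> J h"
  proof -
    have "(\<lambda>n. l (F n)) \<longlonglongrightarrow> l h"
    proof (rule LIM_zero_cancel, rule Lim_null_comparison)
      show "eventually (\<lambda>n. norm (l (F n) - l h) \<le> B * hnorm H (\<lambda>x. F n x - h x)) sequentially"
        using bound[OF diff_closed[OF F h]] l_diff[OF F h] by simp
      show "(\<lambda>n. B * hnorm H (\<lambda>x. F n x - h x)) \<longlonglongrightarrow> 0"
        using tendsto_mult_right_zero[OF lim] by simp
    qed
    moreover have "(\<lambda>n. hnorm H (F n)) \<longlonglongrightarrow> hnorm H h"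
    proof (rule LIM_zero_cancel, rule Lim_null_comparison[OF _ lim])
      show "eventually (\<lambda>n. norm (hnorm H (F n) - hnorm H h) \<le> hnorm H (\<lambda>x. F n x - h x)) sequentially"
      proof (intro always_eventually allI)
        fix n show "norm (hnorm H (F n) - hnorm H h) \<le> hnorm H (\<lambda>x. F n x - h x)"
        using hnorm_triangle_diff[OF F h] hnorm_triangle_diff[OF h F] hnorm_minus_commute[OF h F]
        by (simp add: abs_le_iff algebra_simps)
      qed
    qed
    ultimately show ?thesis unfolding J_def by (intro tendsto_intros)
  qed
  moreover have "(\<lambda>n. I + 1 / Suc n) \<longlonglongrightarrow> I + 0"
    by (intro tendsto_intros LIMSEQ_inverse_real_of_nat[unfolded inverse_eq_divide])
  ultimately have Jh: "J h \<le> I"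
    using JF by (auto intro: LIMSEQ_le less_imp_le)
  have "l f = hinner H f h" if f: "f \<in> hcarrier H" for f
  proof (rule ccontr)
    \<comment> \<open>The direction \<open>k\<close> is chosen opposite to \<open>D\<close>, so that the linear term of \<open>J (h + k f)\<close> is negative;
        \<open>t\<close> is so small that the quadratic term cannot compensate it.\<close>
    define D where "D = hinner H f h - l f"
    assume "l f \<noteq> hinner H f h"
    then have D: "0 < (cmod D)\<^sup>2" by (simp add: D_def)
    define t where "t = 1 / (1 + (hnorm H f)\<^sup>2)"
    have t: "0 < t" "t * (hnorm H f)\<^sup>2 < 1" by (auto simp: t_def add_pos_nonneg field_simps)
    define k where "k = - of_real t * cnj D"
    have kf: "(\<lambda>x. k * f x) \<in> hcarrier H" by (rule scale_closed[OF f])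
    have "I \<le> J (\<lambda>x. h x + k * f x)" by (rule I_le[OF add_closed[OF h kf]])
    also have "\<dots> = J h + 2 * Re (cnj k * hinner H h f) + (cmod k)\<^sup>2 * (hnorm H f)\<^sup>2 - 2 * Re (k * l f)"
      by (simp add: J_def hnorm_sq_add_scale[OF h f] add[OF h kf] scale[OF f])
    also have "Re (cnj k * hinner H h f) = Re (k * hinner H f h)"
      by (subst inner_commute[OF f h]) (metis cnj.sel(1) complex_cnj_cnj complex_cnj_mult)
    also have "J h + 2 * Re (k * hinner H f h) + (cmod k)\<^sup>2 * (hnorm H f)\<^sup>2 - 2 * Re (k * l f)
        = J h + 2 * Re (k * D) + (cmod k)\<^sup>2 * (hnorm H f)\<^sup>2"
      by (simp add: D_def algebra_simps)
    also have "Re (k * D) = - t * (cmod D)\<^sup>2"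
      unfolding k_def cmod_power2 by (simp add: power2_eq_square algebra_simps)
    also have "(cmod k)\<^sup>2 = t\<^sup>2 * (cmod D)\<^sup>2" by (simp add: k_def norm_mult power_mult_distrib)
    finally have "2 * t * (cmod D)\<^sup>2 \<le> t\<^sup>2 * (cmod D)\<^sup>2 * (hnorm H f)\<^sup>2" using Jh by simp
    also have "\<dots> = (t * (hnorm H f)\<^sup>2) * (t * (cmod D)\<^sup>2)" by (simp add: power2_eq_square algebra_simps)
    also have "\<dots> < 1 * (t * (cmod D)\<^sup>2)"
      using t D by (intro mult_strict_right_mono) auto
    finally have "t * (cmod D)\<^sup>2 < 0" by simp
    then show False using t D by (simp add: mult_less_0_iff)
  qed
  then show ?thesis using h by auto
qed

lemma
  assumes T: "linear_op H T" and bound: "\<And>f. f \<in> hcarrier H \<Longrightarrow> hnorm H (T f) \<le> B * hnorm H f"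
    and B: "0 \<le> B"
  shows adjoint_closed: "g \<in> hcarrier H \<Longrightarrow> adjoint_op H T g \<in> hcarrier H"
    and adjoint_inner: "\<lbrakk>f \<in> hcarrier H; g \<in> hcarrier H\<rbrakk> \<Longrightarrow> hinner H (T f) g = hinner H f (adjoint_op H T g)"
    and adjoint_linear: "linear_op H (adjoint_op H T)"
    and adjoint_bound: "g \<in> hcarrier H \<Longrightarrow> hnorm H (adjoint_op H T g) \<le> B * hnorm H g"
proof -
  have TC: "T f \<in> hcarrier H" if "f \<in> hcarrier H" for f using T that by (auto simp: linear_op_def)
  have uniq: "h = h'" if h: "h \<in> hcarrier H" "h' \<in> hcarrier H"
    and eq: "\<And>f. f \<in> hcarrier H \<Longrightarrow> hinner H f h = hinner H f h'" for h h'
  proof -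
    have d: "(\<lambda>x. h x - h' x) \<in> hcarrier H" by (rule diff_closed[OF h])
    have "hinner H (\<lambda>x. h x - h' x) (\<lambda>x. h x - h' x) = 0"
      using eq[OF d] inner_diff_right[OF h d] by simp
    then have "(\<lambda>x. h x - h' x) = (\<lambda>x. 0)" by (intro definite[OF d]) (simp add: hnorm_def)
    then show ?thesis by (simp add: fun_eq_iff)
  qed
  have ex: "\<exists>!h. h \<in> hcarrier H \<and> (\<forall>f\<in>hcarrier H. hinner H (T f) g = hinner H f h)"
    if g: "g \<in> hcarrier H" for g
  proof -
    have "\<exists>h\<in>hcarrier H. \<forall>f\<in>hcarrier H. hinner H (T f) g = hinner H f h"
    proof (rule Riesz_representation)
      fix f f' assume "f \<in> hcarrier H" "f' \<in> hcarrier H"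
      then show "hinner H (T (\<lambda>x. f x + f' x)) g = hinner H (T f) g + hinner H (T f') g"
        using T inner_add_left[OF TC TC g] by (simp add: linear_op_def)
    next
      fix k f assume "f \<in> hcarrier H"
      then show "hinner H (T (\<lambda>x. k * f x)) g = k * hinner H (T f) g"
        using T inner_scale_left[OF TC g] by (simp add: linear_op_def)
    next
      fix f assume f: "f \<in> hcarrier H"
      have "cmod (hinner H (T f) g) \<le> hnorm H (T f) * hnorm H g" by (rule Cauchy_Schwarz[OF TC[OF f] g])
      also have "\<dots> \<le> (B * hnorm H f) * hnorm H g"
        by (rule mult_right_mono[OF bound[OF f] hnorm_nonneg[OF g]])
      finally show "cmod (hinner H (T f) g) \<le> (B * hnorm H g) * hnorm H f" by (simp add: mult_ac)
    qed
    then show ?thesis using uniq by metis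
  qed
  have adj: "adjoint_op H T g \<in> hcarrier H \<and> (\<forall>f\<in>hcarrier H. hinner H (T f) g = hinner H f (adjoint_op H T g))"
    if "g \<in> hcarrier H" for g
    unfolding adjoint_op_def by (rule theI'[OF ex[OF that]])
  show C: "adjoint_op H T g \<in> hcarrier H" if "g \<in> hcarrier H" for g using adj[OF that] by blast
  show I: "hinner H (T f) g = hinner H f (adjoint_op H T g)" if "f \<in> hcarrier H" "g \<in> hcarrier H" for f g
    using adj[OF that(2)] that(1) by blast
  show "linear_op H (adjoint_op H T)"
    unfolding linear_op_def
  proof (intro conjI ballI allI)
    fix f g assume f: "f \<in> hcarrier H" and g: "g \<in> hcarrier H"
    show "adjoint_op H T (\<lambda>x. f x + g x) = (\<lambda>x. adjoint_op H T f x + adjoint_op H T g x)"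
    proof (rule uniq)
      fix k assume k: "k \<in> hcarrier H"
      show "hinner H k (adjoint_op H T (\<lambda>x. f x + g x)) = hinner H k (\<lambda>x. adjoint_op H T f x + adjoint_op H T g x)"
        using I[OF k add_closed[OF f g]] I[OF k f] I[OF k g] inner_add_right[OF f g TC[OF k]]
          inner_add_right[OF C[OF f] C[OF g] k] by simp
    qed (intro C add_closed f g)+
  next
    fix k f assume f: "f \<in> hcarrier H"
    show "adjoint_op H T (\<lambda>x. k * f x) = (\<lambda>x. k * adjoint_op H T f x)"
    proof (rule uniq)
      fix g assume g: "g \<in> hcarrier H"
      show "hinner H g (adjoint_op H T (\<lambda>x. k * f x)) = hinner H g (\<lambda>x. k * adjoint_op H T f x)"
        using I[OF g scale_closed[OF f, of k]] I[OF g f] inner_scale_right[OF f TC[OF g]]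
          inner_scale_right[OF C[OF f] g] by simp
    qed (intro C scale_closed f)+
  qed (rule C)
  show "hnorm H (adjoint_op H T g) \<le> B * hnorm H g" if g: "g \<in> hcarrier H" for g
  proof -
    let ?h = "adjoint_op H T g"
    have h: "?h \<in> hcarrier H" by (rule C[OF g])
    have "(hnorm H ?h)\<^sup>2 = cmod (hinner H (T ?h) g)"
      unfolding I[OF h g] inner_self[OF h] norm_of_real by simp
    also have "\<dots> \<le> hnorm H (T ?h) * hnorm H g" by (rule Cauchy_Schwarz[OF TC[OF h] g])
    also have "\<dots> \<le> (B * hnorm H ?h) * hnorm H g"
      by (rule mult_right_mono[OF bound[OF h] hnorm_nonneg[OF g]])
    finally have "hnorm H ?h * hnorm H ?h \<le> hnorm H ?h * (B * hnorm H g)"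
      by (simp add: power2_eq_square mult_ac)
    then show ?thesis
      using hnorm_nonneg[OF h] hnorm_nonneg[OF g] B
      by (cases "hnorm H ?h = 0") auto
  qed
qed

end

section \<open>Rotations and mean values in the complex plane\<close>

lemma nn_integral_lborel_complex:
  fixes f :: "complex \<Rightarrow> ennreal"
  assumes [measurable]: "f \<in> borel_measurable borel"
  shows "(\<integral>\<^sup>+z. f z \<partial>lborel) = (\<integral>\<^sup>+y. \<integral>\<^sup>+x. f (Complex x y) \<partial>lborel \<partial>lborel)"
proof -
  define C where "C = (\<lambda>(x, y). Complex x y)"
  have [measurable]: "C \<in> borel \<rightarrow>\<^sub>M borel"
    unfolding C_def by (intro borel_measurable_continuous_onI continuous_intros) 
       (auto simp: case_prod_unfold Complex_eq intro!: continuous_intros)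
  have eq: "lborel = distr (lborel \<Otimes>\<^sub>M lborel) borel C"
  proof (rule lborel_eqI)
    fix l u :: complex
    assume le: "\<And>b. b \<in> Basis \<Longrightarrow> l \<bullet> b \<le> u \<bullet> b"
    have "C -` box l u \<inter> space (lborel \<Otimes>\<^sub>M lborel) = {Re l<..<Re u} \<times> {Im l<..<Im u}"
      by (auto simp: C_def box_def Basis_complex_def space_pair_measure)
    then have "emeasure (distr (lborel \<Otimes>\<^sub>M lborel) borel C) (box l u)
        = emeasure (lborel \<Otimes>\<^sub>M lborel) ({Re l<..<Re u} \<times> {Im l<..<Im u})"
      by (subst emeasure_distr) (auto simp: lborel_prod)
    also have "\<dots> = emeasure lborel {Re l<..<Re u} * emeasure lborel {Im l<..<Im u}"
      by (rule lborel.emeasure_pair_measure_Times) auto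
    also have "\<dots> = (\<Prod>b\<in>Basis. (u - l) \<bullet> b)"
      using le[of 1] le[of \<i>] by (simp add: Basis_complex_def ennreal_mult)
    finally show "emeasure (distr (lborel \<Otimes>\<^sub>M lborel) borel C) (box l u) = (\<Prod>b\<in>Basis. (u - l) \<bullet> b)" .
  qed simp
  have "(\<integral>\<^sup>+z. f z \<partial>lborel) = (\<integral>\<^sup>+p. f (C p) \<partial>(lborel \<Otimes>\<^sub>M lborel))"
    by (subst eq, subst nn_integral_distr) (auto simp: lborel_prod)
  also have "\<dots> = (\<integral>\<^sup>+y. \<integral>\<^sup>+x. f (C (x, y)) \<partial>lborel \<partial>lborel)"
    by (rule lborel_pair.nn_integral_snd[symmetric]) (auto simp: lborel_prod)
  finally show ?thesis by (simp add: C_def)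
qed

lemma measurable_Complex [measurable (raw)]:
  assumes [measurable]: "f \<in> borel_measurable M" "g \<in> borel_measurable M"
  shows "(\<lambda>x. Complex (f x) (g x)) \<in> borel_measurable M"
  unfolding Complex_eq by measurable

lemma nn_integral_lborel_translate:
  fixes f :: "real \<Rightarrow> ennreal"
  assumes [measurable]: "f \<in> borel_measurable borel"
  shows "(\<integral>\<^sup>+x. f (x + t) \<partial>lborel) = (\<integral>\<^sup>+x. f x \<partial>lborel)"
  using nn_integral_real_affine[of f 1 t] by (simp add: add.commute)

lemma nn_integral_lborel_shear_Re:
  fixes f :: "complex \<Rightarrow> ennreal"
  assumes [measurable]: "f \<in> borel_measurable borel"
  shows "(\<integral>\<^sup>+z. f (Complex (Re z + p * Im z) (Im z)) \<partial>lborel) = (\<integral>\<^sup>+z. f z \<partial>lborel)"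
  by (simp add: nn_integral_lborel_complex nn_integral_lborel_translate[where f = "\<lambda>x. f (Complex x _)"])

lemma nn_integral_lborel_shear_Im:
  fixes f :: "complex \<Rightarrow> ennreal"
  assumes [measurable]: "f \<in> borel_measurable borel"
  shows "(\<integral>\<^sup>+z. f (Complex (Re z) (Im z + p * Re z)) \<partial>lborel) = (\<integral>\<^sup>+z. f z \<partial>lborel)"
proof -
  have *: "(\<integral>\<^sup>+z. g z \<partial>lborel) = (\<integral>\<^sup>+x. \<integral>\<^sup>+y. g (Complex x y) \<partial>lborel \<partial>lborel)"
    if [measurable]: "g \<in> borel_measurable borel" for g :: "complex \<Rightarrow> ennreal"
    unfolding nn_integral_lborel_complex[OF that]
    by (rule lborel_pair.Fubini') simp
  show ?thesis
    by (simp add: * nn_integral_lborel_translate[where f = "\<lambda>y. f (Complex _ y)"])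
qed

text \<open>A rotation by an angle that is no multiple of \<open>\<pi>\<close> is a product of three shears, and a shear preserves
  the integral by translation invariance in one coordinate. A real \<open>u\<close> is the product of \<open>- \<i> u\<close> and \<open>\<i>\<close>.\<close>

lemma nn_integral_lborel_rotate:
  fixes f :: "complex \<Rightarrow> ennreal"
  assumes f [measurable]: "f \<in> borel_measurable borel" and u: "cmod u = 1"
  shows "(\<integral>\<^sup>+z. f (u * z) \<partial>lborel) = (\<integral>\<^sup>+z. f z \<partial>lborel)"
proof -
  have main: "(\<integral>\<^sup>+z. g (v * z) \<partial>lborel) = (\<integral>\<^sup>+z. g z \<partial>lborel)"
    if g [measurable]: "g \<in> borel_measurable borel" and v: "cmod v = 1" and "Im v \<noteq> 0" for g :: "complex \<Rightarrow> ennreal" and v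
  proof -
    define b where "b = Im v"
    define p where "p = (Re v - 1) / b"
    have b: "b \<noteq> 0" using that b_def by simp
    have a: "Re v = 1 + p * b" by (simp add: p_def b)
    have "(Re v)\<^sup>2 + b\<^sup>2 = 1" using v by (simp add: b_def cmod_def)
    then have "b * (p * (2 + p * b)) = b * (- b)" unfolding a by (simp add: power2_eq_square algebra_simps)
    then have pp: "p * (2 + p * b) = - b" using b mult_left_cancel by blast
    define S where "S = (\<lambda>z. Complex (Re z + p * Im z) (Im z))"
    define R where "R = (\<lambda>z. Complex (Re z) (Im z + b * Re z))"
    have [measurable]: "S \<in> borel_measurable borel" "R \<in> borel_measurable borel"
      unfolding S_def R_def by measurable
    have comp: "v * z = S (R (S z))" for z
    proof (rule complex_eqI)
      have "Re (S (R (S z))) = (1 + p * b) * Re z + p * (2 + p * b) * Im z"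
        by (simp add: S_def R_def algebra_simps)
      then show "Re (v * z) = Re (S (R (S z)))" by (simp add: a pp flip: b_def)
      show "Im (v * z) = Im (S (R (S z)))"
        by (simp add: S_def R_def a flip: b_def) (simp add: algebra_simps)
    qed
    have "(\<integral>\<^sup>+z. g (S (R (S z))) \<partial>lborel) = (\<integral>\<^sup>+z. g (S (R z)) \<partial>lborel)"
      unfolding S_def by (rule nn_integral_lborel_shear_Re) (simp flip: S_def)
    also have "\<dots> = (\<integral>\<^sup>+z. g (S z) \<partial>lborel)"
      unfolding R_def by (rule nn_integral_lborel_shear_Im) simp
    also have "\<dots> = (\<integral>\<^sup>+z. g z \<partial>lborel)"
      unfolding S_def by (rule nn_integral_lborel_shear_Re) simp
    finally show ?thesis by (simp add: comp)
  qed
  show ?thesis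
  proof (cases "Im u = 0")
    case False
    with u show ?thesis by (intro main) auto
  next
    case True
    have "(\<integral>\<^sup>+z. f (u * z) \<partial>lborel) = (\<integral>\<^sup>+z. f ((- \<i> * u) * (\<i> * z)) \<partial>lborel)"
      by (simp add: algebra_simps)
    also have "\<dots> = (\<integral>\<^sup>+z. f ((- \<i> * u) * z) \<partial>lborel)"
      by (rule main) auto
    also have "\<dots> = (\<integral>\<^sup>+z. f z \<partial>lborel)"
    proof (rule main)
      show "Im (- \<i> * u) \<noteq> 0" using True u by (auto simp: cmod_def)
    qed (use u in \<open>auto simp: norm_mult\<close>)
    finally show ?thesis .
  qed
qed

lemma distr_lborel_rotate:
  assumes u: "cmod u = 1"
  shows "distr lborel borel (\<lambda>z. u * z) = (lborel :: complex measure)"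
proof (rule measure_eqI)
  fix A :: "complex set" assume "A \<in> sets (distr lborel borel (\<lambda>z. u * z))"
  then have [measurable]: "A \<in> sets borel" by simp
  show "emeasure (distr lborel borel (\<lambda>z. u * z)) A = emeasure lborel A"
    using nn_integral_lborel_rotate[OF _ u, of "indicator A"]
    by (simp flip: nn_integral_indicator add: nn_integral_distr)
qed simp

text \<open>Rotating by \<open>cis (1 / n)\<close> multiplies the integral by \<open>cis 1 \<noteq> 1\<close>.\<close>

lemma integral_power_ball_eq_0:
  assumes "n > 0"
  shows "(LINT z:ball 0 r|lborel. z ^ n) = (0 :: complex)"
proof -
  define u where "u = cis (1 / real n)"
  define I where "I = (LINT z:ball 0 r|lborel. (z :: complex) ^ n)"
  have "I = (LINT z:ball 0 r|distr lborel borel (\<lambda>z. u * z). z ^ n)"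
    unfolding I_def by (subst distr_lborel_rotate) (auto simp: u_def)
  also have "\<dots> = (LINT z:ball 0 r|lborel. (u * z) ^ n)"
    unfolding set_lebesgue_integral_def
    by (subst integral_distr) (auto simp: u_def norm_mult indicator_def)
  also have "\<dots> = u ^ n * I"
    unfolding I_def set_lebesgue_integral_def
    by (simp add: power_mult_distrib mult.left_commute flip: integral_mult_right_zero)
  finally have "(1 - u ^ n) * I = 0" by (simp add: algebra_simps)
  moreover have "u ^ n = cis 1" using assms Complex.DeMoivre[of "1 / real n" n] by (simp add: u_def)
  moreover have "cis 1 \<noteq> 1"
  proof
    assume "cis 1 = 1"
    then have "sin 1 = (0 :: real)" by (metis cis.simps(2) one_complex.simps(2))
    then show False using sin_gt_zero[of "1 :: real"] pi_gt3 by simp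
  qed
  ultimately show ?thesis unfolding I_def by auto
qed

text \<open>Only the constant term of the power series contributes to the integral.\<close>

lemma area_mean_value:
  assumes hol: "g holomorphic_on ball 0 R" and r: "0 < r" "r < R"
  shows "(LINT z:ball 0 r|lborel. g z) = of_real (pi * r\<^sup>2) * g 0"
proof -
  define a where "a n = (deriv ^^ n) g 0 / fact n" for n
  have sums: "(\<lambda>n. a n * z ^ n) sums g z" if "z \<in> ball 0 R" for z
    using holomorphic_power_series[OF hol that] by (simp add: a_def)
  have abs: "summable (\<lambda>n. norm (a n * of_real r ^ n))"
  proof (rule powser_insidea)
    show "summable (\<lambda>n. a n * of_real ((r + R) / 2) ^ n)"
    proof (rule sums_summable[OF sums])
      show "of_real ((r + R) / 2) \<in> ball (0 :: complex) R"
        using r by (simp only: mem_ball dist_0_norm norm_of_real) simp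
    qed
    show "norm (of_real r :: complex) < norm (of_real ((r + R) / 2) :: complex)"
      using r by (simp only: norm_of_real) simp
  qed
  define B where "B = ball (0 :: complex) r"
  have B: "B \<in> sets lborel" "emeasure lborel B < \<infinity>" unfolding B_def by (simp, rule emeasure_lborel_ball_finite)
  have mB: "measure lborel B = pi * r\<^sup>2"
    using content_ball[of r "0 :: complex"] r unfolding B_def by (simp add: eval_unit_ball_vol)
  have int: "integrable lborel (\<lambda>z. indicator B z *\<^sub>R (a n * z ^ n))" for n
  proof (rule integrableI_bounded_set[where A = B and B = "norm (a n) * r ^ n"])
    show "AE x in lborel. x \<in> B \<longrightarrow> norm (indicator B x *\<^sub>R (a n * x ^ n)) \<le> norm (a n) * r ^ n"
      by (auto simp: B_def norm_mult norm_power intro!: mult_left_mono power_mono)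
  qed (use B in auto)
  have le: "norm (indicator B z *\<^sub>R (a n * z ^ n)) \<le> indicator B z * norm (a n * of_real r ^ n)" for n z
    by (auto simp: B_def indicator_def norm_mult norm_power intro!: mult_left_mono power_mono)
  have norm_le: "(LINT z|lborel. norm (indicator B z *\<^sub>R (a n * z ^ n))) \<le> measure lborel B * norm (a n * of_real r ^ n)" for n
  proof -
    have "(LINT z|lborel. norm (indicator B z *\<^sub>R (a n * z ^ n)))
        \<le> (LINT z|lborel. indicator B z * norm (a n * of_real r ^ n))"
      by (rule integral_mono[OF integrable_norm[OF int] _ le]) (use B in auto)
    then show ?thesis by simp
  qed
  have "(LINT z:B|lborel. g z) = (LINT z|lborel. (\<Sum>n. indicator B z *\<^sub>R (a n * z ^ n)))"
    unfolding set_lebesgue_integral_def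
  proof (rule Bochner_Integration.integral_cong[OF refl])
    fix z show "indicator B z *\<^sub>R g z = (\<Sum>n. indicator B z *\<^sub>R (a n * z ^ n))"
      using sums[of z] r by (cases "z \<in> B") (auto simp: B_def sums_iff)
  qed
  also have "\<dots> = (\<Sum>n. LINT z|lborel. indicator B z *\<^sub>R (a n * z ^ n))"
  proof (rule integral_suminf[OF int])
    show "AE z in lborel. summable (\<lambda>n. norm (indicator B z *\<^sub>R (a n * z ^ n)))"
    proof (rule AE_I2)
      fix z show "summable (\<lambda>n. norm (indicator B z *\<^sub>R (a n * z ^ n)))"
        by (rule summable_comparison_test'[OF summable_mult[OF abs, of "indicator B z"]]) (use le in auto)
    qed
    show "summable (\<lambda>n. LINT z|lborel. norm (indicator B z *\<^sub>R (a n * z ^ n)))"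
      by (rule summable_comparison_test'[OF summable_mult[OF abs, of "measure lborel B"]]) (use norm_le in auto)
  qed
  also have "\<dots> = (\<Sum>n. a n * (LINT z:B|lborel. z ^ n))"
    unfolding set_lebesgue_integral_def by (simp add: mult.left_commute flip: integral_mult_right_zero)
  also have "\<dots> = (\<Sum>n\<in>{0}. a n * (LINT z:B|lborel. z ^ n))"
    by (rule suminf_finite) (auto simp: B_def integral_power_ball_eq_0)
  also have "\<dots> = of_real (pi * r\<^sup>2) * g 0"
    using mB B by (simp add: a_def set_lebesgue_integral_def scaleR_conv_of_real)
  finally show ?thesis by (simp add: B_def)
qed

text \<open>The integral of \<open>\<bar>g - g z0\<bar>\<^sup>2\<close> is nonnegative; expanding the square, the mean value property evaluates
  the mixed term.\<close>

lemma norm_sq_le_area_mean: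
  assumes hol: "g holomorphic_on ball z0 R" and r: "0 < r" "r < R"
  shows "ennreal (pi * r\<^sup>2 * (cmod (g z0))\<^sup>2) \<le> (\<integral>\<^sup>+z\<in>ball z0 r. ennreal ((cmod (g z))\<^sup>2) \<partial>lborel)"
proof -
  define G where "G w = g (z0 + w)" for w
  have holG: "G holomorphic_on ball 0 R"
    unfolding G_def by (rule holomorphic_on_compose_gen[OF _ hol, unfolded o_def]) (auto intro!: holomorphic_intros simp: dist_norm)
  define B where "B = ball (0 :: complex) r"
  have B: "B \<in> sets lborel" "emeasure lborel B < \<infinity>" unfolding B_def by (simp, rule emeasure_lborel_ball_finite)
  have mB: "measure lborel B = pi * r\<^sup>2"
    using content_ball[of r "0 :: complex"] r unfolding B_def by (simp add: eval_unit_ball_vol)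
  have cont: "continuous_on (cball 0 r) G"
    using holomorphic_on_imp_continuous_on[OF holG] by (rule continuous_on_subset) (use r in auto)
  have int: "set_integrable lborel B F" if "continuous_on (cball 0 r) F" for F :: "complex \<Rightarrow> complex"
    by (rule set_integrable_subset[OF borel_integrable_compact[OF _ that, folded set_integrable_def]])
       (auto simp: B_def)
  have intR: "set_integrable lborel B F" if "continuous_on (cball 0 r) F" for F :: "complex \<Rightarrow> real"
    by (rule set_integrable_subset[OF borel_integrable_compact[OF _ that, folded set_integrable_def]])
       (auto simp: B_def)
  have expand: "(cmod (G w - G 0))\<^sup>2 = (cmod (G w))\<^sup>2 - 2 * Re (cnj (G 0) * G w) + (cmod (G 0))\<^sup>2" for w
    unfolding cmod_power2 by (simp add: power2_eq_square algebra_simps)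
  have mean: "(LINT w:B|lborel. G w) = of_real (pi * r\<^sup>2) * G 0"
    unfolding B_def by (rule area_mean_value[OF holG r])
  have "0 \<le> (LINT w:B|lborel. (cmod (G w - G 0))\<^sup>2)"
    unfolding set_lebesgue_integral_def by (intro Bochner_Integration.integral_nonneg) auto
  also have "\<dots> = (LINT w:B|lborel. (cmod (G w))\<^sup>2) - 2 * (LINT w:B|lborel. Re (cnj (G 0) * G w)) + (LINT w:B|lborel. (cmod (G 0))\<^sup>2)"
    unfolding expand
    by (subst set_integral_add, (intro intR set_integral_diff continuous_intros cont)+, subst set_integral_diff,
        (intro intR continuous_intros cont)+, subst set_integral_mult_right, rule refl)
  also have "(LINT w:B|lborel. Re (cnj (G 0) * G w)) = Re (LINT w:B|lborel. cnj (G 0) * G w)"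
  proof -
    have "integrable lborel (\<lambda>w. indicator B w *\<^sub>R (cnj (G 0) * G w))"
      by (rule int[unfolded set_integrable_def]) (intro continuous_intros cont)
    from integral_Re[OF this] show ?thesis
      unfolding set_lebesgue_integral_def scaleR_complex.sel real_scaleR_def .
  qed
  also have "(LINT w:B|lborel. cnj (G 0) * G w) = cnj (G 0) * (LINT w:B|lborel. G w)"
    by simp
  also have "Re \<dots> = pi * r\<^sup>2 * (cmod (G 0))\<^sup>2"
    unfolding mean cmod_power2 by (simp add: power2_eq_square algebra_simps)
  also have "(LINT w:B|lborel. (cmod (G 0))\<^sup>2) = pi * r\<^sup>2 * (cmod (G 0))\<^sup>2"
    using mB by (simp add: set_lebesgue_integral_def)
  finally have le: "pi * r\<^sup>2 * (cmod (G 0))\<^sup>2 \<le> (LINT w:B|lborel. (cmod (G w))\<^sup>2)" by simp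
  have "ennreal (pi * r\<^sup>2 * (cmod (G 0))\<^sup>2) \<le> ennreal (LINT w:B|lborel. (cmod (G w))\<^sup>2)"
    using le by (rule ennreal_leI)
  also have "\<dots> = (\<integral>\<^sup>+w\<in>B. ennreal ((cmod (G w))\<^sup>2) \<partial>lborel)"
    unfolding set_lebesgue_integral_def
  proof (subst nn_integral_eq_integral[symmetric])
    show "integrable lborel (\<lambda>w. indicator B w *\<^sub>R (cmod (G w))\<^sup>2)"
      by (rule intR[unfolded set_integrable_def]) (intro continuous_intros cont)
  qed (auto simp: indicator_def intro!: nn_integral_cong)
  also have "\<dots> = (\<integral>\<^sup>+w. ennreal ((cmod (g w))\<^sup>2) * indicator (ball z0 r) w \<partial>distr lborel borel ((+) z0))"
  proof (subst nn_integral_distr)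
    have "continuous_on (ball z0 r) g"
      using holomorphic_on_imp_continuous_on[OF hol] by (rule continuous_on_subset) (use r in auto)
    then have "(\<lambda>w. indicator (ball z0 r) w *\<^sub>R (cmod (g w))\<^sup>2) \<in> borel_measurable borel"
      by (intro borel_measurable_continuous_on_indicator continuous_intros) auto
    then have "(\<lambda>w. ennreal (indicator (ball z0 r) w *\<^sub>R (cmod (g w))\<^sup>2)) \<in> borel_measurable borel"
      by measurable
    then show "(\<lambda>w. ennreal ((cmod (g w))\<^sup>2) * indicator (ball z0 r) w) \<in> borel_measurable (distr lborel borel ((+) z0))"
      by (simp add: indicator_mult_ennreal mult.commute)
  qed (auto simp: G_def B_def indicator_def dist_norm intro!: nn_integral_cong)
  also have "distr lborel borel ((+) z0) = (lborel :: complex measure)"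
    by (rule lborel_distr_plus)
  finally show ?thesis by (simp add: G_def)
qed

section \<open>The weighted area of Euclidean balls\<close>

lemma ball_sets_borel [measurable]: "ball (p :: complex) t \<in> sets borel"
  by simp

lemma nn_integral_powr_to_right_end:
  fixes \<alpha> :: real
  assumes \<alpha>: "-1 < \<alpha>" and L: "q - l \<le> L" "0 \<le> L"
  shows "(\<integral>\<^sup>+x. indicator {l<..<q} x * ennreal ((q - x) powr \<alpha>) \<partial>lborel)
    \<le> ennreal (L powr (1 + \<alpha>) / (1 + \<alpha>))"
proof -
  have "(\<integral>\<^sup>+x. indicator {l<..<q} x * ennreal ((q - x) powr \<alpha>) \<partial>lborel)
      = (\<integral>\<^sup>+x. indicator {l<..<q} (q + (-1) * x) * ennreal ((q - (q + (-1) * x)) powr \<alpha>) \<partial>lborel)"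
    by (subst nn_integral_real_affine[where c = "-1" and t = q]) auto
  also have "\<dots> \<le> (\<integral>\<^sup>+x. ennreal (indicator {0..L} x * x powr \<alpha>) \<partial>lborel)"
    using L by (intro nn_integral_mono) (auto simp: indicator_def)
  also have "\<dots> = ennreal (L powr (\<alpha> + 1) / (\<alpha> + 1))"
    by (rule nn_integral_has_integral_lebesgue[OF _ has_integral_powr_from_0[OF \<alpha> L(2)]]) auto
  finally show ?thesis by (simp add: add.commute)
qed

text \<open>The constant is uniform in the centre. Away from the circle the weight is bounded. Near the circle
  the ball lies in \<open>Re z > 1/4\<close>, where \<open>1 - \<bar>z\<bar>\<^sup>2 \<ge> (s - x) / 4\<close> for \<open>s = sqrt (1 - y\<^sup>2)\<close>, the
  abscissa of the circle at height \<open>y\<close>. The horizontal slices have length at most \<open>2 t\<close>, and each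
  contributes at most a constant times \<open>t\<^sup>1\<^sup>+\<^sup>\<alpha>\<close>.\<close>

lemma weight_integral_ball_pos_le:
  fixes \<alpha> :: real
  assumes \<alpha>: "-1 < \<alpha>" "\<alpha> < 0" and p: "0 \<le> p" and t: "0 < t" "t \<le> 1/4"
  shows "(\<integral>\<^sup>+z\<in>ball (of_real p) t \<inter> unit_disc. ennreal ((1 - (cmod z)\<^sup>2) powr \<alpha>) \<partial>lborel)
    \<le> ennreal (4 * (1/4) powr \<alpha> / (1 + \<alpha>) * 2 powr (1 + \<alpha>) * t powr (2 + \<alpha>))"
proof (cases "p < 1/2")
  case True
  have "(\<integral>\<^sup>+z\<in>ball (of_real p) t \<inter> unit_disc. ennreal ((1 - (cmod z)\<^sup>2) powr \<alpha>) \<partial>lborel)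
      \<le> (\<integral>\<^sup>+z. ennreal ((1/4) powr \<alpha>) * indicator (ball (complex_of_real p) t) z \<partial>lborel)"
  proof (rule nn_integral_mono)
    fix z :: complex
    show "ennreal ((1 - (cmod z)\<^sup>2) powr \<alpha>) * indicator (ball (of_real p) t \<inter> unit_disc) z
        \<le> ennreal ((1/4) powr \<alpha>) * indicator (ball (of_real p) t) z"
    proof (cases "z \<in> ball (of_real p) t")
      case z: True
      have "cmod z \<le> cmod (of_real p) + cmod (z - of_real p)" by (rule norm_triangle_sub)
      then have "cmod z \<le> 3/4" using z True t p by (simp add: dist_norm norm_minus_commute)
      then have "(cmod z)\<^sup>2 \<le> (3/4)\<^sup>2" by (rule power_mono) auto
      then have "(1 - (cmod z)\<^sup>2) powr \<alpha> \<le> (1/4) powr \<alpha>"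
        using \<alpha> by (intro powr_mono2') (auto simp: power2_eq_square)
      then show ?thesis by (auto simp: indicator_def intro: ennreal_leI)
    qed auto
  qed
  also have "\<dots> = ennreal ((1/4) powr \<alpha> * (pi * t\<^sup>2))"
    using emeasure_ball[of t "complex_of_real p"] t by (simp add: nn_integral_cmult_indicator ennreal_mult eval_unit_ball_vol)
  also have "\<dots> \<le> ennreal (4 * (1/4) powr \<alpha> / (1 + \<alpha>) * 2 powr (1 + \<alpha>) * t powr (2 + \<alpha>))"
  proof (rule ennreal_leI)
    have "t\<^sup>2 = t powr 2" using t by (simp add: powr_numeral)
    also have "\<dots> \<le> t powr (2 + \<alpha>)" using t \<alpha> by (intro powr_mono') auto
    finally have 1: "t\<^sup>2 \<le> t powr (2 + \<alpha>)" .
    have 2: "1 \<le> 1 / (1 + \<alpha>)" "1 \<le> 2 powr (1 + \<alpha>)" using \<alpha> by (auto simp: field_simps ge_one_powr_ge_zero)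
    have "pi * t\<^sup>2 \<le> 4 * t powr (2 + \<alpha>)"
      using 1 pi_less_4 by (intro mult_mono) auto
    also have "\<dots> \<le> (4 * t powr (2 + \<alpha>)) * (1 / (1 + \<alpha>) * 2 powr (1 + \<alpha>))"
    proof -
      have "1 * 1 \<le> 1 / (1 + \<alpha>) * 2 powr (1 + \<alpha>)" by (rule mult_mono) (use 2 \<alpha> in auto)
      then show ?thesis using mult_left_mono[of 1 "1 / (1 + \<alpha>) * 2 powr (1 + \<alpha>)" "4 * t powr (2 + \<alpha>)"] by simp
    qed
    finally have "(1/4) powr \<alpha> * (pi * t\<^sup>2) \<le> (1/4) powr \<alpha> * ((4 * t powr (2 + \<alpha>)) * (1 / (1 + \<alpha>) * 2 powr (1 + \<alpha>)))"
      by (rule mult_left_mono) auto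
    then show "(1/4) powr \<alpha> * (pi * t\<^sup>2) \<le> 4 * (1/4) powr \<alpha> / (1 + \<alpha>) * 2 powr (1 + \<alpha>) * t powr (2 + \<alpha>)"
      by (simp add: mult_ac)
  qed
  finally show ?thesis .
next
  case False
  \<comment> \<open>The right end of the slice at height \<open>y\<close>. Lowering the end of integration from \<open>sqrt (1 - y\<^sup>2)\<close> to
      \<open>q y\<close> only increases the integrand, as \<open>\<alpha> < 0\<close>.\<close>
  define q where "q y = min (sqrt (1 - y\<^sup>2)) (p + t)" for y
  define F where "F y x = ennreal (indicator {-t<..<t} y * (1/4) powr \<alpha>) * (indicator {p - t<..<q y} x * ennreal ((q y - x) powr \<alpha>))" for x y
  have [measurable]: "q \<in> borel_measurable borel" unfolding q_def by measurable
  have pt: "ennreal ((1 - (cmod (Complex x y))\<^sup>2) powr \<alpha>) * indicator (ball (of_real p) t \<inter> unit_disc) (Complex x y) \<le> F y x" for x y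
  proof (cases "Complex x y \<in> ball (of_real p) t \<inter> unit_disc")
    case True
    have "\<bar>Re (Complex x y - of_real p)\<bar> \<le> cmod (Complex x y - of_real p)" "\<bar>Im (Complex x y - of_real p)\<bar> \<le> cmod (Complex x y - of_real p)"
      by (rule abs_Re_le_cmod, rule abs_Im_le_cmod)
    then have xy: "\<bar>x - p\<bar> < t" "\<bar>y\<bar> < t" using True by (auto simp: dist_norm norm_minus_commute)
    have lt: "x\<^sup>2 + y\<^sup>2 < 1" using True by (simp add: cmod_def)
    have x: "1/4 < x" using xy False t by auto
    have "0 \<le> 1 - y\<^sup>2" using lt by (smt (verit) zero_le_power2)
    then have s: "(sqrt (1 - y\<^sup>2))\<^sup>2 = 1 - y\<^sup>2" by simp
    have "x < sqrt (1 - y\<^sup>2)" using lt by (intro real_less_rsqrt) auto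
    then have xq: "x < q y" using xy by (auto simp: q_def)
    have "1/4 * (q y - x) \<le> (sqrt (1 - y\<^sup>2) + x) * (sqrt (1 - y\<^sup>2) - x)"
      using x xq by (intro mult_mono) (auto simp: q_def intro: add_increasing)
    also have "\<dots> = 1 - (cmod (Complex x y))\<^sup>2"
    proof -
      have "(S + x) * (S - x) = S\<^sup>2 - x\<^sup>2" for S by (simp add: algebra_simps power2_eq_square)
      then show ?thesis unfolding cmod_power2 complex.sel by (simp only: s)
    qed
    finally have "(1 - (cmod (Complex x y))\<^sup>2) powr \<alpha> \<le> (1/4 * (q y - x)) powr \<alpha>"
      using xq \<alpha> by (intro powr_mono2') auto
    also have "\<dots> = (1/4) powr \<alpha> * (q y - x) powr \<alpha>" using xq by (intro powr_mult) 
    finally have "ennreal ((1 - (cmod (Complex x y))\<^sup>2) powr \<alpha>) \<le> ennreal ((1/4) powr \<alpha>) * ennreal ((q y - x) powr \<alpha>)"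
      by (subst ennreal_mult[symmetric]) (auto intro: ennreal_leI)
    moreover have "x \<in> {p - t<..<q y}" "y \<in> {-t<..<t}" using xy xq by auto
    ultimately show ?thesis unfolding F_def using True by (simp only: indicator_simps mult_1 mult_1_right)
  qed auto
  have "(\<integral>\<^sup>+z\<in>ball (of_real p) t \<inter> unit_disc. ennreal ((1 - (cmod z)\<^sup>2) powr \<alpha>) \<partial>lborel)
      \<le> (\<integral>\<^sup>+y. \<integral>\<^sup>+x. F y x \<partial>lborel \<partial>lborel)"
    by (subst nn_integral_lborel_complex) (use pt in \<open>auto intro!: nn_integral_mono\<close>)
  also have "\<dots> \<le> (\<integral>\<^sup>+y. ennreal (indicator {-t<..<t} y * (1/4) powr \<alpha>) * ennreal ((2 * t) powr (1 + \<alpha>) / (1 + \<alpha>)) \<partial>lborel)"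
  proof (rule nn_integral_mono)
    fix y :: real
    have "(\<integral>\<^sup>+x. F y x \<partial>lborel) = ennreal (indicator {-t<..<t} y * (1/4) powr \<alpha>) * (\<integral>\<^sup>+x. indicator {p - t<..<q y} x * ennreal ((q y - x) powr \<alpha>) \<partial>lborel)"
      unfolding F_def by (rule nn_integral_cmult) measurable
    also have "\<dots> \<le> ennreal (indicator {-t<..<t} y * (1/4) powr \<alpha>) * ennreal ((2 * t) powr (1 + \<alpha>) / (1 + \<alpha>))"
      using t by (intro mult_left_mono nn_integral_powr_to_right_end \<alpha>) (auto simp: q_def)
    finally show "(\<integral>\<^sup>+x. F y x \<partial>lborel) \<le> ennreal (indicator {-t<..<t} y * (1/4) powr \<alpha>) * ennreal ((2 * t) powr (1 + \<alpha>) / (1 + \<alpha>))" .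
  qed
  also have "\<dots> = (\<integral>\<^sup>+y. ennreal ((1/4) powr \<alpha> * ((2 * t) powr (1 + \<alpha>) / (1 + \<alpha>))) * indicator {-t<..<t} y \<partial>lborel)"
    using \<alpha> by (intro nn_integral_cong) (auto simp: indicator_def simp flip: ennreal_mult)
  also have "\<dots> = ennreal ((1/4) powr \<alpha> * ((2 * t) powr (1 + \<alpha>) / (1 + \<alpha>)) * (2 * t))"
    using t \<alpha> by (simp add: nn_integral_cmult_indicator flip: ennreal_mult)
  also have "(1/4) powr \<alpha> * ((2 * t) powr (1 + \<alpha>) / (1 + \<alpha>)) * (2 * t) = 2 * (1/4) powr \<alpha> / (1 + \<alpha>) * 2 powr (1 + \<alpha>) * t powr (2 + \<alpha>)"
  proof -
    have "t powr (2 + \<alpha>) = t powr (1 + \<alpha>) * t powr 1" unfolding powr_add[symmetric] by simp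
    then have "t powr (2 + \<alpha>) = t powr (1 + \<alpha>) * t" using t by simp
    then show ?thesis using t by (simp add: powr_mult)
  qed
  also have "ennreal \<dots> \<le> ennreal (4 * (1/4) powr \<alpha> / (1 + \<alpha>) * 2 powr (1 + \<alpha>) * t powr (2 + \<alpha>))"
    using \<alpha> t by (intro ennreal_leI mult_right_mono divide_right_mono) auto
  finally show ?thesis .
qed

text \<open>A rotation moves the centre to the nonnegative real axis.\<close>

lemma weight_integral_small_ball_le:
  fixes \<alpha> :: real
  assumes \<alpha>: "-1 < \<alpha>" "\<alpha> < 0" and t: "0 < t" "t \<le> 1/4"
  shows "(\<integral>\<^sup>+z\<in>ball p t \<inter> unit_disc. ennreal ((1 - (cmod z)\<^sup>2) powr \<alpha>) \<partial>lborel)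
    \<le> ennreal (4 * (1/4) powr \<alpha> / (1 + \<alpha>) * 2 powr (1 + \<alpha>) * t powr (2 + \<alpha>))"
proof -
  define u where "u = (if p = 0 then 1 else sgn p)"
  have u: "cmod u = 1" by (auto simp: u_def norm_sgn)
  have p: "p = u * of_real (cmod p)" by (auto simp: u_def sgn_eq)
  have "dist p (u * z) = dist (of_real (cmod p)) z" for z
  proof -
    have "p - u * z = u * (of_real (cmod p) - z)" by (subst p) (simp add: algebra_simps)
    then show ?thesis by (simp add: dist_norm norm_mult u)
  qed
  then have "(\<integral>\<^sup>+z\<in>ball (of_real (cmod p)) t \<inter> unit_disc. ennreal ((1 - (cmod z)\<^sup>2) powr \<alpha>) \<partial>lborel)
     = (\<integral>\<^sup>+z. ennreal ((1 - (cmod (u * z))\<^sup>2) powr \<alpha>) * indicator (ball p t \<inter> unit_disc) (u * z) \<partial>lborel)"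
    by (intro nn_integral_cong) (auto simp: indicator_def norm_mult u)
  also have "\<dots> = (\<integral>\<^sup>+z\<in>ball p t \<inter> unit_disc. ennreal ((1 - (cmod z)\<^sup>2) powr \<alpha>) \<partial>lborel)"
    by (rule nn_integral_lborel_rotate[OF _ u]) measurable
  finally show ?thesis
    using weight_integral_ball_pos_le[OF \<alpha> norm_ge_zero t, of p] by simp
qed

text \<open>The disc is covered by finitely many balls of radius \<open>1/4\<close>.\<close>

lemma weight_integral_disc_finite:
  fixes \<alpha> :: real
  assumes \<alpha>: "-1 < \<alpha>" "\<alpha> < 0"
  shows "(\<integral>\<^sup>+z\<in>unit_disc. ennreal ((1 - (cmod z)\<^sup>2) powr \<alpha>) \<partial>lborel) < \<infinity>"
proof -
  obtain P where P: "finite P" "cball 0 1 \<subseteq> (\<Union>p\<in>P. ball p (1/4 :: real))" and "P \<subseteq> cball (0 :: complex) 1"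
  proof (rule compactE_image)
    show "compact (cball (0 :: complex) 1)" by (rule compact_cball)
    show "cball 0 1 \<subseteq> (\<Union>p\<in>cball (0 :: complex) 1. ball p (1/4 :: real))"
      by (intro subsetI UN_I) auto
  qed auto
  have "(\<integral>\<^sup>+z\<in>unit_disc. ennreal ((1 - (cmod z)\<^sup>2) powr \<alpha>) \<partial>lborel)
      \<le> (\<integral>\<^sup>+z. (\<Sum>p\<in>P. ennreal ((1 - (cmod z)\<^sup>2) powr \<alpha>) * indicator (ball p (1/4) \<inter> unit_disc) z) \<partial>lborel)"
  proof (rule nn_integral_mono)
    fix z :: complex
    show "ennreal ((1 - (cmod z)\<^sup>2) powr \<alpha>) * indicator unit_disc z
        \<le> (\<Sum>p\<in>P. ennreal ((1 - (cmod z)\<^sup>2) powr \<alpha>) * indicator (ball p (1/4) \<inter> unit_disc) z)"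
    proof (cases "z \<in> unit_disc")
      case True
      then obtain p where p: "p \<in> P" "z \<in> ball p (1/4)" using P(2) by force
      have "ennreal ((1 - (cmod z)\<^sup>2) powr \<alpha>) * indicator (ball p (1/4) \<inter> unit_disc) z
          \<le> (\<Sum>p\<in>P. ennreal ((1 - (cmod z)\<^sup>2) powr \<alpha>) * indicator (ball p (1/4) \<inter> unit_disc) z)"
        by (rule member_le_sum[OF p(1)]) (use P in auto)
      then show ?thesis using p True by simp
    qed auto
  qed
  also have "\<dots> = (\<Sum>p\<in>P. \<integral>\<^sup>+z\<in>ball p (1/4) \<inter> unit_disc. ennreal ((1 - (cmod z)\<^sup>2) powr \<alpha>) \<partial>lborel)"
    by (rule nn_integral_sum) measurable
  also have "\<dots> < \<infinity>"
  proof -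
    have "(\<integral>\<^sup>+z\<in>ball p (1/4) \<inter> unit_disc. ennreal ((1 - (cmod z)\<^sup>2) powr \<alpha>) \<partial>lborel) < \<infinity>" for p
      by (rule order.strict_trans1[OF weight_integral_small_ball_le[OF \<alpha>] _]) auto
    then have "(\<integral>\<^sup>+z\<in>ball p (1/4) \<inter> unit_disc. ennreal ((1 - (cmod z)\<^sup>2) powr \<alpha>) \<partial>lborel) \<noteq> top" for p
      by (simp add: less_top)
    then show ?thesis using P(1) by (simp add: less_top[symmetric])
  qed
  finally show ?thesis .
qed

text \<open>The Carleson-type estimate behind all upper bounds below; large balls are controlled by the total
  mass.\<close>

lemma weight_integral_ball_le:
  fixes \<alpha> :: real
  assumes \<alpha>: "-1 < \<alpha>" "\<alpha> < 0"
  obtains C where "0 < C" "\<And>p t. 0 < t \<Longrightarrow>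
    (\<integral>\<^sup>+z\<in>ball p t \<inter> unit_disc. ennreal ((1 - (cmod z)\<^sup>2) powr \<alpha>) \<partial>lborel) \<le> ennreal (C * t powr (2 + \<alpha>))"
proof -
  let ?I = "\<lambda>A. \<integral>\<^sup>+z\<in>A. ennreal ((1 - (cmod z)\<^sup>2) powr \<alpha>) \<partial>lborel"
  obtain T where T: "?I unit_disc = ennreal T" "0 \<le> T"
    using weight_integral_disc_finite[OF \<alpha>] by (cases "?I unit_disc") auto
  define C0 where "C0 = 4 * (1/4) powr \<alpha> / (1 + \<alpha>) * 2 powr (1 + \<alpha>)"
  define C where "C = C0 + T * 4 powr (2 + \<alpha>)"
  have C0: "0 < C0" using \<alpha> by (simp add: C0_def)
  show ?thesis
  proof
    show "0 < C" using C0 T by (auto simp: C_def intro: add_pos_nonneg)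
    fix p :: complex and t :: real assume t: "0 < t"
    show "?I (ball p t \<inter> unit_disc) \<le> ennreal (C * t powr (2 + \<alpha>))"
    proof (cases "t \<le> 1/4")
      case True
      have "?I (ball p t \<inter> unit_disc) \<le> ennreal (C0 * t powr (2 + \<alpha>))"
        using weight_integral_small_ball_le[OF \<alpha> t True, of p] by (simp add: C0_def)
      also have "\<dots> \<le> ennreal (C * t powr (2 + \<alpha>))"
        using T by (intro ennreal_leI mult_right_mono) (auto simp: C_def)
      finally show ?thesis .
    next
      case False
      have "?I (ball p t \<inter> unit_disc) \<le> ?I unit_disc"
        by (intro nn_integral_mono) (auto simp: indicator_def)
      also have "\<dots> \<le> ennreal (C * t powr (2 + \<alpha>))"
        unfolding T
      proof (rule ennreal_leI)
        have "1 \<le> (4 * t) powr (2 + \<alpha>)" using False \<alpha> by (intro ge_one_powr_ge_zero) auto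
        then have "T * 1 \<le> T * (4 powr (2 + \<alpha>) * t powr (2 + \<alpha>))"
          using t T by (intro mult_left_mono) (auto simp: powr_mult)
        also have "\<dots> \<le> C * t powr (2 + \<alpha>)"
          using C0 by (simp add: C_def algebra_simps)
        finally show "T \<le> C * t powr (2 + \<alpha>)" by simp
      qed
      finally show ?thesis .
    qed
  qed
qed

section \<open>The weighted Dirichlet space as a Hilbert space\<close>

lemma sets_area_measure [measurable_cong, simp]: "sets area_measure = sets borel"
  by (simp add: area_measure_def)

lemma space_area_measure [simp]: "space area_measure = UNIV"
  by (simp add: area_measure_def)

lemma sets_weighted_area [measurable_cong, simp]: "sets (weighted_area \<alpha>) = sets borel"
  by (simp add: weighted_area_def)

lemma space_weighted_area [simp]: "space (weighted_area \<alpha>) = UNIV"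
  by (simp add: weighted_area_def)

lemma emeasure_lborel_complex_ball: "0 \<le> r \<Longrightarrow> emeasure lborel (ball (z :: complex) r) = ennreal (pi * r\<^sup>2)"
  using emeasure_ball[of r z] by (simp add: eval_unit_ball_vol)

lemma nn_integral_area_measure:
  assumes [measurable]: "f \<in> borel_measurable borel"
  shows "(\<integral>\<^sup>+z. f z \<partial>area_measure) = (\<integral>\<^sup>+z. ennreal (1 / pi) * indicator unit_disc z * f z \<partial>lborel)"
proof -
  have "indicator unit_disc z / emeasure lborel unit_disc = ennreal (1 / pi) * indicator unit_disc z" for z :: complex
    using emeasure_lborel_complex_ball[of 1 0] divide_ennreal[of 1 pi]
    by (simp add: indicator_def)
  then show ?thesis
    unfolding area_measure_def uniform_measure_def by (subst nn_integral_density) auto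
qed

lemma nn_integral_weighted_area:
  assumes \<alpha>: "-1 < \<alpha>" and [measurable]: "f \<in> borel_measurable borel"
  shows "(\<integral>\<^sup>+z. f z \<partial>weighted_area \<alpha>)
    = (\<integral>\<^sup>+z. ennreal ((1 + \<alpha>) / pi) * (ennreal ((1 - (cmod z)\<^sup>2) powr \<alpha>) * indicator unit_disc z * f z) \<partial>lborel)"
proof -
  have "(\<integral>\<^sup>+z. f z \<partial>weighted_area \<alpha>)
      = (\<integral>\<^sup>+z. ennreal ((1 + \<alpha>) * (1 - (cmod z)\<^sup>2) powr \<alpha>) * f z \<partial>area_measure)"
    unfolding weighted_area_def by (rule nn_integral_density) measurable
  also have "\<dots> = (\<integral>\<^sup>+z. ennreal (1 / pi) * indicator unit_disc z * (ennreal ((1 + \<alpha>) * (1 - (cmod z)\<^sup>2) powr \<alpha>) * f z) \<partial>lborel)"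
    by (rule nn_integral_area_measure) measurable
  also have "\<dots> = (\<integral>\<^sup>+z. ennreal ((1 + \<alpha>) / pi) * (ennreal ((1 - (cmod z)\<^sup>2) powr \<alpha>) * indicator unit_disc z * f z) \<partial>lborel)"
  proof (rule nn_integral_cong)
    fix z :: complex
    have *: "ennreal (1 / pi) * ennreal ((1 + \<alpha>) * (1 - (cmod z)\<^sup>2) powr \<alpha>)
        = ennreal ((1 + \<alpha>) / pi) * ennreal ((1 - (cmod z)\<^sup>2) powr \<alpha>)"
      using \<alpha> by (simp flip: ennreal_mult)
    have reassoc: "P * I * (Q * F) = R * (S * I * F)" if "P * Q = R * S" for P I Q F R S :: ennreal
    proof -
      have "P * I * (Q * F) = (P * Q) * (I * F)" by (simp only: mult_ac)
      also have "\<dots> = R * (S * I * F)" by (simp only: that mult_ac)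
      finally show ?thesis .
    qed
    show "ennreal (1 / pi) * indicator unit_disc z * (ennreal ((1 + \<alpha>) * (1 - (cmod z)\<^sup>2) powr \<alpha>) * f z)
        = ennreal ((1 + \<alpha>) / pi) * (ennreal ((1 - (cmod z)\<^sup>2) powr \<alpha>) * indicator unit_disc z * f z)"
      by (rule reassoc[OF *])
  qed
  finally show ?thesis .
qed

text \<open>Extending the derivative by \<open>0\<close> turns integrals over the disc into integrals over the plane and makes
  the integrands Borel functions.\<close>

definition disc_deriv :: "(complex \<Rightarrow> complex) \<Rightarrow> complex \<Rightarrow> complex" where
  "disc_deriv f z = (if z \<in> unit_disc then deriv f z else 0)"

lemma measurable_disc_deriv:
  assumes "f holomorphic_on unit_disc"
  shows "disc_deriv f \<in> borel_measurable borel"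
proof -
  have "continuous_on unit_disc (deriv f)"
    using assms by (intro holomorphic_on_imp_continuous_on holomorphic_deriv) auto
  then have "(\<lambda>z. indicator unit_disc z *\<^sub>R deriv f z) \<in> borel_measurable borel"
    by (intro borel_measurable_continuous_on_indicator) auto
  moreover have "(\<lambda>z. indicator unit_disc z *\<^sub>R deriv f z) = disc_deriv f"
    by (auto simp: disc_deriv_def fun_eq_iff)
  ultimately show ?thesis by simp
qed

lemma disc_deriv_add:
  assumes "f holomorphic_on unit_disc" "g holomorphic_on unit_disc"
  shows "disc_deriv (\<lambda>x. f x + g x) z = disc_deriv f z + disc_deriv g z"
proof (cases "z \<in> unit_disc")
  case True
  then have "f field_differentiable at z" "g field_differentiable at z"
    using assms by (auto intro: holomorphic_on_imp_differentiable_at)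
  then show ?thesis using True by (simp add: disc_deriv_def)
qed (simp add: disc_deriv_def)

lemma disc_deriv_scale:
  assumes "f holomorphic_on unit_disc"
  shows "disc_deriv (\<lambda>x. k * f x) z = k * disc_deriv f z"
proof (cases "z \<in> unit_disc")
  case True
  then have "f field_differentiable at z"
    using assms by (auto intro: holomorphic_on_imp_differentiable_at)
  then show ?thesis using True by (simp add: disc_deriv_def)
qed (simp add: disc_deriv_def)

lemma hcarrier_dirichlet_iff:
  "f \<in> hcarrier (dirichlet_space \<alpha>) \<longleftrightarrow> f holomorphic_on unit_disc \<and> (\<forall>z. z \<notin> unit_disc \<longrightarrow> f z = 0)
     \<and> integrable (weighted_area \<alpha>) (\<lambda>z. (cmod (disc_deriv f z))\<^sup>2)"
proof -
  have "(\<lambda>z. indicator unit_disc z *\<^sub>R (cmod (deriv f z))\<^sup>2) = (\<lambda>z. (cmod (disc_deriv f z))\<^sup>2)"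
    by (auto simp: disc_deriv_def fun_eq_iff)
  then show ?thesis by (simp add: dirichlet_space_def set_integrable_def)
qed

lemma hinner_dirichlet:
  "hinner (dirichlet_space \<alpha>) f g
    = f 0 * cnj (g 0) + (LINT z|weighted_area \<alpha>. disc_deriv f z * cnj (disc_deriv g z))"
proof -
  have "(\<lambda>z. indicator unit_disc z *\<^sub>R (deriv f z * cnj (deriv g z))) = (\<lambda>z. disc_deriv f z * cnj (disc_deriv g z))"
    by (auto simp: disc_deriv_def fun_eq_iff)
  then show ?thesis by (simp add: dirichlet_space_def set_lebesgue_integral_def)
qed

lemma hnorm_sq_dirichlet:
  "(hnorm (dirichlet_space \<alpha>) f)\<^sup>2 = (cmod (f 0))\<^sup>2 + (LINT z|weighted_area \<alpha>. (cmod (disc_deriv f z))\<^sup>2)"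
proof -
  have "(\<lambda>z. indicator unit_disc z *\<^sub>R (cmod (deriv f z))\<^sup>2) = (\<lambda>z. (cmod (disc_deriv f z))\<^sup>2)"
    by (auto simp: disc_deriv_def fun_eq_iff)
  then show ?thesis by (simp add: hnorm_dirichlet_space set_lebesgue_integral_def)
qed

lemma integrable_mult_cnj:
  fixes u v :: "'b \<Rightarrow> complex"
  assumes [measurable]: "u \<in> borel_measurable M" "v \<in> borel_measurable M"
    and u: "integrable M (\<lambda>z. (cmod (u z))\<^sup>2)" and v: "integrable M (\<lambda>z. (cmod (v z))\<^sup>2)"
  shows "integrable M (\<lambda>z. u z * cnj (v z))" "integrable M (\<lambda>z. cmod (u z) * cmod (v z))"
proof -
  have [measurable]: "(\<lambda>z. cnj (v z)) \<in> borel_measurable M"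
    by (rule measurable_compose[OF assms(2) borel_measurable_continuous_onI]) (intro continuous_intros)
  have le: "cmod (u z) * cmod (v z) \<le> (cmod (u z))\<^sup>2 + (cmod (v z))\<^sup>2" for z
    using sum_squares_bound[of "cmod (u z)" "cmod (v z)"] zero_le_power2[of "cmod (u z)"] zero_le_power2[of "cmod (v z)"]
    by linarith
  show "integrable M (\<lambda>z. u z * cnj (v z))"
    by (rule Bochner_Integration.integrable_bound[OF Bochner_Integration.integrable_add[OF u v]])
       (use le in \<open>auto simp: norm_mult\<close>)
  show "integrable M (\<lambda>z. cmod (u z) * cmod (v z))"
    by (rule Bochner_Integration.integrable_bound[OF Bochner_Integration.integrable_add[OF u v]])
       (use le in \<open>auto simp: norm_mult\<close>)
qed

lemma fun_inner_space_dirichlet: "fun_inner_space (dirichlet_space \<alpha>)"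
proof
  let ?H = "dirichlet_space \<alpha>"
  have M: "disc_deriv f \<in> borel_measurable (weighted_area \<alpha>)" if "f \<in> hcarrier ?H" for f
    using measurable_disc_deriv[of f] that by (simp add: hcarrier_dirichlet_iff measurable_def space_weighted_area)
  have I: "integrable (weighted_area \<alpha>) (\<lambda>z. disc_deriv f z * cnj (disc_deriv g z))"
    if "f \<in> hcarrier ?H" "g \<in> hcarrier ?H" for f g
    using M[OF that(1)] M[OF that(2)] that by (intro integrable_mult_cnj) (auto simp: hcarrier_dirichlet_iff)
  show "(\<lambda>x. 0) \<in> hcarrier ?H"
  proof -
    have "disc_deriv (\<lambda>x. 0) = (\<lambda>z. 0)" by (simp add: disc_deriv_def fun_eq_iff)
    then show ?thesis by (simp add: hcarrier_dirichlet_iff)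
  qed
  fix f g h and k :: complex
  assume f: "f \<in> hcarrier ?H"
  show "(\<lambda>x. k * f x) \<in> hcarrier ?H"
    using f by (auto simp: hcarrier_dirichlet_iff disc_deriv_scale norm_mult power_mult_distrib intro!: holomorphic_intros)
  show "0 \<le> Re (hinner ?H f f)"
    using hnorm_sq_dirichlet[of \<alpha> f]
  proof -
    have "(LINT z|weighted_area \<alpha>. disc_deriv f z * cnj (disc_deriv f z)) = of_real (LINT z|weighted_area \<alpha>. (cmod (disc_deriv f z))\<^sup>2)"
      unfolding integral_complex_of_real[symmetric] by (intro Bochner_Integration.integral_cong) (simp_all only: complex_norm_square)
    moreover have "0 \<le> (LINT z|weighted_area \<alpha>. (cmod (disc_deriv f z))\<^sup>2)"
      by (intro Bochner_Integration.integral_nonneg) auto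
    ultimately show ?thesis by (simp add: hinner_dirichlet)
  qed
  assume g: "g \<in> hcarrier ?H"
  show "hinner ?H g f = cnj (hinner ?H f g)"
  proof -
    have "(LINT z|weighted_area \<alpha>. disc_deriv g z * cnj (disc_deriv f z))
        = (LINT z|weighted_area \<alpha>. cnj (disc_deriv f z * cnj (disc_deriv g z)))"
      by (simp add: mult.commute)
    also have "\<dots> = cnj (LINT z|weighted_area \<alpha>. disc_deriv f z * cnj (disc_deriv g z))"
      by (rule Bochner_Integration.integral_cnj)
    finally show ?thesis by (simp add: hinner_dirichlet mult.commute)
  qed
  show "hinner ?H (\<lambda>x. k * f x) g = k * hinner ?H f g"
    using f by (simp add: hinner_dirichlet hcarrier_dirichlet_iff disc_deriv_scale algebra_simps flip: integral_mult_right_zero)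
  show "(\<lambda>x. f x + g x) \<in> hcarrier ?H"
  proof -
    have "integrable (weighted_area \<alpha>) (\<lambda>z. (cmod (disc_deriv f z + disc_deriv g z))\<^sup>2)"
    proof (rule Bochner_Integration.integrable_bound)
      show "integrable (weighted_area \<alpha>) (\<lambda>z. 2 * (cmod (disc_deriv f z))\<^sup>2 + 2 * (cmod (disc_deriv g z))\<^sup>2)"
        using f g by (auto simp: hcarrier_dirichlet_iff)
      show "(\<lambda>z. (cmod (disc_deriv f z + disc_deriv g z))\<^sup>2) \<in> borel_measurable (weighted_area \<alpha>)"
        using M[OF f] M[OF g] by simp
      have "(cmod (x + y))\<^sup>2 \<le> 2 * (cmod x)\<^sup>2 + 2 * (cmod y)\<^sup>2" for x y :: complex
      proof -
        have "(cmod (x + y))\<^sup>2 + (cmod (x - y))\<^sup>2 = 2 * (cmod x)\<^sup>2 + 2 * (cmod y)\<^sup>2"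
          unfolding cmod_power2 by (simp add: power2_eq_square algebra_simps)
        then show ?thesis using zero_le_power2[of "cmod (x - y)"] by linarith
      qed
      then show "AE z in weighted_area \<alpha>. norm ((cmod (disc_deriv f z + disc_deriv g z))\<^sup>2)
          \<le> norm (2 * (cmod (disc_deriv f z))\<^sup>2 + 2 * (cmod (disc_deriv g z))\<^sup>2)" by auto
    qed
    then show ?thesis
      using f g by (auto simp: hcarrier_dirichlet_iff disc_deriv_add intro!: holomorphic_intros)
  qed
  assume h: "h \<in> hcarrier ?H"
  show "hinner ?H (\<lambda>x. f x + g x) h = hinner ?H f h + hinner ?H g h"
    using f g I[OF f h] I[OF g h]
    by (simp add: hinner_dirichlet hcarrier_dirichlet_iff disc_deriv_add algebra_simps)
qed

lemma ball_subset_unit_disc: "ball z (1 - cmod z) \<subseteq> unit_disc"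
proof
  fix w assume "w \<in> ball z (1 - cmod z)"
  then show "w \<in> unit_disc"
    using norm_triangle_sub[of w z] by (simp add: dist_norm norm_minus_commute)
qed

lemma local_area_integral_le:
  assumes f: "f holomorphic_on unit_disc" and r: "0 < r" "r < R" and sub: "ball z R \<subseteq> unit_disc"
  shows "ennreal (pi * r\<^sup>2 * (cmod (deriv f z))\<^sup>2)
    \<le> (\<integral>\<^sup>+w\<in>ball z r. ennreal ((cmod (disc_deriv f w))\<^sup>2) \<partial>lborel)"
proof -
  have "deriv f holomorphic_on ball z R"
    using f by (intro holomorphic_on_subset[OF holomorphic_deriv sub]) auto
  from norm_sq_le_area_mean[OF this r]
  have "ennreal (pi * r\<^sup>2 * (cmod (deriv f z))\<^sup>2) \<le> (\<integral>\<^sup>+w\<in>ball z r. ennreal ((cmod (deriv f w))\<^sup>2) \<partial>lborel)" .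
  also have "\<dots> = (\<integral>\<^sup>+w\<in>ball z r. ennreal ((cmod (disc_deriv f w))\<^sup>2) \<partial>lborel)"
  proof (rule nn_integral_cong)
    fix w
    have "w \<in> ball z r \<Longrightarrow> w \<in> unit_disc" using sub r by (meson less_imp_le subsetD subset_ball)
    then show "ennreal ((cmod (deriv f w))\<^sup>2) * indicator (ball z r) w = ennreal ((cmod (disc_deriv f w))\<^sup>2) * indicator (ball z r) w"
      by (auto simp: disc_deriv_def indicator_def)
  qed
  finally show ?thesis .
qed

text \<open>The mean value inequality on the ball of radius \<open>(1 - \<bar>w\<bar>) / 4\<close> about \<open>w\<close>. On that ball \<open>1 - \<bar>u\<bar>\<close> is
  comparable to \<open>1 - \<bar>w\<bar>\<close>, so that the kernel can be written with \<open>1 - \<bar>u\<bar>\<close>. This is the form in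
  which the order of integration can be exchanged after \<open>w = \<phi> z\<close> has been substituted.\<close>

lemma deriv_sq_le_average:
  assumes f: "f holomorphic_on unit_disc" and w: "w \<in> unit_disc"
  shows "ennreal ((cmod (disc_deriv f w))\<^sup>2)
    \<le> (\<integral>\<^sup>+u. ennreal (25 / (pi * (1 - cmod u)\<^sup>2)) * indicator {u \<in> unit_disc. dist w u < 1 - cmod u} u
          * ennreal ((cmod (disc_deriv f u))\<^sup>2) \<partial>lborel)"
proof -
  note [measurable] = measurable_disc_deriv[OF f]
  define \<delta> where "\<delta> = 1 - cmod w"
  define r where "r = \<delta> / 4"
  have \<delta>: "0 < \<delta>" using w by (simp add: \<delta>_def)
  have r: "0 < r" "r < \<delta>" using \<delta> by (auto simp: r_def)
  have sub: "ball w \<delta> \<subseteq> unit_disc" unfolding \<delta>_def by (rule ball_subset_unit_disc)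
  have "ennreal ((cmod (disc_deriv f w))\<^sup>2) = ennreal (1 / (pi * r\<^sup>2)) * ennreal (pi * r\<^sup>2 * (cmod (deriv f w))\<^sup>2)"
    using r w by (subst ennreal_mult[symmetric]) (auto simp: disc_deriv_def)
  also have "\<dots> \<le> ennreal (1 / (pi * r\<^sup>2)) * (\<integral>\<^sup>+u\<in>ball w r. ennreal ((cmod (disc_deriv f u))\<^sup>2) \<partial>lborel)"
    by (intro mult_left_mono local_area_integral_le[OF f r sub]) auto
  also have "\<dots> = (\<integral>\<^sup>+u. ennreal (1 / (pi * r\<^sup>2)) * (ennreal ((cmod (disc_deriv f u))\<^sup>2) * indicator (ball w r) u) \<partial>lborel)"
    by (rule nn_integral_cmult[symmetric]) measurable
  also have "\<dots> \<le> (\<integral>\<^sup>+u. ennreal (25 / (pi * (1 - cmod u)\<^sup>2)) * indicator {u \<in> unit_disc. dist w u < 1 - cmod u} u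
          * ennreal ((cmod (disc_deriv f u))\<^sup>2) \<partial>lborel)"
  proof (rule nn_integral_mono)
    fix u
    show "ennreal (1 / (pi * r\<^sup>2)) * (ennreal ((cmod (disc_deriv f u))\<^sup>2) * indicator (ball w r) u)
      \<le> ennreal (25 / (pi * (1 - cmod u)\<^sup>2)) * indicator {u \<in> unit_disc. dist w u < 1 - cmod u} u
          * ennreal ((cmod (disc_deriv f u))\<^sup>2)"
    proof (cases "u \<in> ball w r")
      case True
      then have near: "dist w u < \<delta> / 4" by (simp add: r_def)
      have "\<bar>cmod w - cmod u\<bar> \<le> dist w u" unfolding dist_norm by (rule norm_triangle_ineq3)
      then have t: "3 / 4 * \<delta> < 1 - cmod u" "1 - cmod u < 5 / 4 * \<delta>"
        using near unfolding \<delta>_def by (simp_all add: abs_le_iff)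
      then have mem: "u \<in> {u \<in> unit_disc. dist w u < 1 - cmod u}" using near \<delta> by auto
      have "(1 - cmod u)\<^sup>2 \<le> (5 / 4 * \<delta>)\<^sup>2" using t \<delta> by (intro power_mono) auto
      then have "pi * (1 - cmod u)\<^sup>2 \<le> pi * (25 * r\<^sup>2)"
        by (intro mult_left_mono) (auto simp: r_def power2_eq_square)
      then have "25 / (pi * (25 * r\<^sup>2)) \<le> 25 / (pi * (1 - cmod u)\<^sup>2)"
        using t r \<delta> by (intro divide_left_mono mult_pos_pos) auto
      then have "1 / (pi * r\<^sup>2) \<le> 25 / (pi * (1 - cmod u)\<^sup>2)" by simp
      then have "ennreal (1 / (pi * r\<^sup>2)) * ennreal ((cmod (disc_deriv f u))\<^sup>2)
          \<le> ennreal (25 / (pi * (1 - cmod u)\<^sup>2)) * ennreal ((cmod (disc_deriv f u))\<^sup>2)"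
        by (intro mult_right_mono ennreal_leI) auto
      then show ?thesis using True mem by (simp only: indicator_simps mult_1_right)
    qed simp
  qed
  finally show ?thesis .
qed

text \<open>The closed discs about \<open>0\<close> exhaust the unit disc, so this is locally uniform convergence.\<close>

definition loc_conv :: "(nat \<Rightarrow> complex \<Rightarrow> complex) \<Rightarrow> (complex \<Rightarrow> complex) \<Rightarrow> bool" where
  "loc_conv F g \<longleftrightarrow> (\<forall>R<1. uniform_limit (cball 0 R) F g sequentially)"

lemma loc_conv_subseq:
  assumes "loc_conv F g" "strict_mono s"
  shows "loc_conv (\<lambda>n. F (s n)) g"
  using assms filterlim_subseq[OF assms(2)] unfolding loc_conv_def uniform_limit_iff filterlim_iff by blast

lemma loc_conv_diff:
  assumes "loc_conv F f" "loc_conv G g"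
  shows "loc_conv (\<lambda>n x. F n x - G n x) (\<lambda>x. f x - g x)"
  using assms unfolding loc_conv_def by (intro allI impI uniform_limit_intros) auto

lemma loc_conv_const: "loc_conv (\<lambda>n. g) g"
  unfolding loc_conv_def by (intro allI impI uniform_limit_const)

text \<open>Cauchy's inequality on balls of a fixed radius \<open>r\<close>, half the distance of the given disc to the
  circle.\<close>

lemma loc_conv_deriv:
  assumes conv: "loc_conv F g" and F: "\<And>n. F n holomorphic_on unit_disc" and g: "g holomorphic_on unit_disc"
  shows "loc_conv (\<lambda>n. deriv (F n)) (deriv g)"
  unfolding loc_conv_def
proof (intro allI impI uniform_limitI)
  fix R e :: real assume R: "R < 1" and e: "0 < e"
  define r where "r = (1 - max R 0) / 2"
  have r: "0 < r" "max R 0 + r < 1" using R by (auto simp: r_def field_simps)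
  have "uniform_limit (cball 0 (max R 0 + r)) F g sequentially"
    using conv r by (auto simp: loc_conv_def)
  then have "eventually (\<lambda>n. \<forall>x\<in>cball 0 (max R 0 + r). dist (F n x) (g x) < e * r / 2) sequentially"
    by (rule uniform_limitD) (use e r in auto)
  then show "eventually (\<lambda>n. \<forall>x\<in>cball 0 R. dist (deriv (F n) x) (deriv g x) < e) sequentially"
  proof (rule eventually_mono, intro ballI)
    fix n and x :: complex
    assume close: "\<forall>x\<in>cball 0 (max R 0 + r). dist (F n x) (g x) < e * r / 2" and x: "x \<in> cball 0 R"
    have xr: "cball x r \<subseteq> cball (0 :: complex) (max R 0 + r)"
    proof
      fix y :: complex assume "y \<in> cball x r"
      then show "y \<in> cball 0 (max R 0 + r)"
        using x norm_triangle_sub[of y x] by (auto simp: dist_norm norm_minus_commute)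
    qed
    then have sub: "cball x r \<subseteq> unit_disc" using r by (force simp: subset_iff)
    have hol: "(\<lambda>y. F n y - g y) holomorphic_on unit_disc" by (intro holomorphic_intros F g)
    have "norm ((deriv ^^ 1) (\<lambda>y. F n y - g y) x) \<le> fact 1 * (e * r / 2) / r ^ 1"
    proof (rule Cauchy_inequality)
      show "(\<lambda>y. F n y - g y) holomorphic_on ball x r"
        by (rule holomorphic_on_subset[OF hol]) (use sub in auto)
      show "continuous_on (cball x r) (\<lambda>y. F n y - g y)"
        by (rule continuous_on_subset[OF holomorphic_on_imp_continuous_on[OF hol] sub])
      fix y assume "norm (x - y) = r"
      then have "y \<in> cball x r" by (simp add: dist_norm)
      with close xr have "dist (F n y) (g y) < e * r / 2" by blast
      then show "norm (F n y - g y) \<le> e * r / 2" by (simp add: dist_norm)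
    qed (use r in auto)
    moreover have "x \<in> unit_disc" using x R by auto
    then have "deriv (\<lambda>y. F n y - g y) x = deriv (F n) x - deriv g x"
      by (intro deriv_diff holomorphic_on_imp_differentiable_at[OF F open_ball] holomorphic_on_imp_differentiable_at[OF g open_ball])
    ultimately show "dist (deriv (F n) x) (deriv g x) < e" using r e by (simp add: dist_norm)
  qed
qed

lemma loc_conv_pointwise:
  assumes "loc_conv F g" "z \<in> unit_disc"
  shows "(\<lambda>n. F n z) \<longlonglongrightarrow> g z"
proof -
  have "uniform_limit (cball 0 (cmod z)) F g sequentially" using assms by (auto simp: loc_conv_def)
  then show ?thesis by (rule tendsto_uniform_limitI) simp
qed

locale negative_weight =
  fixes \<alpha> :: real
  assumes \<alpha>_gt: "-1 < \<alpha>" and \<alpha>_less: "\<alpha> < 0"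
begin

abbreviation "A \<equiv> weighted_area \<alpha>"
abbreviation "D \<equiv> dirichlet_space \<alpha>"

sublocale D: fun_inner_space D
  by (rule fun_inner_space_dirichlet)

lemma weighted_area_ball_le:
  obtains C where "0 < C" "\<And>p t. 0 < t \<Longrightarrow> emeasure A (ball p t) \<le> ennreal (C * t powr (2 + \<alpha>))"
proof -
  obtain C where C: "0 < C" "\<And>p t. 0 < t \<Longrightarrow>
    (\<integral>\<^sup>+z\<in>ball p t \<inter> unit_disc. ennreal ((1 - (cmod z)\<^sup>2) powr \<alpha>) \<partial>lborel) \<le> ennreal (C * t powr (2 + \<alpha>))"
    by (rule weight_integral_ball_le[OF \<alpha>_gt \<alpha>_less]) blast
  show ?thesis
  proof
    show "0 < (1 + \<alpha>) / pi * C" using C \<alpha>_gt by simp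
    fix p :: complex and t :: real assume t: "0 < t"
    have "emeasure A (ball p t) = (\<integral>\<^sup>+z. indicator (ball p t) z \<partial>A)" by simp
    also have "\<dots> = (\<integral>\<^sup>+z. ennreal ((1 + \<alpha>) / pi) * (ennreal ((1 - (cmod z)\<^sup>2) powr \<alpha>) * indicator unit_disc z * indicator (ball p t) z) \<partial>lborel)"
      by (rule nn_integral_weighted_area[OF \<alpha>_gt]) measurable
    also have "\<dots> = ennreal ((1 + \<alpha>) / pi) * (\<integral>\<^sup>+z\<in>ball p t \<inter> unit_disc. ennreal ((1 - (cmod z)\<^sup>2) powr \<alpha>) \<partial>lborel)"
    proof -
      have "ennreal ((1 - (cmod z)\<^sup>2) powr \<alpha>) * indicator unit_disc z * indicator (ball p t) z
          = ennreal ((1 - (cmod z)\<^sup>2) powr \<alpha>) * indicator (ball p t \<inter> unit_disc) z" for z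
        by (simp add: indicator_inter_arith mult_ac)
      then have eq: "(\<lambda>z. ennreal ((1 + \<alpha>) / pi) * (ennreal ((1 - (cmod z)\<^sup>2) powr \<alpha>) * indicator unit_disc z * indicator (ball p t) z))
          = (\<lambda>z. ennreal ((1 + \<alpha>) / pi) * (ennreal ((1 - (cmod z)\<^sup>2) powr \<alpha>) * indicator (ball p t \<inter> unit_disc) z))"
        by (simp only:)
      show ?thesis unfolding eq by (rule nn_integral_cmult) measurable
    qed
    also have "\<dots> \<le> ennreal ((1 + \<alpha>) / pi) * ennreal (C * t powr (2 + \<alpha>))"
      by (intro mult_left_mono C t) auto
    also have "\<dots> = ennreal ((1 + \<alpha>) / pi * C * t powr (2 + \<alpha>))"
      using \<alpha>_gt C by (simp flip: ennreal_mult)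
    finally show "emeasure A (ball p t) \<le> ennreal ((1 + \<alpha>) / pi * C * t powr (2 + \<alpha>))" .
  qed
qed

lemma finite_measure_A: "finite_measure A"
proof -
  obtain C where C: "\<And>p t. 0 < t \<Longrightarrow> emeasure A (ball p t) \<le> ennreal (C * t powr (2 + \<alpha>))"
    using weighted_area_ball_le by metis
  have "emeasure A UNIV = (\<integral>\<^sup>+z. indicator UNIV z \<partial>A)" by (subst nn_integral_indicator) auto
  also have "\<dots> = (\<integral>\<^sup>+z. indicator unit_disc z \<partial>A)"
    by (subst (1 2) nn_integral_weighted_area[OF \<alpha>_gt]) (auto intro!: nn_integral_cong simp: indicator_def)
  also have "\<dots> = emeasure A unit_disc" by (subst nn_integral_indicator) auto
  also have "\<dots> < \<infinity>" by (rule order.strict_trans1[OF C]) auto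
  finally show ?thesis by (intro finite_measureI) simp
qed

sublocale A: finite_measure A
  by (rule finite_measure_A)

text \<open>Since \<open>\<alpha> < 0\<close>, the factor \<open>(1 - \<bar>z\<bar>\<^sup>2)\<^sup>\<alpha>\<close> of the density is at least \<open>1\<close>.\<close>

lemma nn_integral_lborel_le_weighted:
  assumes [measurable]: "f \<in> borel_measurable borel"
  shows "ennreal ((1 + \<alpha>) / pi) * (\<integral>\<^sup>+z\<in>unit_disc. f z \<partial>lborel) \<le> (\<integral>\<^sup>+z. f z \<partial>A)"
proof -
  have "ennreal ((1 + \<alpha>) / pi) * (\<integral>\<^sup>+z\<in>unit_disc. f z \<partial>lborel)
      = (\<integral>\<^sup>+z. ennreal ((1 + \<alpha>) / pi) * (f z * indicator unit_disc z) \<partial>lborel)"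
    by (subst nn_integral_cmult) auto
  also have "\<dots> \<le> (\<integral>\<^sup>+z. f z \<partial>A)"
    unfolding nn_integral_weighted_area[OF \<alpha>_gt assms]
  proof (intro nn_integral_mono mult_left_mono)
    fix z :: complex
    show "f z * indicator unit_disc z \<le> ennreal ((1 - (cmod z)\<^sup>2) powr \<alpha>) * indicator unit_disc z * f z"
    proof (cases "z \<in> unit_disc")
      case True
      then have "(cmod z)\<^sup>2 < 1" by (simp add: power_less_one_iff)
      then have "1 powr \<alpha> \<le> (1 - (cmod z)\<^sup>2) powr \<alpha>"
        using \<alpha>_less by (intro powr_mono2') auto
      then have "ennreal 1 \<le> ennreal ((1 - (cmod z)\<^sup>2) powr \<alpha>)" by (intro ennreal_leI) simp
      then have "1 * f z \<le> ennreal ((1 - (cmod z)\<^sup>2) powr \<alpha>) * f z" by (intro mult_right_mono) auto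
      then show ?thesis using True by simp
    qed auto
  qed auto
  finally show ?thesis .
qed

lemma dirichlet_deriv_nn_integral:
  assumes f: "f \<in> hcarrier D"
  shows "(\<integral>\<^sup>+z. ennreal ((cmod (disc_deriv f z))\<^sup>2) \<partial>A) = ennreal (LINT z|A. (cmod (disc_deriv f z))\<^sup>2)"
  using f by (intro nn_integral_eq_integral) (auto simp: hcarrier_dirichlet_iff)

lemma dirichlet_deriv_nn_integral_le:
  assumes f: "f \<in> hcarrier D"
  shows "(\<integral>\<^sup>+z. ennreal ((cmod (disc_deriv f z))\<^sup>2) \<partial>A) \<le> ennreal ((hnorm D f)\<^sup>2)"
  unfolding dirichlet_deriv_nn_integral[OF f] hnorm_sq_dirichlet by (intro ennreal_leI) auto

text \<open>The mean value inequality on the ball of radius \<open>(1 - \<bar>z\<bar>) / 2\<close>.\<close>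

lemma dirichlet_deriv_bound:
  assumes f: "f \<in> hcarrier D" and z: "z \<in> unit_disc"
  shows "cmod (deriv f z) \<le> 2 / sqrt (1 + \<alpha>) / (1 - cmod z) * hnorm D f"
proof -
  have hol: "f holomorphic_on unit_disc" using f by (simp add: hcarrier_dirichlet_iff)
  note [measurable] = measurable_disc_deriv[OF hol]
  define r where "r = (1 - cmod z) / 2"
  have r: "0 < r" "r < 1 - cmod z" using z by (auto simp: r_def)
  note sub = ball_subset_unit_disc[of z]
  have "ennreal ((1 + \<alpha>) / pi) * ennreal (pi * r\<^sup>2 * (cmod (deriv f z))\<^sup>2)
      \<le> ennreal ((1 + \<alpha>) / pi) * (\<integral>\<^sup>+w\<in>unit_disc. ennreal ((cmod (disc_deriv f w))\<^sup>2) \<partial>lborel)"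
  proof (rule mult_left_mono[OF order_trans[OF local_area_integral_le[OF hol r sub] nn_integral_mono]])
    fix w
    have "w \<in> ball z r \<Longrightarrow> w \<in> unit_disc" using sub r by (meson less_imp_le subsetD subset_ball)
    then show "ennreal ((cmod (disc_deriv f w))\<^sup>2) * indicator (ball z r) w
        \<le> ennreal ((cmod (disc_deriv f w))\<^sup>2) * indicator unit_disc w" by (auto simp: indicator_def)
  qed auto
  also have "\<dots> \<le> ennreal ((hnorm D f)\<^sup>2)"
    by (rule order_trans[OF nn_integral_lborel_le_weighted dirichlet_deriv_nn_integral_le[OF f]]) measurable
  finally have "(1 + \<alpha>) * r\<^sup>2 * (cmod (deriv f z))\<^sup>2 \<le> (hnorm D f)\<^sup>2"
    using \<alpha>_gt by (simp add: ennreal_le_iff flip: ennreal_mult)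
  then have "(sqrt (1 + \<alpha>) * r * cmod (deriv f z))\<^sup>2 \<le> (hnorm D f)\<^sup>2"
    using \<alpha>_gt by (simp add: power_mult_distrib)
  then have "sqrt (1 + \<alpha>) * r * cmod (deriv f z) \<le> hnorm D f"
    by (rule power2_le_imp_le) (rule D.hnorm_nonneg[OF f])
  moreover have "0 < sqrt (1 + \<alpha>)" using \<alpha>_gt by simp
  ultimately have "cmod (deriv f z) \<le> hnorm D f / (sqrt (1 + \<alpha>) * r)"
    using r by (simp add: field_simps)
  then show ?thesis by (simp add: r_def field_simps)
qed

lemma dirichlet_value_bound:
  assumes f: "f \<in> hcarrier D" and z: "cmod z \<le> R" and R: "R < 1"
  shows "cmod (f z) \<le> (1 + 2 / sqrt (1 + \<alpha>) / (1 - R)) * hnorm D f"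
proof -
  have hol: "f holomorphic_on unit_disc" using f by (simp add: hcarrier_dirichlet_iff)
  define K where "K = 2 / sqrt (1 + \<alpha>) / (1 - R) * hnorm D f"
  have K0: "0 \<le> K" using R \<alpha>_gt D.hnorm_nonneg[OF f] by (simp add: K_def)
  have "cmod (f z - f 0) \<le> K * cmod (z - 0)"
  proof (rule field_differentiable_bound)
    show "convex (cball (0 :: complex) R)" by simp
    fix w :: complex assume w: "w \<in> cball 0 R"
    then have w': "w \<in> unit_disc" using R by simp
    show "(f has_field_derivative deriv f w) (at w within cball 0 R)"
      using holomorphic_derivI[OF hol open_ball w'] by (rule has_field_derivative_at_within)
    have "cmod (deriv f w) \<le> 2 / sqrt (1 + \<alpha>) / (1 - cmod w) * hnorm D f"
      by (rule dirichlet_deriv_bound[OF f w'])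
    also have "\<dots> \<le> K"
      unfolding K_def using w R \<alpha>_gt D.hnorm_nonneg[OF f] by (intro mult_right_mono divide_left_mono) auto
    finally show "cmod (deriv f w) \<le> K" .
  qed (use z in \<open>auto intro: order_trans[OF norm_ge_zero]\<close>)
  also have "\<dots> \<le> K * 1" using z R K0 by (intro mult_left_mono) auto
  finally have "cmod (f z) \<le> cmod (f 0) + K" using norm_triangle_sub[of "f z" "f 0"] by linarith
  moreover have "cmod (f 0) \<le> hnorm D f"
    by (rule power2_le_imp_le) (auto simp: hnorm_sq_dirichlet D.hnorm_nonneg[OF f])
  ultimately show ?thesis by (simp add: K_def algebra_simps)
qed

text \<open>Closed balls of the space are closed under locally uniform convergence, by Fatou's lemma for the
  squares of the derivatives.\<close>

lemma dirichlet_Fatou: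
  fixes F :: "nat \<Rightarrow> complex \<Rightarrow> complex"
  assumes F: "\<And>n. F n \<in> hcarrier D" and B: "\<And>n. hnorm D (F n) \<le> B"
    and conv: "loc_conv F g" and g: "g holomorphic_on unit_disc" "\<And>z. z \<notin> unit_disc \<Longrightarrow> g z = 0"
  shows "g \<in> hcarrier D" "hnorm D g \<le> B"
proof -
  have B0: "0 \<le> B" using D.hnorm_nonneg[OF F] B order_trans by blast
  have holF: "F n holomorphic_on unit_disc" for n using F by (simp add: hcarrier_dirichlet_iff)
  note [measurable] = measurable_disc_deriv[OF holF] measurable_disc_deriv[OF g(1)]
  have ptd: "(\<lambda>n. disc_deriv (F n) z) \<longlonglongrightarrow> disc_deriv g z" for z
    using loc_conv_pointwise[OF loc_conv_deriv[OF conv holF g(1)], of z] by (auto simp: disc_deriv_def)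
  have pt: "(\<lambda>n. F n 0) \<longlonglongrightarrow> g 0" by (rule loc_conv_pointwise[OF conv]) simp
  have le: "ennreal ((cmod (g 0))\<^sup>2) + (\<integral>\<^sup>+z. ennreal ((cmod (disc_deriv g z))\<^sup>2) \<partial>A) \<le> ennreal (B\<^sup>2)"
  proof -
    have "(\<integral>\<^sup>+z. ennreal ((cmod (disc_deriv g z))\<^sup>2) \<partial>A) = (\<integral>\<^sup>+z. liminf (\<lambda>n. ennreal ((cmod (disc_deriv (F n) z))\<^sup>2)) \<partial>A)"
    proof (rule nn_integral_cong)
      fix z
      have "(\<lambda>n. ennreal ((cmod (disc_deriv (F n) z))\<^sup>2)) \<longlonglongrightarrow> ennreal ((cmod (disc_deriv g z))\<^sup>2)"
        by (intro tendsto_intros ptd)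
      from lim_imp_Liminf[OF _ this] show "ennreal ((cmod (disc_deriv g z))\<^sup>2) = liminf (\<lambda>n. ennreal ((cmod (disc_deriv (F n) z))\<^sup>2))"
        by simp
    qed
    also have "\<dots> \<le> liminf (\<lambda>n. \<integral>\<^sup>+z. ennreal ((cmod (disc_deriv (F n) z))\<^sup>2) \<partial>A)"
      by (rule nn_integral_liminf) measurable
    also have "\<dots> \<le> liminf (\<lambda>n. ennreal (B\<^sup>2 - (cmod (F n 0))\<^sup>2))"
    proof (intro Liminf_mono always_eventually allI)
      fix n
      have "(hnorm D (F n))\<^sup>2 \<le> B\<^sup>2" using B D.hnorm_nonneg[OF F] by (intro power_mono) auto
      then show "(\<integral>\<^sup>+z. ennreal ((cmod (disc_deriv (F n) z))\<^sup>2) \<partial>A) \<le> ennreal (B\<^sup>2 - (cmod (F n 0))\<^sup>2)"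
        unfolding dirichlet_deriv_nn_integral[OF F] hnorm_sq_dirichlet by (intro ennreal_leI) simp
    qed
    also have "\<dots> = ennreal (B\<^sup>2 - (cmod (g 0))\<^sup>2)"
      by (rule lim_imp_Liminf) (auto intro!: tendsto_intros pt)
    finally have "ennreal ((cmod (g 0))\<^sup>2) + (\<integral>\<^sup>+z. ennreal ((cmod (disc_deriv g z))\<^sup>2) \<partial>A)
      \<le> ennreal ((cmod (g 0))\<^sup>2) + ennreal (B\<^sup>2 - (cmod (g 0))\<^sup>2)" by (rule add_left_mono)
    moreover have "(cmod (g 0))\<^sup>2 \<le> B\<^sup>2"
    proof (rule LIMSEQ_le_const2)
      show "(\<lambda>n. (cmod (F n 0))\<^sup>2) \<longlonglongrightarrow> (cmod (g 0))\<^sup>2" by (intro tendsto_intros pt)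
      have "(cmod (F n 0))\<^sup>2 \<le> B\<^sup>2" for n
      proof -
        have "(cmod (F n 0))\<^sup>2 \<le> (hnorm D (F n))\<^sup>2" by (simp add: hnorm_sq_dirichlet)
        also have "\<dots> \<le> B\<^sup>2" using B D.hnorm_nonneg[OF F] by (intro power_mono) auto
        finally show ?thesis .
      qed
      then show "\<exists>N. \<forall>n\<ge>N. (cmod (F n 0))\<^sup>2 \<le> B\<^sup>2" by blast
    qed
    ultimately show ?thesis by (simp flip: ennreal_plus)
  qed
  have "(\<integral>\<^sup>+z. ennreal ((cmod (disc_deriv g z))\<^sup>2) \<partial>A) \<le> ennreal (B\<^sup>2)"
    by (rule order_trans[OF _ le]) simp
  then have fin: "(\<integral>\<^sup>+z. ennreal ((cmod (disc_deriv g z))\<^sup>2) \<partial>A) < \<infinity>"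
    by (rule order.strict_trans1) simp
  have "integrable A (\<lambda>z. (cmod (disc_deriv g z))\<^sup>2)"
    using fin by (intro integrableI_bounded) auto
  then show gD: "g \<in> hcarrier D" using g by (simp add: hcarrier_dirichlet_iff)
  have "ennreal ((hnorm D g)\<^sup>2) \<le> ennreal (B\<^sup>2)"
    using le unfolding dirichlet_deriv_nn_integral[OF gD] hnorm_sq_dirichlet by (subst ennreal_plus) auto
  then have "(hnorm D g)\<^sup>2 \<le> B\<^sup>2" by (simp add: ennreal_le_iff)
  then show "hnorm D g \<le> B" by (rule power2_le_imp_le) (rule B0)
qed

text \<open>Point evaluations are bounded uniformly on compact sets, so Montel's theorem applies; the limit
  inherits the norm bound. It plays the part of weak sequential compactness of balls.\<close>

lemma dirichlet_Montel:
  fixes F :: "nat \<Rightarrow> complex \<Rightarrow> complex"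
  assumes F: "\<And>n. F n \<in> hcarrier D" and B: "\<And>n. hnorm D (F n) \<le> B"
  obtains s g where "strict_mono s" "g \<in> hcarrier D" "hnorm D g \<le> B" "loc_conv (\<lambda>n. F (s n)) g"
proof -
  define \<H> where "\<H> = {h \<in> hcarrier D. hnorm D h \<le> B}"
  obtain g s where g: "g holomorphic_on unit_disc" and s: "strict_mono (s :: nat \<Rightarrow> nat)"
    and ul: "\<And>K. \<lbrakk>compact K; K \<subseteq> unit_disc\<rbrakk> \<Longrightarrow> uniform_limit K (F \<circ> s) g sequentially"
  proof (rule Montel[of unit_disc \<H> F])
    show "open unit_disc" by simp
    show "h holomorphic_on unit_disc" if "h \<in> \<H>" for h using that by (simp add: \<H>_def hcarrier_dirichlet_iff)
    show "range F \<subseteq> \<H>" using F B by (auto simp: \<H>_def)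
    fix K :: "complex set" assume K: "compact K" "K \<subseteq> unit_disc"
    obtain R where R: "R < 1" "\<And>z. z \<in> K \<Longrightarrow> cmod z \<le> R"
    proof (cases "K = {}")
      case False
      then obtain z0 where "z0 \<in> K" "\<forall>z\<in>K. cmod z \<le> cmod z0"
        using continuous_attains_sup[OF K(1) False, of cmod] continuous_on_norm_id by blast
      then show ?thesis using K(2) that[of "cmod z0"] by auto
    qed (use that[of 0] in auto)
    show "\<exists>B. \<forall>h\<in>\<H>. \<forall>z\<in>K. cmod (h z) \<le> B"
    proof (intro exI ballI)
      fix h z assume h: "h \<in> \<H>" and z: "z \<in> K"
      have "cmod (h z) \<le> (1 + 2 / sqrt (1 + \<alpha>) / (1 - R)) * hnorm D h"
        using h by (intro dirichlet_value_bound R z) (auto simp: \<H>_def)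
      also have "\<dots> \<le> (1 + 2 / sqrt (1 + \<alpha>) / (1 - R)) * B"
        using h R \<alpha>_gt by (intro mult_left_mono) (auto simp: \<H>_def)
      finally show "cmod (h z) \<le> (1 + 2 / sqrt (1 + \<alpha>) / (1 - R)) * B" .
    qed
  qed blast
  define g' where "g' = (\<lambda>z. if z \<in> unit_disc then g z else 0)"
  have conv: "loc_conv (\<lambda>n. F (s n)) g'"
    unfolding loc_conv_def
  proof (intro allI impI)
    fix R :: real assume R: "R < 1"
    then have sub: "cball 0 R \<subseteq> unit_disc" by auto
    have "uniform_limit (cball 0 R) (F \<circ> s) g sequentially" by (rule ul) (use sub in auto)
    then show "uniform_limit (cball 0 R) (\<lambda>n. F (s n)) g' sequentially"
      unfolding uniform_limit_iff using sub by (auto simp: g'_def subset_iff)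
  qed
  have g': "g' holomorphic_on unit_disc"
    by (rule holomorphic_transform[OF g]) (simp add: g'_def)
  have out: "g' z = 0" if "z \<notin> unit_disc" for z using that by (simp add: g'_def)
  have "g' \<in> hcarrier D" "hnorm D g' \<le> B"
    using dirichlet_Fatou[OF F B conv g' out] by auto
  then show ?thesis using s conv that by blast
qed

text \<open>A subsequence of a Cauchy sequence converges locally uniformly to some \<open>g\<close>. The norm bound of
  Fatou's lemma for \<open>F m - F n\<close>, with \<open>n \<rightarrow> \<infinity>\<close> along the subsequence, gives convergence in norm.\<close>

sublocale D: fun_hilbert_space D
proof
  fix f assume f: "f \<in> hcarrier D" "hnorm D f = 0"
  show "f = (\<lambda>z. 0)"
  proof
    fix z show "f z = 0"
    proof (cases "z \<in> unit_disc")
      case True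
      then show ?thesis using dirichlet_value_bound[OF f(1), of z "cmod z"] f(2) by simp
    qed (use f in \<open>auto simp: hcarrier_dirichlet_iff\<close>)
  qed
next
  fix F :: "nat \<Rightarrow> complex \<Rightarrow> complex"
  assume F: "\<And>n. F n \<in> hcarrier D"
    and C: "\<And>e. 0 < e \<Longrightarrow> \<exists>N. \<forall>m\<ge>N. \<forall>n\<ge>N. hnorm D (\<lambda>x. F m x - F n x) < e"
  obtain N where N: "\<forall>m\<ge>N. \<forall>n\<ge>N. hnorm D (\<lambda>x. F m x - F n x) < 1" using C[of 1] by auto
  have bound: "hnorm D (F (n + N)) \<le> hnorm D (F N) + 1" for n
  proof -
    have "hnorm D (\<lambda>x. F (n + N) x - F N x) < 1" using N by simp
    then show ?thesis using D.hnorm_triangle_diff[OF F F, of "n + N" N] by linarith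
  qed
  obtain s g where s: "strict_mono s" and g: "g \<in> hcarrier D"
    and conv: "loc_conv (\<lambda>n. F (s n + N)) g"
    by (rule dirichlet_Montel[of "\<lambda>n. F (n + N)", OF F bound]) blast
  have "(\<lambda>n. hnorm D (\<lambda>x. F n x - g x)) \<longlonglongrightarrow> 0"
  proof (rule LIMSEQ_I)
    fix e :: real assume e: "0 < e"
    then obtain M where M: "\<forall>m\<ge>M. \<forall>n\<ge>M. hnorm D (\<lambda>x. F m x - F n x) < e / 2" using C[of "e / 2"] by auto
    have "norm (hnorm D (\<lambda>x. F m x - g x) - 0) < e" if m: "m \<ge> M" for m
    proof -
      have conv': "loc_conv (\<lambda>n x. F m x - F (s (n + M) + N) x) (\<lambda>x. F m x - g x)"
        by (rule loc_conv_diff[OF loc_conv_const loc_conv_subseq[OF conv, of "\<lambda>n. n + M"]])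
           (simp add: strict_mono_def)
      have bound': "hnorm D (\<lambda>x. F m x - F (s (n + M) + N) x) \<le> e / 2" for n
      proof -
        have "M \<le> s (n + M) + N" using strict_mono_imp_increasing[OF s, of "n + M"] by linarith
        then have "hnorm D (\<lambda>x. F m x - F (s (n + M) + N) x) < e / 2" using M m by blast
        then show ?thesis by (rule less_imp_le)
      qed
      have hol: "(\<lambda>x. F m x - g x) holomorphic_on unit_disc"
        and out: "\<And>z. z \<notin> unit_disc \<Longrightarrow> F m z - g z = 0"
        using D.diff_closed[OF F g, of m] unfolding hcarrier_dirichlet_iff by blast+
      have "hnorm D (\<lambda>x. F m x - g x) \<le> e / 2"
        by (rule dirichlet_Fatou(2)[OF D.diff_closed[OF F F] bound' conv' hol out])
      then show ?thesis using e D.hnorm_nonneg[OF D.diff_closed[OF F g]] by auto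
    qed
    then show "\<exists>M. \<forall>m\<ge>M. norm (hnorm D (\<lambda>x. F m x - g x) - 0) < e" by blast
  qed
  then show "\<exists>g\<in>hcarrier D. (\<lambda>n. hnorm D (\<lambda>x. F n x - g x)) \<longlonglongrightarrow> 0" using g by blast
qed

end

section \<open>Linear fractional self-maps up to the boundary\<close>

locale linear_fractional =
  fixes a b c d :: complex
  assumes self_map: "moebius_self_map a b c d"
begin

abbreviation "\<phi> \<equiv> moebius a b c d"
abbreviation "\<Delta> \<equiv> a * d - b * c"

lemma det_nonzero: "\<Delta> \<noteq> 0"
  and den_nonzero_disc: "z \<in> unit_disc \<Longrightarrow> c * z + d \<noteq> 0"
  and map_disc: "z \<in> unit_disc \<Longrightarrow> \<phi> z \<in> unit_disc"
  using self_map unfolding moebius_self_map_def by blast+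

lemma num_less_den:
  assumes "z \<in> unit_disc"
  shows "cmod (a * z + b) < cmod (c * z + d)"
proof -
  have "cmod (\<phi> z) < 1" using map_disc[OF assms] by simp
  moreover have "0 < cmod (c * z + d)" using den_nonzero_disc[OF assms] by simp
  ultimately show ?thesis by (simp add: moebius_def norm_divide)
qed

lemma num_le_den:
  assumes "cmod z \<le> 1"
  shows "cmod (a * z + b) \<le> cmod (c * z + d)"
proof -
  have "cmod (a * z + b) - cmod (c * z + d) \<le> 0"
  proof (rule continuous_le_on_closure[where S = "unit_disc" and f = "\<lambda>z. cmod (a * z + b) - cmod (c * z + d)"])
    show "continuous_on (closure unit_disc) (\<lambda>z. cmod (a * z + b) - cmod (c * z + d))"
      by (intro continuous_intros)
    show "z \<in> closure unit_disc" using assms by (simp add: closure_ball)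
    show "cmod (a * x + b) - cmod (c * x + d) \<le> 0" if "x \<in> unit_disc" for x
      using num_less_den[OF that] by simp
  qed
  then show ?thesis by simp
qed

text \<open>On the closed disc the numerator is dominated by the denominator, so a zero of the latter is a common
  zero, which a nonzero determinant forbids.\<close>

lemma den_nonzero:
  assumes "cmod z \<le> 1"
  shows "c * z + d \<noteq> 0"
proof
  assume 0: "c * z + d = 0"
  then have 1: "a * z + b = 0" using num_le_den[OF assms] by simp
  have "\<Delta> = a * (c * z + d) - c * (a * z + b)" by (simp add: algebra_simps)
  then show False using det_nonzero 0 1 by simp
qed

lemma c_less_d: "cmod c < cmod d"
proof (rule ccontr)
  assume "\<not> cmod c < cmod d"
  then have le: "cmod d \<le> cmod c" by simp
  have "c \<noteq> 0" using le det_nonzero by auto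
  then have "cmod (- d / c) \<le> 1" "c * (- d / c) + d = 0"
    using le by (auto simp: norm_divide)
  then show False using den_nonzero by blast
qed

lemma den_ge:
  assumes "cmod z \<le> 1"
  shows "cmod d - cmod c \<le> cmod (c * z + d)"
proof -
  have "cmod d \<le> cmod (c * z + d) + cmod (c * z)"
    using norm_triangle_sub[of d "- (c * z)"] by (simp add: add.commute)
  moreover have "cmod (c * z) \<le> cmod c"
    using assms by (simp add: norm_mult mult_left_le)
  ultimately show ?thesis by simp
qed

lemma den_le:
  assumes "cmod z \<le> 1"
  shows "cmod (c * z + d) \<le> cmod c + cmod d"
proof -
  have "cmod (c * z) \<le> cmod c"
    using assms by (simp add: norm_mult mult_left_le)
  then show ?thesis using norm_triangle_ineq[of "c * z" d] by simp
qed

lemma moebius_diff: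
  assumes "c * z + d \<noteq> 0" "c * w + d \<noteq> 0"
  shows "\<phi> z - \<phi> w = \<Delta> * (z - w) / ((c * z + d) * (c * w + d))"
  using assms by (simp add: moebius_def divide_simps) (simp add: algebra_simps)

lemma moebius_has_derivative:
  assumes "cmod z \<le> 1"
  shows "(\<phi> has_field_derivative \<Delta> / (c * z + d)\<^sup>2) (at z)"
  unfolding moebius_def
  by (rule derivative_eq_intros refl den_nonzero[OF assms])+ (simp add: power2_eq_square algebra_simps)

lemma moebius_holomorphic: "\<phi> holomorphic_on unit_disc"
proof -
  have "\<exists>f'. (\<phi> has_field_derivative f') (at z)" if "z \<in> unit_disc" for z
    using moebius_has_derivative[of z] that by auto
  then show ?thesis by (simp add: holomorphic_on_open)
qed

lemma moebius_continuous: "continuous_on (cball 0 1) \<phi>"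
  using moebius_has_derivative
  by (intro continuous_at_imp_continuous_on ballI DERIV_isCont) auto

lemma moebius_measurable: "\<phi> \<in> borel_measurable borel"
  unfolding moebius_def by measurable

lemma map_cball: "cmod z \<le> 1 \<Longrightarrow> cmod (\<phi> z) \<le> 1"
  using num_le_den den_nonzero by (simp add: moebius_def norm_divide divide_le_eq)

definition "upper_lip = cmod \<Delta> / (cmod d - cmod c)\<^sup>2"
definition "lower_lip = cmod \<Delta> / (cmod c + cmod d)\<^sup>2"

lemma upper_lip_pos: "0 < upper_lip"
  using c_less_d det_nonzero by (simp add: upper_lip_def)

lemma lower_lip_pos: "0 < lower_lip"
proof -
  have "0 < cmod c + cmod d" using c_less_d norm_ge_zero[of c] by linarith
  then show ?thesis using det_nonzero by (simp add: lower_lip_def)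
qed

lemma deriv_moebius_le:
  assumes "cmod z \<le> 1"
  shows "cmod (deriv \<phi> z) \<le> upper_lip"
proof -
  have "(cmod d - cmod c)\<^sup>2 \<le> (cmod (c * z + d))\<^sup>2"
    using den_ge[OF assms] c_less_d by (intro power_mono) auto
  then show ?thesis
    unfolding DERIV_imp_deriv[OF moebius_has_derivative[OF assms]] norm_divide norm_power upper_lip_def
    using c_less_d den_nonzero[OF assms] by (intro divide_left_mono) auto
qed

lemma moebius_lipschitz:
  assumes z: "cmod z \<le> 1" and w: "cmod w \<le> 1"
  shows "cmod (\<phi> z - \<phi> w) \<le> upper_lip * cmod (z - w)"
proof -
  have pos: "0 < (cmod d - cmod c)\<^sup>2" using c_less_d by simp
  have "(cmod d - cmod c)\<^sup>2 \<le> cmod (c * z + d) * cmod (c * w + d)"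
    unfolding power2_eq_square using den_ge[OF z] den_ge[OF w] c_less_d by (intro mult_mono) auto
  then have "cmod \<Delta> * cmod (z - w) / (cmod (c * z + d) * cmod (c * w + d)) \<le> cmod \<Delta> * cmod (z - w) / (cmod d - cmod c)\<^sup>2"
    using pos den_nonzero[OF z] den_nonzero[OF w] by (intro divide_left_mono) auto
  then show ?thesis
    by (simp add: moebius_diff den_nonzero z w norm_divide norm_mult upper_lip_def)
qed

lemma moebius_lipschitz_lower:
  assumes z: "cmod z \<le> 1" and w: "cmod w \<le> 1"
  shows "lower_lip * cmod (z - w) \<le> cmod (\<phi> z - \<phi> w)"
proof -
  have "cmod (c * z + d) * cmod (c * w + d) \<le> (cmod c + cmod d)\<^sup>2"
    unfolding power2_eq_square using den_le[OF z] den_le[OF w] by (intro mult_mono) auto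
  then have "cmod \<Delta> * cmod (z - w) / (cmod c + cmod d)\<^sup>2 \<le> cmod \<Delta> * cmod (z - w) / (cmod (c * z + d) * cmod (c * w + d))"
  proof (rule divide_left_mono)
    have "0 < cmod (c * z + d) * cmod (c * w + d)" using den_nonzero[OF z] den_nonzero[OF w] by simp
    moreover have "0 < (cmod c + cmod d)\<^sup>2"
      using c_less_d norm_ge_zero[of c] by (smt (verit) zero_less_power)
    ultimately show "0 < (cmod c + cmod d)\<^sup>2 * (cmod (c * z + d) * cmod (c * w + d))" by simp
  qed auto
  then show ?thesis
    by (simp add: moebius_diff den_nonzero z w norm_divide norm_mult lower_lip_def)
qed

lemma moebius_inj: "inj_on \<phi> (cball 0 1)"
proof (rule inj_onI)
  fix z w :: complex assume "z \<in> cball 0 1" "w \<in> cball 0 1" "\<phi> z = \<phi> w"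
  then show "z = w" using moebius_lipschitz_lower[of z w] lower_lip_pos by (simp add: mult_le_0_iff)
qed

text \<open>The equation \<open>\<phi> z = w\<close> is solved explicitly near \<open>u\<close>. Besides its use as an inverse function theorem
  with uniform constants, this serves as a substitute for Hopf's lemma: if the ball about \<open>u\<close> touches
  the circle, then \<open>1 - \<bar>\<phi> u\<bar> \<ge> k (1 - \<bar>u\<bar>)\<close>.\<close>

lemma ball_subset_image:
  obtains k where "0 < k" "\<And>u s. \<lbrakk>0 < s; ball u s \<subseteq> unit_disc\<rbrakk> \<Longrightarrow> ball (\<phi> u) (k * s) \<subseteq> \<phi> ` ball u s"
proof -
  define M where "M = cmod c + cmod d"
  have M: "0 < M" using c_less_d norm_ge_zero[of c] unfolding M_def by linarith
  define k where "k = cmod \<Delta> / (2 * M\<^sup>2)"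
  have k: "0 < k" using M det_nonzero by (simp add: k_def)
  show ?thesis
  proof
    show "0 < k" by (rule k)
    fix u s assume s: "0 < s" and sub: "ball u s \<subseteq> unit_disc"
    have u: "u \<in> unit_disc" using sub s by (meson centre_in_ball subsetD)
    have s1: "s \<le> 1"
      using sub s unfolding ball_subset_ball_iff by (smt (verit) zero_le_dist)
    show "ball (\<phi> u) (k * s) \<subseteq> \<phi> ` ball u s"
    proof
      fix w assume "w \<in> ball (\<phi> u) (k * s)"
      then have w: "cmod (w - \<phi> u) < k * s" by (simp add: dist_norm norm_minus_commute)
      define e where "e = w - \<phi> u"
      define q where "q = c * u + d"
      have q: "q \<noteq> 0" "cmod q \<le> M" "cmod c \<le> M"
        using den_nonzero_disc[OF u] den_le[of u] u by (auto simp: q_def M_def)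
      have "cmod (e * c * q) \<le> (k * s) * M * M"
        unfolding norm_mult using w q M k s by (intro mult_mono) (auto simp: e_def)
      also have "\<dots> = cmod \<Delta> * s / 2" using M by (simp add: k_def power2_eq_square)
      also have "\<dots> \<le> cmod \<Delta> / 2" using s1 by (simp add: mult_left_le)
      finally have small: "cmod (e * c * q) \<le> cmod \<Delta> / 2" .
      have den: "cmod \<Delta> / 2 \<le> cmod (\<Delta> - e * c * q)"
        using norm_triangle_ineq2[of \<Delta> "e * c * q"] small by linarith
      then have den0: "\<Delta> - e * c * q \<noteq> 0" using det_nonzero by auto
      \<comment> \<open>The solution of \<open>\<phi> z - \<phi> u = e\<close>, read off from the difference formula.\<close>
      define z where "z = u + e * q\<^sup>2 / (\<Delta> - e * c * q)"
      have "cmod (z - u) = cmod e * (cmod q)\<^sup>2 / cmod (\<Delta> - e * c * q)"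
        by (simp add: z_def norm_divide norm_mult norm_power)
      also have "\<dots> \<le> cmod e * M\<^sup>2 / (cmod \<Delta> / 2)"
        using den den0 det_nonzero q by (intro frac_le mult_left_mono power_mono) auto
      also have "\<dots> < (k * s) * M\<^sup>2 / (cmod \<Delta> / 2)"
        using w M det_nonzero by (intro divide_strict_right_mono mult_strict_right_mono) (auto simp: e_def)
      also have "\<dots> = s" using M det_nonzero by (simp add: k_def)
      finally have zb: "z \<in> ball u s" by (simp add: dist_norm norm_minus_commute)
      have "c * z + d = q * \<Delta> / (\<Delta> - e * c * q)"
        using den0 by (simp add: z_def q_def divide_simps power2_eq_square) (simp add: algebra_simps)
      moreover have "c * z + d \<noteq> 0" using den_nonzero_disc sub zb by blast
      ultimately have "\<phi> z - \<phi> u = e"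
        using moebius_diff[of z u] q den0 det_nonzero
        by (simp add: z_def flip: q_def) (simp add: divide_simps power2_eq_square)
      then have "w = \<phi> z" by (simp add: e_def)
      then show "w \<in> \<phi> ` ball u s" using zb by blast
    qed
  qed
qed

text \<open>Otherwise \<open>u = (d - b w) / (a w - c)\<close> lies in the closed disc and satisfies \<open>c u + d = w (a u + b)\<close>. As
  \<open>\<bar>w\<bar> < 1\<close>, the numerator of \<open>\<phi> u\<close> would then exceed the denominator in absolute value.\<close>

lemma krein_num_less:
  assumes w: "w \<in> unit_disc"
  shows "cmod (a * w - c) < cmod (d - b * w)"
proof (rule ccontr)
  assume "\<not> ?thesis"
  then have le: "cmod (d - b * w) \<le> cmod (a * w - c)" by simp
  have nz: "a * w - c \<noteq> 0"
  proof
    assume 0: "a * w - c = 0"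
    then have "d - b * w = 0" using le by simp
    then have "\<Delta> = a * (b * w) - b * (a * w)" using 0 by simp
    then have "\<Delta> = 0" by (simp add: algebra_simps)
    then show False using det_nonzero by simp
  qed
  define u where "u = (d - b * w) / (a * w - c)"
  have u: "cmod u \<le> 1" using le nz by (simp add: u_def norm_divide)
  have 1: "a * u + b = \<Delta> / (a * w - c)" and 2: "c * u + d = \<Delta> * w / (a * w - c)"
    using nz by (simp_all add: u_def divide_simps) (simp_all add: algebra_simps)
  have "cmod (\<Delta> / (a * w - c)) \<le> cmod (\<Delta> * w / (a * w - c))"
    using num_le_den[OF u] unfolding 1 2 .
  then have "1 \<le> cmod w" using nz det_nonzero by (simp add: norm_divide norm_mult divide_le_cancel)
  then show False using w by simp
qed

lemma krein_self_map: "moebius_self_map (cnj a) (- cnj c) (- cnj b) (cnj d)"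
  unfolding moebius_self_map_def
proof (intro conjI ballI subsetI)
  have "cnj a * cnj d - (- cnj c) * (- cnj b) = cnj \<Delta>" by (simp add: algebra_simps)
  then show "cnj a * cnj d - - cnj c * - cnj b \<noteq> 0" using det_nonzero by (metis complex_cnj_zero_iff)
  have less: "cmod (cnj a * z + - cnj c) < cmod (- cnj b * z + cnj d)" if "z \<in> unit_disc" for z
  proof -
    have "cnj a * z + - cnj c = cnj (a * cnj z - c)" "- cnj b * z + cnj d = cnj (d - b * cnj z)"
      by (simp_all add: algebra_simps)
    then show ?thesis using krein_num_less[of "cnj z"] that by (simp only: complex_mod_cnj) simp
  qed
  show "- cnj b * z + cnj d \<noteq> 0" if "z \<in> unit_disc" for z
    using less[OF that] by auto
  fix x assume "x \<in> moebius (cnj a) (- cnj c) (- cnj b) (cnj d) ` unit_disc"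
  then obtain z where z: "z \<in> unit_disc" "x = (cnj a * z + - cnj c) / (- cnj b * z + cnj d)"
    by (auto simp: moebius_def)
  then have "cmod x < 1" unfolding z(2) norm_divide using less[OF z(1)] order.strict_trans1[OF norm_ge_zero less[OF z(1)]]
    by (simp only: divide_less_eq_1_pos)
  then show "x \<in> unit_disc" by simp
qed

text \<open>The Krein adjoint is the inverse map conjugated with the reflection in the circle, and the reflection
  fixes the circle pointwise.\<close>

lemma krein_inverse_circle:
  assumes om: "cmod \<omega> = 1" and xi: "cmod (\<phi> \<omega>) = 1"
  shows "krein_adjoint a b c d (\<phi> \<omega>) = \<omega>"
proof -
  interpret K: linear_fractional "cnj a" "- cnj c" "- cnj b" "cnj d" by unfold_locales (rule krein_self_map)
  define \<xi> where "\<xi> = \<phi> \<omega>"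
  have x1: "cnj \<xi> * \<xi> = 1" "cnj \<omega> * \<omega> = 1"
    using om xi complex_norm_square[of \<xi>] complex_norm_square[of \<omega>] by (simp_all add: \<xi>_def mult.commute)
  have "a * \<omega> + b = \<xi> * (c * \<omega> + d)"
    using den_nonzero[of \<omega>] om by (simp add: \<xi>_def moebius_def)
  then have "cnj a * cnj \<omega> + cnj b = cnj \<xi> * (cnj c * cnj \<omega> + cnj d)"
    by (metis complex_cnj_add complex_cnj_mult)
  then have "(cnj a * cnj \<omega> + cnj b) * (\<omega> * \<xi>) = (cnj \<xi> * (cnj c * cnj \<omega> + cnj d)) * (\<omega> * \<xi>)" by simp
  then have "cnj a * (cnj \<omega> * \<omega>) * \<xi> + cnj b * \<omega> * \<xi> = (cnj \<xi> * \<xi>) * (cnj c * (cnj \<omega> * \<omega>) + cnj d * \<omega>)"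
    by (simp only: algebra_simps)
  then have "cnj a * \<xi> + - cnj c = \<omega> * (- cnj b * \<xi> + cnj d)"
    unfolding x1 by (simp add: algebra_simps)
  moreover have "- cnj b * \<xi> + cnj d \<noteq> 0"
    using K.den_nonzero[of \<xi>] xi by (simp add: \<xi>_def)
  ultimately show ?thesis by (simp add: krein_adjoint_def moebius_def \<xi>_def)
qed

lemma moebius_compose:
  assumes "linear_fractional a' b' c' d'"
  shows "linear_fractional (a * a' + b * c') (a * b' + b * d') (c * a' + d * c') (c * b' + d * d')"
    and "\<And>z. cmod z \<le> 1 \<Longrightarrow> \<phi> (moebius a' b' c' d' z) = moebius (a * a' + b * c') (a * b' + b * d') (c * a' + d * c') (c * b' + d * d') z"
proof -
  interpret L: linear_fractional a' b' c' d' by fact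
  have den: "(c * a' + d * c') * z + (c * b' + d * d') = (c * L.\<phi> z + d) * (c' * z + d')" 
    and num: "(a * a' + b * c') * z + (a * b' + b * d') = (a * L.\<phi> z + b) * (c' * z + d')" if "cmod z \<le> 1" for z
    using L.den_nonzero[OF that] by (simp_all add: moebius_def divide_simps) (simp_all add: algebra_simps)
  show eq: "\<phi> (L.\<phi> z) = moebius (a * a' + b * c') (a * b' + b * d') (c * a' + d * c') (c * b' + d * d') z"
    if z: "cmod z \<le> 1" for z
    unfolding moebius_def[of "a * a' + b * c'"] den[OF z] num[OF z]
    using L.den_nonzero[OF z] by (simp add: moebius_def[of a])
  show "linear_fractional (a * a' + b * c') (a * b' + b * d') (c * a' + d * c') (c * b' + d * d')"
    unfolding linear_fractional_def moebius_self_map_def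
  proof (intro conjI ballI subsetI)
    have "(a * a' + b * c') * (c * b' + d * d') - (a * b' + b * d') * (c * a' + d * c') = \<Delta> * L.\<Delta>"
      by (simp add: algebra_simps)
    then show "(a * a' + b * c') * (c * b' + d * d') - (a * b' + b * d') * (c * a' + d * c') \<noteq> 0"
      using det_nonzero L.det_nonzero by simp
    fix z assume z: "z \<in> unit_disc"
    show "(c * a' + d * c') * z + (c * b' + d * d') \<noteq> 0"
      using den_nonzero_disc[OF L.map_disc[OF z]] L.den_nonzero_disc[OF z] z by (subst den) auto
  next
    fix x assume "x \<in> moebius (a * a' + b * c') (a * b' + b * d') (c * a' + d * c') (c * b' + d * d') ` unit_disc"
    then obtain z where z: "z \<in> unit_disc" and x: "x = \<phi> (L.\<phi> z)" using eq by force
    then show "x \<in> unit_disc" using map_disc L.map_disc by blast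
  qed
qed

end

section \<open>Boundedness of composition operators\<close>

lemma disc_deriv_cong:
  assumes "\<And>z. z \<in> unit_disc \<Longrightarrow> f z = g z"
  shows "disc_deriv f = disc_deriv g"
proof
  fix z
  show "disc_deriv f z = disc_deriv g z"
  proof (cases "z \<in> unit_disc")
    case True
    have "eventually (\<lambda>w. f w = g w) (nhds z)"
      using eventually_nhds_in_open[OF open_ball True] by (rule eventually_mono) (rule assms)
    then have "deriv f z = deriv g z" by (rule deriv_cong_ev) simp
    then show ?thesis by (simp add: disc_deriv_def)
  qed (simp add: disc_deriv_def)
qed

locale dirichlet_composition = negative_weight + linear_fractional
begin

lemma composition_holomorphic:
  assumes "f holomorphic_on unit_disc"
  shows "composition_op \<phi> f holomorphic_on unit_disc"
proof (rule holomorphic_transform)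
  show "(f \<circ> \<phi>) holomorphic_on unit_disc"
    using map_disc by (intro holomorphic_on_compose_gen[OF moebius_holomorphic assms]) auto
qed (simp add: composition_op_def)

lemma disc_deriv_composition:
  assumes f: "f holomorphic_on unit_disc"
  shows "disc_deriv (composition_op \<phi> f) z = (if z \<in> unit_disc then deriv f (\<phi> z) * deriv \<phi> z else 0)"
proof (cases "z \<in> unit_disc")
  case True
  have "((\<lambda>z. f (\<phi> z)) has_field_derivative deriv f (\<phi> z) * deriv \<phi> z) (at z)"
    by (rule DERIV_chain2[OF holomorphic_derivI[OF f open_ball map_disc[OF True]]
        holomorphic_derivI[OF moebius_holomorphic open_ball True]])
  then have "deriv (\<lambda>z. f (\<phi> z)) z = deriv f (\<phi> z) * deriv \<phi> z" by (rule DERIV_imp_deriv)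
  moreover have "disc_deriv (composition_op \<phi> f) = disc_deriv (\<lambda>z. f (\<phi> z))"
    by (rule disc_deriv_cong) (simp add: composition_op_def)
  ultimately show ?thesis using True by (simp add: disc_deriv_def)
qed (auto simp: disc_deriv_def)

text \<open>The map expands distances at least by the factor \<open>lower_lip\<close>, so that the preimage of a ball of radius
  \<open>t\<close> is contained in a ball of comparable radius.\<close>

lemma preimage_measure_le:
  obtains C where "0 < C" "\<And>u t. 0 < t \<Longrightarrow>
    emeasure A {z \<in> unit_disc. dist (\<phi> z) u < t} \<le> ennreal (C * t powr (2 + \<alpha>))"
proof -
  obtain C where C: "0 < C" "\<And>p t. 0 < t \<Longrightarrow> emeasure A (ball p t) \<le> ennreal (C * t powr (2 + \<alpha>))"
    by (rule weighted_area_ball_le) blast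
  define k where "k = 2 / lower_lip"
  have k: "0 < k" using lower_lip_pos by (simp add: k_def)
  show ?thesis
  proof
    show "0 < C * k powr (2 + \<alpha>)" using C k by simp
    fix u and t :: real assume t: "0 < t"
    show "emeasure A {z \<in> unit_disc. dist (\<phi> z) u < t} \<le> ennreal (C * k powr (2 + \<alpha>) * t powr (2 + \<alpha>))"
    proof (cases "{z \<in> unit_disc. dist (\<phi> z) u < t} = {}")
      case False
      then obtain z0 where z0: "z0 \<in> unit_disc" "dist (\<phi> z0) u < t" by auto
      have "{z \<in> unit_disc. dist (\<phi> z) u < t} \<subseteq> ball z0 (k * t)"
      proof
        fix z assume z: "z \<in> {z \<in> unit_disc. dist (\<phi> z) u < t}"
        have "lower_lip * cmod (z0 - z) \<le> dist (\<phi> z0) (\<phi> z)"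
          using moebius_lipschitz_lower[of z0 z] z z0 by (simp add: dist_norm)
        also have "\<dots> < 2 * t"
          using dist_triangle[of "\<phi> z0" "\<phi> z" u] z z0 by (simp add: dist_commute)
        finally show "z \<in> ball z0 (k * t)"
          using lower_lip_pos by (simp add: k_def dist_norm field_simps)
      qed
      then have "emeasure A {z \<in> unit_disc. dist (\<phi> z) u < t} \<le> emeasure A (ball z0 (k * t))"
        by (rule emeasure_mono) simp
      also have "\<dots> \<le> ennreal (C * (k * t) powr (2 + \<alpha>))" using k t by (intro C) simp
      finally show ?thesis using k t by (simp add: powr_mult mult.assoc)
    next
      case True
      then show ?thesis by (simp only: emeasure_empty) simp
    qed
  qed
qed

text \<open>By Tonelli's theorem, averaging \<open>\<bar>f' (\<phi> z)\<bar>\<^sup>2\<close> and integrating over \<open>z\<close> first leaves the weighted area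
  of the preimage of a ball of radius \<open>1 - \<bar>u\<bar>\<close>, which is of order \<open>(1 - \<bar>u\<bar>)\<^sup>2\<^sup>+\<^sup>\<alpha>\<close>. The factor
  \<open>(1 - \<bar>u\<bar>)\<^sup>-\<^sup>2\<close> of the kernel reduces it to the weight.\<close>

lemma pullback_integral_le:
  obtains K where "0 \<le> K" "\<And>f. f holomorphic_on unit_disc \<Longrightarrow>
    (\<integral>\<^sup>+z\<in>unit_disc. ennreal ((cmod (disc_deriv f (\<phi> z)))\<^sup>2) \<partial>A)
      \<le> ennreal K * (\<integral>\<^sup>+u. ennreal ((cmod (disc_deriv f u))\<^sup>2) \<partial>A)"
proof -
  note [measurable] = moebius_measurable
  obtain C where C: "0 < C" "\<And>u t. 0 < t \<Longrightarrow>
    emeasure A {z \<in> unit_disc. dist (\<phi> z) u < t} \<le> ennreal (C * t powr (2 + \<alpha>))"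
    by (rule preimage_measure_le) blast
  define K where "K = 25 / pi * C * (1 / 2) powr \<alpha> * (pi / (1 + \<alpha>))"
  have K: "0 \<le> K" using C \<alpha>_gt by (simp add: K_def)
  show ?thesis
  proof
    show "0 \<le> K" by (rule K)
    fix f assume f: "f holomorphic_on unit_disc"
    note [measurable] = measurable_disc_deriv[OF f]
    define g where "g u = ennreal ((cmod (disc_deriv f u))\<^sup>2)" for u
    have [measurable]: "g \<in> borel_measurable borel" unfolding g_def by measurable
    define k where "k u = ennreal (25 / (pi * (1 - cmod u)\<^sup>2)) * indicator unit_disc u * g u" for u
    have [measurable]: "k \<in> borel_measurable borel" unfolding k_def by measurable
    define G where "G z u = indicator {p \<in> unit_disc \<times> UNIV. dist (\<phi> (fst p)) (snd p) < 1 - cmod (snd p)} (z, u) * k u" for z u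
    interpret P: pair_sigma_finite A lborel
      by (intro pair_sigma_finite.intro A.sigma_finite_measure_axioms lborel.sigma_finite_measure_axioms)
    have meas: "case_prod G \<in> borel_measurable (A \<Otimes>\<^sub>M lborel)"
    proof -
      have "{p \<in> space (A \<Otimes>\<^sub>M lborel). fst p \<in> unit_disc \<and> dist (\<phi> (fst p)) (snd p) < 1 - cmod (snd p)} \<in> sets (A \<Otimes>\<^sub>M lborel)"
        by measurable
      moreover have "{p \<in> space (A \<Otimes>\<^sub>M lborel). fst p \<in> unit_disc \<and> dist (\<phi> (fst p)) (snd p) < 1 - cmod (snd p)}
          = {p \<in> unit_disc \<times> UNIV. dist (\<phi> (fst p)) (snd p) < 1 - cmod (snd p)}"
        by (auto simp: space_pair_measure)
      ultimately have [measurable]: "{p \<in> unit_disc \<times> UNIV. dist (\<phi> (fst p)) (snd p) < 1 - cmod (snd p)} \<in> sets (A \<Otimes>\<^sub>M lborel)"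
        by simp
      have eq: "case_prod G = (\<lambda>p. indicator {p \<in> unit_disc \<times> UNIV. dist (\<phi> (fst p)) (snd p) < 1 - cmod (snd p)} p * k (snd p))"
        by (auto simp: G_def fun_eq_iff)
      show ?thesis unfolding eq by measurable
    qed
    have "(\<integral>\<^sup>+z\<in>unit_disc. g (\<phi> z) \<partial>A) \<le> (\<integral>\<^sup>+z. \<integral>\<^sup>+u. G z u \<partial>lborel \<partial>A)"
    proof (rule nn_integral_mono)
      fix z
      show "g (\<phi> z) * indicator unit_disc z \<le> (\<integral>\<^sup>+u. G z u \<partial>lborel)"
      proof (cases "z \<in> unit_disc")
        case True
        have "g (\<phi> z) \<le> (\<integral>\<^sup>+u. ennreal (25 / (pi * (1 - cmod u)\<^sup>2)) * indicator {u \<in> unit_disc. dist (\<phi> z) u < 1 - cmod u} u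
          * ennreal ((cmod (disc_deriv f u))\<^sup>2) \<partial>lborel)"
          unfolding g_def by (rule deriv_sq_le_average[OF f map_disc[OF True]])
        also have "\<dots> = (\<integral>\<^sup>+u. G z u \<partial>lborel)"
          using True by (intro nn_integral_cong) (auto simp: G_def k_def g_def indicator_def)
        finally show ?thesis using True by simp
      qed simp
    qed
    also have "\<dots> = (\<integral>\<^sup>+u. \<integral>\<^sup>+z. G z u \<partial>A \<partial>lborel)"
      by (rule P.Fubini'[symmetric, OF meas])
    also have "\<dots> \<le> (\<integral>\<^sup>+u. ennreal K * (ennreal ((1 + \<alpha>) / pi) * (ennreal ((1 - (cmod u)\<^sup>2) powr \<alpha>) * indicator unit_disc u * g u)) \<partial>lborel)"
    proof (rule nn_integral_mono)
      fix u
      show "(\<integral>\<^sup>+z. G z u \<partial>A) \<le> ennreal K * (ennreal ((1 + \<alpha>) / pi) * (ennreal ((1 - (cmod u)\<^sup>2) powr \<alpha>) * indicator unit_disc u * g u))"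
      proof (cases "u \<in> unit_disc")
        case True
        define t where "t = 1 - cmod u"
        have t: "0 < t" using True by (simp add: t_def)
        have [measurable]: "{z \<in> unit_disc. dist (\<phi> z) u < t} \<in> sets A"
          by (simp only: sets_weighted_area) measurable
        have "(\<integral>\<^sup>+z. G z u \<partial>A) = (\<integral>\<^sup>+z. k u * indicator {z \<in> unit_disc. dist (\<phi> z) u < t} z \<partial>A)"
          by (intro nn_integral_cong) (auto simp: G_def t_def indicator_def)
        also have "\<dots> = k u * emeasure A {z \<in> unit_disc. dist (\<phi> z) u < t}"
          by (rule nn_integral_cmult_indicator) measurable
        also have "\<dots> \<le> k u * ennreal (C * t powr (2 + \<alpha>))"
          by (intro mult_left_mono C t) auto
        also have "\<dots> = ennreal (25 / (pi * t\<^sup>2)) * ennreal (C * t powr (2 + \<alpha>)) * g u"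
          using True by (simp add: k_def t_def mult_ac)
        also have "ennreal (25 / (pi * t\<^sup>2)) * ennreal (C * t powr (2 + \<alpha>)) = ennreal (25 / pi * C * t powr \<alpha>)"
        proof -
          have "t powr (2 + \<alpha>) = t\<^sup>2 * t powr \<alpha>" using t by (simp add: powr_add powr_numeral)
          then show ?thesis using t C by (subst ennreal_mult[symmetric]) auto
        qed
        also have "\<dots> * g u \<le> ennreal (K * ((1 + \<alpha>) / pi * (1 - (cmod u)\<^sup>2) powr \<alpha>)) * g u"
        proof (intro mult_right_mono ennreal_leI)
          have "1 - (cmod u)\<^sup>2 = t * (1 + cmod u)" by (simp add: t_def power2_eq_square algebra_simps)
          also have "\<dots> \<le> t * 2" using True t by (intro mult_left_mono) auto
          finally have le: "1/2 * (1 - (cmod u)\<^sup>2) \<le> t" by simp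
          have pos: "0 < 1 - (cmod u)\<^sup>2" using True by (simp add: power_less_one_iff)
          have "t powr \<alpha> \<le> (1/2 * (1 - (cmod u)\<^sup>2)) powr \<alpha>"
            using le pos \<alpha>_less by (intro powr_mono2') auto
          also have "\<dots> = (1/2) powr \<alpha> * (1 - (cmod u)\<^sup>2) powr \<alpha>"
            using pos by (intro powr_mult)
          finally have "25 / pi * C * t powr \<alpha> \<le> 25 / pi * C * ((1/2) powr \<alpha> * (1 - (cmod u)\<^sup>2) powr \<alpha>)"
            using C by (intro mult_left_mono) auto
          also have "\<dots> = K * ((1 + \<alpha>) / pi * (1 - (cmod u)\<^sup>2) powr \<alpha>)"
            using \<alpha>_gt by (simp add: K_def)
          finally show "25 / pi * C * t powr \<alpha> \<le> K * ((1 + \<alpha>) / pi * (1 - (cmod u)\<^sup>2) powr \<alpha>)" .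
        qed auto
        also have "\<dots> = ennreal K * (ennreal ((1 + \<alpha>) / pi) * (ennreal ((1 - (cmod u)\<^sup>2) powr \<alpha>) * indicator unit_disc u * g u))"
        proof -
          have "ennreal (K * (P * Q)) = ennreal K * (ennreal P * ennreal Q)" if "0 \<le> P" "0 \<le> Q" for P Q
            using K that by (simp add: ennreal_mult)
          then show ?thesis using True \<alpha>_gt by (simp only: mult.assoc indicator_simps mult_1 divide_nonneg_pos pi_gt_zero powr_ge_zero)
        qed
        finally show ?thesis .
      qed (simp add: G_def k_def)
    qed
    also have "\<dots> = ennreal K * (\<integral>\<^sup>+u. g u \<partial>A)"
      by (subst nn_integral_cmult) (auto simp: nn_integral_weighted_area[OF \<alpha>_gt])
    finally show "(\<integral>\<^sup>+z\<in>unit_disc. ennreal ((cmod (disc_deriv f (\<phi> z)))\<^sup>2) \<partial>A)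
      \<le> ennreal K * (\<integral>\<^sup>+u. ennreal ((cmod (disc_deriv f u))\<^sup>2) \<partial>A)" by (simp add: g_def)
  qed
qed

lemma composition_bounded:
  obtains B where "0 < B" "\<And>f. f \<in> hcarrier D \<Longrightarrow> composition_op \<phi> f \<in> hcarrier D"
    "\<And>f. f \<in> hcarrier D \<Longrightarrow> hnorm D (composition_op \<phi> f) \<le> B * hnorm D f"
proof -
  obtain K where K: "0 \<le> K" and le: "\<And>f. f holomorphic_on unit_disc \<Longrightarrow>
    (\<integral>\<^sup>+z\<in>unit_disc. ennreal ((cmod (disc_deriv f (\<phi> z)))\<^sup>2) \<partial>A)
      \<le> ennreal K * (\<integral>\<^sup>+u. ennreal ((cmod (disc_deriv f u))\<^sup>2) \<partial>A)"
    by (rule pullback_integral_le) blast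
  define K0 where "K0 = 1 + 2 / sqrt (1 + \<alpha>) / (1 - cmod (\<phi> 0))"
  define B where "B = 1 + sqrt (K0\<^sup>2 + upper_lip\<^sup>2 * K)"
  have B: "0 < B" unfolding B_def using K by (intro add_pos_nonneg) auto
  have main: "composition_op \<phi> f \<in> hcarrier D \<and> hnorm D (composition_op \<phi> f) \<le> B * hnorm D f"
    if f: "f \<in> hcarrier D" for f
  proof -
    let ?h = "composition_op \<phi> f"
    have fhol: "f holomorphic_on unit_disc" using f by (simp add: hcarrier_dirichlet_iff)
    have hhol: "?h holomorphic_on unit_disc" by (rule composition_holomorphic[OF fhol])
    note [measurable] = measurable_disc_deriv[OF fhol] measurable_disc_deriv[OF hhol] moebius_measurable
    have "(\<integral>\<^sup>+z. ennreal ((cmod (disc_deriv ?h z))\<^sup>2) \<partial>A)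
        \<le> (\<integral>\<^sup>+z. ennreal (upper_lip\<^sup>2) * (ennreal ((cmod (disc_deriv f (\<phi> z)))\<^sup>2) * indicator unit_disc z) \<partial>A)"
    proof (rule nn_integral_mono)
      fix z
      show "ennreal ((cmod (disc_deriv ?h z))\<^sup>2) \<le> ennreal (upper_lip\<^sup>2) * (ennreal ((cmod (disc_deriv f (\<phi> z)))\<^sup>2) * indicator unit_disc z)"
      proof (cases "z \<in> unit_disc")
        case True
        have "(cmod (deriv \<phi> z))\<^sup>2 \<le> upper_lip\<^sup>2"
          using deriv_moebius_le[of z] True by (intro power_mono) auto
        then have "(cmod (disc_deriv ?h z))\<^sup>2 \<le> upper_lip\<^sup>2 * (cmod (disc_deriv f (\<phi> z)))\<^sup>2"
          using True map_disc[OF True]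
          by (simp add: disc_deriv_composition[OF fhol] norm_mult power_mult_distrib disc_deriv_def[of f]
              mult.commute[of "(cmod (deriv f (\<phi> z)))\<^sup>2"] mult_right_mono)
        then show ?thesis using True by (simp flip: ennreal_mult add: ennreal_leI)
      qed (simp add: disc_deriv_def)
    qed
    also have "\<dots> = ennreal (upper_lip\<^sup>2) * (\<integral>\<^sup>+z\<in>unit_disc. ennreal ((cmod (disc_deriv f (\<phi> z)))\<^sup>2) \<partial>A)"
      by (rule nn_integral_cmult) measurable
    also have "\<dots> \<le> ennreal (upper_lip\<^sup>2) * (ennreal K * (\<integral>\<^sup>+u. ennreal ((cmod (disc_deriv f u))\<^sup>2) \<partial>A))"
      by (intro mult_left_mono le fhol) auto
    also have "\<dots> \<le> ennreal (upper_lip\<^sup>2) * (ennreal K * ennreal ((hnorm D f)\<^sup>2))"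
      by (intro mult_left_mono dirichlet_deriv_nn_integral_le f) auto
    also have "\<dots> = ennreal (upper_lip\<^sup>2 * K * (hnorm D f)\<^sup>2)"
      using K by (simp add: ennreal_mult mult.assoc)
    finally have int: "(\<integral>\<^sup>+z. ennreal ((cmod (disc_deriv ?h z))\<^sup>2) \<partial>A) \<le> ennreal (upper_lip\<^sup>2 * K * (hnorm D f)\<^sup>2)" .
    then have "(\<integral>\<^sup>+z. ennreal ((cmod (disc_deriv ?h z))\<^sup>2) \<partial>A) < \<infinity>"
      by (rule order.strict_trans1) simp
    then have "integrable A (\<lambda>z. (cmod (disc_deriv ?h z))\<^sup>2)"
      by (intro integrableI_bounded) auto
    then have hD: "?h \<in> hcarrier D"
      using hhol by (auto simp: hcarrier_dirichlet_iff composition_op_def)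
    have "(LINT z|A. (cmod (disc_deriv ?h z))\<^sup>2) \<le> upper_lip\<^sup>2 * K * (hnorm D f)\<^sup>2"
      using int K unfolding dirichlet_deriv_nn_integral[OF hD] by (subst (asm) ennreal_le_iff) auto
    moreover have "(cmod (?h 0))\<^sup>2 \<le> K0\<^sup>2 * (hnorm D f)\<^sup>2"
    proof -
      have "cmod (?h 0) \<le> K0 * hnorm D f"
        unfolding K0_def using dirichlet_value_bound[OF f, of "\<phi> 0" "cmod (\<phi> 0)"] map_disc[of 0]
        by (simp add: composition_op_def)
      then have "(cmod (?h 0))\<^sup>2 \<le> (K0 * hnorm D f)\<^sup>2" by (intro power_mono) auto
      then show ?thesis by (simp add: power_mult_distrib)
    qed
    ultimately have "(hnorm D ?h)\<^sup>2 \<le> (K0\<^sup>2 + upper_lip\<^sup>2 * K) * (hnorm D f)\<^sup>2"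
      by (simp add: hnorm_sq_dirichlet[of \<alpha> ?h] algebra_simps)
    also have "\<dots> = (sqrt (K0\<^sup>2 + upper_lip\<^sup>2 * K) * hnorm D f)\<^sup>2"
      using K by (simp add: power_mult_distrib)
    finally have "hnorm D ?h \<le> sqrt (K0\<^sup>2 + upper_lip\<^sup>2 * K) * hnorm D f"
      by (rule power2_le_imp_le) (use K D.hnorm_nonneg[OF f] in auto)
    also have "\<dots> \<le> B * hnorm D f"
      using D.hnorm_nonneg[OF f] by (intro mult_right_mono) (auto simp: B_def)
    finally show ?thesis using hD by blast
  qed
  show ?thesis by (rule that[OF B]) (use main in blast)+
qed

lemma composition_linear: "linear_op D (composition_op \<phi>)"
proof -
  obtain B where "\<And>f. f \<in> hcarrier D \<Longrightarrow> composition_op \<phi> f \<in> hcarrier D"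
    by (rule composition_bounded) blast
  then show ?thesis unfolding linear_op_def by (auto simp: composition_op_def fun_eq_iff)
qed

end

section \<open>Compactness without a common boundary contact\<close>

text \<open>A bounded sequence in \<open>L\<^sup>2\<close> that tends to \<open>0\<close> pointwise tends to \<open>0\<close> weakly. Where \<open>s \<bar>u n\<bar> \<le> \<bar>k\<bar>\<close> the
  product is dominated by \<open>\<bar>k\<bar>\<^sup>2 / s\<close>, elsewhere it is at most \<open>s \<bar>u n\<bar>\<^sup>2\<close>, whose integral is at most
  \<open>s B\<close>.\<close>

lemma L2_product_tendsto_0:
  fixes u :: "nat \<Rightarrow> 'b \<Rightarrow> complex"
  assumes [measurable]: "\<And>n. u n \<in> borel_measurable M" "k \<in> borel_measurable M"
    and u: "\<And>n. integrable M (\<lambda>z. (cmod (u n z))\<^sup>2)" "\<And>n. (LINT z|M. (cmod (u n z))\<^sup>2) \<le> B"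
    and k: "integrable M (\<lambda>z. (cmod (k z))\<^sup>2)"
    and conv: "\<And>z. (\<lambda>n. u n z) \<longlonglongrightarrow> 0"
  shows "(\<lambda>n. LINT z|M. cmod (u n z) * cmod (k z)) \<longlonglongrightarrow> 0"
proof (rule LIMSEQ_I)
  fix e :: real assume e: "0 < e"
  have B: "0 \<le> B" using u(2)[of 0] by (rule order_trans[rotated]) (auto intro: Bochner_Integration.integral_nonneg)
  define s where "s = e / (2 * (1 + B))"
  have s: "0 < s" "s * B < e / 2" using e B by (auto simp: s_def field_simps)
  define w where "w n z = min (cmod (u n z) * cmod (k z)) ((cmod (k z))\<^sup>2 / s)" for n z
  have [measurable]: "w n \<in> borel_measurable M" for n unfolding w_def by measurable
  have kint: "integrable M (\<lambda>z. (cmod (k z))\<^sup>2 / s)" using k by simp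
  have wbound: "norm (w n z) \<le> (cmod (k z))\<^sup>2 / s" for n z
    using s by (simp add: w_def)
  have wint: "integrable M (w n)" for n
    by (rule Bochner_Integration.integrable_bound[OF kint]) (use wbound s in auto)
  have "(\<lambda>n. LINT z|M. w n z) \<longlonglongrightarrow> (LINT z|M. (0 :: real))"
  proof (rule integral_dominated_convergence[OF _ _ kint])
    show "AE z in M. (\<lambda>n. w n z) \<longlonglongrightarrow> 0"
    proof (rule AE_I2)
      fix z
      have "(\<lambda>n. min (cmod (u n z) * cmod (k z)) ((cmod (k z))\<^sup>2 / s)) \<longlonglongrightarrow> min (cmod 0 * cmod (k z)) ((cmod (k z))\<^sup>2 / s)"
        by (intro tendsto_intros conv)
      then show "(\<lambda>n. w n z) \<longlonglongrightarrow> 0" using s by (simp add: w_def)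
    qed
  qed (use wbound in auto)
  then have "(\<lambda>n. LINT z|M. w n z) \<longlonglongrightarrow> 0" by simp
  then have "eventually (\<lambda>n. (LINT z|M. w n z) < e / 2) sequentially"
    using e by (intro order_tendstoD(2)) auto
  then obtain N where N: "(LINT z|M. w n z) < e / 2" if "n \<ge> N" for n
    by (auto simp: eventually_sequentially)
  have "norm ((LINT z|M. cmod (u n z) * cmod (k z)) - 0) < e" if n: "n \<ge> N" for n
  proof -
    have le: "cmod (u n z) * cmod (k z) \<le> w n z + s * (cmod (u n z))\<^sup>2" for z
    proof (cases "cmod (u n z) * cmod (k z) \<le> (cmod (k z))\<^sup>2 / s")
      case True
      then show ?thesis using s by (simp add: w_def)
    next
      case False
      then have "(cmod (k z))\<^sup>2 < cmod (u n z) * cmod (k z) * s" using s by (simp add: field_simps)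
      then have "cmod (k z) * cmod (k z) < (cmod (u n z) * s) * cmod (k z)" by (simp add: power2_eq_square mult_ac)
      then have "cmod (k z) < cmod (u n z) * s" by (rule mult_right_less_imp_less) simp
      then have "cmod (u n z) * cmod (k z) \<le> cmod (u n z) * (cmod (u n z) * s)"
        by (intro mult_left_mono) auto
      moreover have "0 \<le> w n z" using s by (simp add: w_def)
      ultimately show ?thesis by (simp add: power2_eq_square mult_ac)
    qed
    have "(LINT z|M. cmod (u n z) * cmod (k z)) \<le> (LINT z|M. w n z + s * (cmod (u n z))\<^sup>2)"
      by (rule integral_mono[OF integrable_mult_cnj(2)[OF _ _ u(1) k] _ le]) (use wint u in auto)
    also have "\<dots> = (LINT z|M. w n z) + s * (LINT z|M. (cmod (u n z))\<^sup>2)"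
      using wint u by simp
    also have "\<dots> \<le> (LINT z|M. w n z) + s * B" using u(2) s by (intro add_left_mono mult_left_mono) auto
    also have "\<dots> < e" using N[OF n] s by simp
    finally have "(LINT z|M. cmod (u n z) * cmod (k z)) < e" .
    moreover have "0 \<le> (LINT z|M. cmod (u n z) * cmod (k z))" by (intro Bochner_Integration.integral_nonneg) auto
    ultimately show ?thesis by simp
  qed
  then show "\<exists>N. \<forall>n\<ge>N. norm ((LINT z|M. cmod (u n z) * cmod (k z)) - 0) < e" by blast
qed

text \<open>Replacing \<open>v n\<close> by its limit \<open>k\<close> reduces the claim to weak convergence of \<open>u n\<close>. The error
  \<open>u n (v n - k)\<close> is small on \<open>U\<close> because of its second factor and off \<open>U\<close> because of its first.\<close>

lemma L2_split_tendsto_0: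
  fixes u v :: "nat \<Rightarrow> 'b \<Rightarrow> complex"
  assumes M: "finite_measure M"
    and [measurable]: "\<And>n. u n \<in> borel_measurable M" "\<And>n. v n \<in> borel_measurable M" "k \<in> borel_measurable M"
    and u: "\<And>n. integrable M (\<lambda>z. (cmod (u n z))\<^sup>2)" "\<And>n. (LINT z|M. (cmod (u n z))\<^sup>2) \<le> B"
    and v: "\<And>n. integrable M (\<lambda>z. (cmod (v n z))\<^sup>2)" "\<And>n. (LINT z|M. (cmod (v n z))\<^sup>2) \<le> B"
    and k: "integrable M (\<lambda>z. (cmod (k z))\<^sup>2)" "(LINT z|M. (cmod (k z))\<^sup>2) \<le> B"
    and conv: "\<And>z. (\<lambda>n. u n z) \<longlonglongrightarrow> 0"
    and U: "\<And>e. 0 < e \<Longrightarrow> eventually (\<lambda>n. \<forall>z\<in>U. cmod (v n z - k z) \<le> e) sequentially"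
    and nU: "\<And>e. 0 < e \<Longrightarrow> eventually (\<lambda>n. \<forall>z. z \<notin> U \<longrightarrow> cmod (u n z) \<le> e) sequentially"
  shows "(\<lambda>n. LINT z|M. v n z * cnj (u n z)) \<longlonglongrightarrow> 0"
proof (rule LIMSEQ_I)
  interpret finite_measure M by (rule M)
  fix e :: real assume e: "0 < e"
  have B: "0 \<le> B" using k(2) by (rule order_trans[rotated]) (auto intro: Bochner_Integration.integral_nonneg)
  define m where "m = measure M (space M)"
  have m: "0 \<le> m" by (simp add: m_def)
  define s where "s = e / (4 * (1 + 3 * B + 3 * m))"
  have s: "0 < s" "s * (3 * B + 3 * m) < e / 2"
    using e B m by (auto simp: s_def field_simps add_pos_nonneg)
  have "eventually (\<lambda>n. (LINT z|M. cmod (u n z) * cmod (k z)) < e / 2) sequentially"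
    using e by (intro order_tendstoD(2)[OF L2_product_tendsto_0[OF _ _ u k(1) conv]]) auto
  then have "eventually (\<lambda>n. norm ((LINT z|M. v n z * cnj (u n z)) - 0) < e) sequentially"
    using U[OF s(1)] nU[OF s(1)]
  proof eventually_elim
    case (elim n)
    have sq: "x \<le> x\<^sup>2 + 1" for x :: real
      using zero_le_power2[of "x - 1"] zero_le_power2[of x] unfolding power2_diff by (smt (verit) mult_cancel_left1 one_power2)
    have le: "norm (v n z * cnj (u n z)) \<le> cmod (u n z) * cmod (k z) + s * ((cmod (u n z))\<^sup>2 + (cmod (v n z))\<^sup>2 + (cmod (k z))\<^sup>2 + 3)" for z
    proof -
      have "cmod (v n z) \<le> cmod (k z) + cmod (v n z - k z)" by (rule norm_triangle_sub)
      then have "cmod (u n z) * cmod (v n z) \<le> cmod (u n z) * (cmod (k z) + cmod (v n z - k z))"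
        by (rule mult_left_mono) simp
      also have "\<dots> = cmod (u n z) * cmod (k z) + cmod (u n z) * cmod (v n z - k z)" by (simp add: algebra_simps)
      also have "cmod (u n z) * cmod (v n z - k z) \<le> s * (cmod (u n z) + cmod (v n z) + cmod (k z))"
      proof (cases "z \<in> U")
        case True
        then have "cmod (u n z) * cmod (v n z - k z) \<le> cmod (u n z) * s" using elim by (intro mult_left_mono) auto
        also have "\<dots> \<le> s * (cmod (u n z) + cmod (v n z) + cmod (k z))" using s by (simp add: algebra_simps)
        finally show ?thesis .
      next
        case False
        then have "cmod (u n z) * cmod (v n z - k z) \<le> s * (cmod (v n z) + cmod (k z))"
          using elim s by (intro mult_mono norm_triangle_ineq4) auto
        also have "\<dots> \<le> s * (cmod (u n z) + cmod (v n z) + cmod (k z))" using s by (simp add: algebra_simps)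
        finally show ?thesis .
      qed
      also have "s * (cmod (u n z) + cmod (v n z) + cmod (k z)) \<le> s * ((cmod (u n z))\<^sup>2 + (cmod (v n z))\<^sup>2 + (cmod (k z))\<^sup>2 + 3)"
        using s sq[of "cmod (u n z)"] sq[of "cmod (v n z)"] sq[of "cmod (k z)"] by (intro mult_left_mono) auto
      finally show ?thesis by (simp add: norm_mult mult.commute)
    qed
    have i1: "integrable M (\<lambda>z. cmod (u n z) * cmod (k z))" by (rule integrable_mult_cnj(2)[OF _ _ u(1) k(1)]) measurable
    have i2: "integrable M (\<lambda>z. v n z * cnj (u n z))" by (rule integrable_mult_cnj(1)[OF _ _ v(1) u(1)]) measurable
    have i3: "integrable M (\<lambda>z. (cmod (u n z))\<^sup>2 + (cmod (v n z))\<^sup>2 + (cmod (k z))\<^sup>2 + 3)"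
      using u(1) v(1) k(1) by simp
    have "norm (LINT z|M. v n z * cnj (u n z)) \<le> (LINT z|M. norm (v n z * cnj (u n z)))"
      by (rule integral_norm_bound)
    also have "\<dots> \<le> (LINT z|M. cmod (u n z) * cmod (k z) + s * ((cmod (u n z))\<^sup>2 + (cmod (v n z))\<^sup>2 + (cmod (k z))\<^sup>2 + 3))"
      by (rule integral_mono[OF integrable_norm[OF i2] _ le]) (use i1 i3 in auto)
    also have "\<dots> = (LINT z|M. cmod (u n z) * cmod (k z)) + s * ((LINT z|M. (cmod (u n z))\<^sup>2) + (LINT z|M. (cmod (v n z))\<^sup>2) + (LINT z|M. (cmod (k z))\<^sup>2) + 3 * m)"
      using i1 i3 u(1) v(1) k(1) by (simp add: m_def mult.commute)
    also have "\<dots> \<le> (LINT z|M. cmod (u n z) * cmod (k z)) + s * (3 * B + 3 * m)"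
      using u(2)[of n] v(2)[of n] k(2) s by (intro add_left_mono mult_left_mono) auto
    also have "\<dots> < e" using elim s by simp
    finally show ?case by simp
  qed
  then show "\<exists>N. \<forall>n\<ge>N. norm ((LINT z|M. v n z * cnj (u n z)) - 0) < e"
    by (auto simp: eventually_sequentially)
qed

context negative_weight
begin

lemma dirichlet_integral_le:
  assumes "f \<in> hcarrier D" "hnorm D f \<le> B"
  shows "(LINT z|A. (cmod (disc_deriv f z))\<^sup>2) \<le> B\<^sup>2"
proof -
  have "(hnorm D f)\<^sup>2 \<le> B\<^sup>2" using assms D.hnorm_nonneg by (intro power_mono) auto
  then show ?thesis unfolding hnorm_sq_dirichlet using zero_le_power2[of "cmod (f 0)"] by linarith
qed

end

locale two_compositions =
  phi: dirichlet_composition \<alpha> a b c d + psi: dirichlet_composition \<alpha> a' b' c' d'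
  for \<alpha> a b c d a' b' c' d'
begin

abbreviation "D \<equiv> dirichlet_space \<alpha>"
abbreviation "A \<equiv> weighted_area \<alpha>"
abbreviation "\<phi> \<equiv> moebius a b c d"
abbreviation "\<psi> \<equiv> moebius a' b' c' d'"
abbreviation "C\<phi> \<equiv> composition_op \<phi>"
abbreviation "C\<psi> \<equiv> composition_op \<psi>"

definition T :: "complex fun_op" where
  "T = adjoint_op D C\<psi> \<circ> C\<phi>"

lemma T_closed: "f \<in> hcarrier D \<Longrightarrow> T f \<in> hcarrier D"
  and T_inner: "\<lbrakk>f \<in> hcarrier D; g \<in> hcarrier D\<rbrakk> \<Longrightarrow> hinner D g (T f) = hinner D (C\<psi> g) (C\<phi> f)"
  and T_linear: "linear_op D T"
  and T_bounded: "\<exists>B>0. \<forall>f\<in>hcarrier D. hnorm D (T f) \<le> B * hnorm D f"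
proof -
  obtain B1 where B1: "0 < B1" "\<And>f. f \<in> hcarrier D \<Longrightarrow> C\<phi> f \<in> hcarrier D"
    "\<And>f. f \<in> hcarrier D \<Longrightarrow> hnorm D (C\<phi> f) \<le> B1 * hnorm D f"
    by (rule phi.composition_bounded) blast
  obtain B2 where B2: "0 < B2" "\<And>f. f \<in> hcarrier D \<Longrightarrow> C\<psi> f \<in> hcarrier D"
    "\<And>f. f \<in> hcarrier D \<Longrightarrow> hnorm D (C\<psi> f) \<le> B2 * hnorm D f"
    by (rule psi.composition_bounded) blast
  note adj = phi.D.adjoint_closed phi.D.adjoint_inner phi.D.adjoint_linear phi.D.adjoint_bound
  note adj' = adj[OF psi.composition_linear B2(3) less_imp_le[OF B2(1)]]
  show "T f \<in> hcarrier D" if "f \<in> hcarrier D" for f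
    unfolding T_def comp_def by (rule adj'(1)[OF _ B1(2)[OF that]])
  show "hinner D g (T f) = hinner D (C\<psi> g) (C\<phi> f)" if "f \<in> hcarrier D" "g \<in> hcarrier D" for f g
    unfolding T_def comp_def by (rule adj'(2)[OF _ that(2) B1(2)[OF that(1)], symmetric])
  show "linear_op D T"
    using adj'(3) phi.composition_linear unfolding T_def linear_op_def by (simp add: comp_def)
  show "\<exists>B>0. \<forall>f\<in>hcarrier D. hnorm D (T f) \<le> B * hnorm D f"
  proof (intro exI[of _ "B2 * B1"] conjI ballI)
    show "0 < B2 * B1" using B1 B2 by simp
    fix f assume f: "f \<in> hcarrier D"
    have "hnorm D (T f) \<le> B2 * hnorm D (C\<phi> f)"
      unfolding T_def comp_def by (rule adj'(4)[OF _ B1(2)[OF f]])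
    also have "\<dots> \<le> B2 * (B1 * hnorm D f)" using B1(3)[OF f] B2(1) by simp
    finally show "hnorm D (T f) \<le> B2 * B1 * hnorm D f" by simp
  qed
qed

lemma ess_norm_T_finite: "ess_norm D T < \<infinity>"
proof -
  obtain B where B: "0 < B" "\<And>f. f \<in> hcarrier D \<Longrightarrow> hnorm D (T f) \<le> B * hnorm D f"
    using T_bounded by blast
  show ?thesis by (rule phi.D.ess_norm_finite[OF B(2) less_imp_le[OF B(1)]])
qed

end

lemma (in dirichlet_composition) loc_conv_composition_uniform:
  assumes F: "\<And>n. F n \<in> hcarrier D" and g: "g \<in> hcarrier D" and conv: "loc_conv F g" and R: "R < 1" and e: "0 < e"
  shows "eventually (\<lambda>n. \<forall>z\<in>unit_disc. cmod (\<phi> z) \<le> R \<longrightarrow>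
    cmod (disc_deriv (composition_op \<phi> (F n)) z - disc_deriv (composition_op \<phi> g) z) \<le> e) sequentially"
proof -
  have hol: "F n holomorphic_on unit_disc" "g holomorphic_on unit_disc" for n
    using F g by (auto simp: hcarrier_dirichlet_iff)
  have "uniform_limit (cball 0 R) (\<lambda>n. deriv (F n)) (deriv g) sequentially"
    using loc_conv_deriv[OF conv hol] R by (simp add: loc_conv_def)
  then have "eventually (\<lambda>n. \<forall>w\<in>cball 0 R. dist (deriv (F n) w) (deriv g w) < e / upper_lip) sequentially"
    by (rule uniform_limitD) (use e upper_lip_pos in auto)
  then show ?thesis
  proof (rule eventually_mono, intro ballI impI)
    fix n z assume close: "\<forall>w\<in>cball 0 R. dist (deriv (F n) w) (deriv g w) < e / upper_lip"
      and z: "z \<in> unit_disc" "cmod (\<phi> z) \<le> R"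
    have "cmod (disc_deriv (composition_op \<phi> (F n)) z - disc_deriv (composition_op \<phi> g) z)
        = cmod ((deriv (F n) (\<phi> z) - deriv g (\<phi> z)) * deriv \<phi> z)"
      using z by (simp add: disc_deriv_composition hol algebra_simps)
    also have "\<dots> \<le> (e / upper_lip) * upper_lip"
      unfolding norm_mult using close z deriv_moebius_le[of z] e upper_lip_pos
      by (intro mult_mono) (auto simp: dist_norm less_imp_le)
    also have "\<dots> = e" using upper_lip_pos by simp
    finally show "cmod (disc_deriv (composition_op \<phi> (F n)) z - disc_deriv (composition_op \<phi> g) z) \<le> e" .
  qed
qed

lemma (in dirichlet_composition) loc_conv_composition_pointwise:
  assumes F: "\<And>n. F n \<in> hcarrier D" and g: "g \<in> hcarrier D" and conv: "loc_conv F g"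
  shows "(\<lambda>n. disc_deriv (composition_op \<phi> (F n)) z) \<longlonglongrightarrow> disc_deriv (composition_op \<phi> g) z"
proof (cases "z \<in> unit_disc")
  case True
  have hol: "F n holomorphic_on unit_disc" "g holomorphic_on unit_disc" for n
    using F g by (auto simp: hcarrier_dirichlet_iff)
  have "(\<lambda>n. deriv (F n) (\<phi> z) * deriv \<phi> z) \<longlonglongrightarrow> deriv g (\<phi> z) * deriv \<phi> z"
    by (intro tendsto_mult_right loc_conv_pointwise[OF loc_conv_deriv[OF conv hol] map_disc[OF True]])
  then show ?thesis using True by (simp add: disc_deriv_composition hol)
qed (simp add: disc_deriv_def)

context two_compositions
begin

text \<open>Two extractions of locally uniformly convergent subsequences are needed: for the given sequence, and
  for the images \<open>T (h n)\<close> of its differences \<open>h n\<close> to the limit. Neither composition operator has to be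
  compact; \<open>U\<close> separates the places where they fail to be.\<close>

lemma T_compact:
  assumes disjoint: "\<And>\<omega>. \<lbrakk>cmod \<omega> = 1; cmod (\<phi> \<omega>) = 1; cmod (\<psi> \<omega>) = 1\<rbrakk> \<Longrightarrow> False"
  shows "compact_op D T"
proof -
  obtain R where R: "R < 1" and minR: "\<And>z. z \<in> unit_disc \<Longrightarrow> min (cmod (\<phi> z)) (cmod (\<psi> z)) \<le> R"
  proof -
    have "continuous_on (cball 0 1) (\<lambda>z. min (cmod (\<phi> z)) (cmod (\<psi> z)))"
      by (intro continuous_intros phi.moebius_continuous psi.moebius_continuous)
    then obtain w where w: "w \<in> cball 0 1"
      and max: "\<forall>z\<in>cball 0 1. min (cmod (\<phi> z)) (cmod (\<psi> z)) \<le> min (cmod (\<phi> w)) (cmod (\<psi> w))"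
      using continuous_attains_sup[OF compact_cball, of 0 1 "\<lambda>z. min (cmod (\<phi> z)) (cmod (\<psi> z))"] by auto
    have "min (cmod (\<phi> w)) (cmod (\<psi> w)) < 1"
    proof (cases "cmod w = 1")
      case True
      then have "cmod (\<phi> w) \<le> 1" "cmod (\<psi> w) \<le> 1" using phi.map_cball psi.map_cball by auto
      then show ?thesis using disjoint[OF True] unfolding min_less_iff_disj by (metis order_less_le)
    next
      case False
      then have "w \<in> unit_disc" using w by auto
      then show ?thesis using phi.map_disc[of w] by (auto simp: min_less_iff_disj)
    qed
    then show ?thesis using max by (intro that) auto
  qed
  define U where "U = {z \<in> unit_disc. cmod (\<psi> z) \<le> cmod (\<phi> z)}"
  have U\<psi>: "cmod (\<psi> z) \<le> R" if "z \<in> U" for z using minR[of z] that by (auto simp: U_def)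
  have U\<phi>: "cmod (\<phi> z) \<le> R" if "z \<in> unit_disc" "z \<notin> U" for z using minR[of z] that by (auto simp: U_def)
  obtain BT where BT: "0 < BT" "\<And>f. f \<in> hcarrier D \<Longrightarrow> hnorm D (T f) \<le> BT * hnorm D f"
    using T_bounded by blast
  obtain B1 where B1: "0 < B1" "\<And>f. f \<in> hcarrier D \<Longrightarrow> C\<phi> f \<in> hcarrier D"
    "\<And>f. f \<in> hcarrier D \<Longrightarrow> hnorm D (C\<phi> f) \<le> B1 * hnorm D f"
    by (rule phi.composition_bounded) blast
  obtain B2 where B2: "0 < B2" "\<And>f. f \<in> hcarrier D \<Longrightarrow> C\<psi> f \<in> hcarrier D"
    "\<And>f. f \<in> hcarrier D \<Longrightarrow> hnorm D (C\<psi> f) \<le> B2 * hnorm D f"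
    by (rule psi.composition_bounded) blast
  have meas: "disc_deriv f \<in> borel_measurable A" if "f \<in> hcarrier D" for f
    using measurable_disc_deriv[of f] that by (simp add: hcarrier_dirichlet_iff measurable_def)
  have int: "integrable A (\<lambda>z. (cmod (disc_deriv f z))\<^sup>2)" if "f \<in> hcarrier D" for f
    using that by (simp add: hcarrier_dirichlet_iff)
  show ?thesis
    unfolding compact_op_def
  proof (intro conjI allI impI T_linear)
    fix F :: "nat \<Rightarrow> complex \<Rightarrow> complex"
    assume "(\<forall>n. F n \<in> hcarrier D) \<and> (\<exists>B. \<forall>n. hnorm D (F n) \<le> B)"
    then obtain B where F: "\<And>n. F n \<in> hcarrier D" and FB: "\<And>n. hnorm D (F n) \<le> B" by blast
    obtain s f where s: "strict_mono s" and f: "f \<in> hcarrier D" "hnorm D f \<le> B" and conv: "loc_conv (\<lambda>n. F (s n)) f"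
      by (rule phi.dirichlet_Montel[where F = F, OF F FB]) blast
    define h where "h n = (\<lambda>x. F (s n) x - f x)" for n
    have h: "h n \<in> hcarrier D" for n unfolding h_def by (rule phi.D.diff_closed[OF F f(1)])
    have hB: "hnorm D (h n) \<le> 2 * B" for n
      using phi.D.hnorm_triangle_diff_le[OF F f(1), of "s n"] FB[of "s n"] f(2) by (simp add: h_def)
    have B: "0 \<le> B" using f(2) phi.D.hnorm_nonneg[OF f(1)] by linarith
    have hconv: "loc_conv h (\<lambda>x. 0)"
      using loc_conv_diff[OF conv loc_conv_const[of f]] by (simp add: h_def[abs_def])
    have Th: "T (h n) \<in> hcarrier D" for n by (rule T_closed[OF h])
    have ThB: "hnorm D (T (h n)) \<le> BT * (2 * B)" for n
      using BT(2)[OF h, of n] mult_left_mono[OF hB[of n], of BT] BT(1) by linarith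
    obtain t g where t: "strict_mono t" and g: "g \<in> hcarrier D" "hnorm D g \<le> BT * (2 * B)"
      and gconv: "loc_conv (\<lambda>n. T (h (t n))) g"
      by (rule phi.dirichlet_Montel[where F = "\<lambda>n. T (h n)", OF Th ThB]) blast
    define u where "u n = disc_deriv (C\<phi> (h (t n)))" for n
    define v where "v n = disc_deriv (C\<psi> (T (h (t n))))" for n
    define k where "k = disc_deriv (C\<psi> g)"
    define K where "K = max (B1 * (2 * B)) (B2 * (BT * (2 * B)))"
    have htconv: "loc_conv (\<lambda>n. h (t n)) (\<lambda>x. 0)" by (rule loc_conv_subseq[OF hconv t])
    have C0: "C\<phi> (\<lambda>x. 0) = (\<lambda>x. 0)" by (simp add: composition_op_def fun_eq_iff)
    have d0: "disc_deriv (\<lambda>x. 0) z = 0" for z by (simp add: disc_deriv_def)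
    have bu: "hnorm D (C\<phi> (h n)) \<le> K" for n
      using order_trans[OF B1(3)[OF h] mult_left_mono[OF hB less_imp_le[OF B1(1)]]]
      unfolding K_def by (rule max.coboundedI1)
    have bv: "hnorm D (C\<psi> (T (h n))) \<le> K" for n
      using order_trans[OF B2(3)[OF Th] mult_left_mono[OF ThB less_imp_le[OF B2(1)]]]
      unfolding K_def by (rule max.coboundedI2)
    have bk: "hnorm D (C\<psi> g) \<le> K"
      using order_trans[OF B2(3)[OF g(1)] mult_left_mono[OF g(2) less_imp_le[OF B2(1)]]]
      unfolding K_def by (rule max.coboundedI2)
    have "(\<lambda>n. LINT z|A. v n z * cnj (u n z)) \<longlonglongrightarrow> 0"
    proof (rule L2_split_tendsto_0[where U = U and B = "K\<^sup>2" and k = k])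
      show "finite_measure A" by (rule phi.finite_measure_A)
      show "u n \<in> borel_measurable A" "v n \<in> borel_measurable A" "k \<in> borel_measurable A" for n
        unfolding u_def v_def k_def by (intro meas B1 B2 h Th g)+
      show "integrable A (\<lambda>z. (cmod (u n z))\<^sup>2)" "integrable A (\<lambda>z. (cmod (v n z))\<^sup>2)" "integrable A (\<lambda>z. (cmod (k z))\<^sup>2)" for n
        unfolding u_def v_def k_def by (intro int B1 B2 h Th g)+
      show "(LINT z|A. (cmod (u n z))\<^sup>2) \<le> K\<^sup>2" "(LINT z|A. (cmod (v n z))\<^sup>2) \<le> K\<^sup>2" "(LINT z|A. (cmod (k z))\<^sup>2) \<le> K\<^sup>2" for n
        unfolding u_def v_def k_def by (intro phi.dirichlet_integral_le B1 B2 h Th g bu bv bk)+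
      show "(\<lambda>n. u n z) \<longlonglongrightarrow> 0" for z
        using phi.loc_conv_composition_pointwise[where F = "\<lambda>n. h (t n)", OF h phi.D.zero_closed htconv, of z] by (simp add: u_def C0 d0)
      show "eventually (\<lambda>n. \<forall>z\<in>U. cmod (v n z - k z) \<le> e) sequentially" if "0 < e" for e
        using psi.loc_conv_composition_uniform[where F = "\<lambda>n. T (h (t n))", OF Th g(1) gconv R that]
        by (rule eventually_mono) (use U\<psi> in \<open>auto simp: v_def k_def U_def\<close>)
      show "eventually (\<lambda>n. \<forall>z. z \<notin> U \<longrightarrow> cmod (u n z) \<le> e) sequentially" if "0 < e" for e
        using phi.loc_conv_composition_uniform[where F = "\<lambda>n. h (t n)", OF h phi.D.zero_closed htconv R that]
      proof (rule eventually_mono, intro allI impI)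
        fix n z assume *: "\<forall>z\<in>unit_disc. cmod (\<phi> z) \<le> R \<longrightarrow> cmod (disc_deriv (C\<phi> (h (t n))) z - disc_deriv (C\<phi> (\<lambda>x. 0)) z) \<le> e"
          and z: "z \<notin> U"
        show "cmod (u n z) \<le> e"
        proof (cases "z \<in> unit_disc")
          case True
          then show ?thesis using * U\<phi>[OF True z] by (auto simp: u_def C0 d0)
        next
          case False
          then show ?thesis using that by (auto simp: u_def disc_deriv_def)
        qed
      qed
    qed
    moreover have "(\<lambda>n. C\<psi> (T (h (t n))) 0 * cnj (C\<phi> (h (t n)) 0)) \<longlonglongrightarrow> g (\<psi> 0) * cnj 0"
    proof -
      have "(\<lambda>n. T (h (t n)) (\<psi> 0)) \<longlonglongrightarrow> g (\<psi> 0)" "(\<lambda>n. h (t n) (\<phi> 0)) \<longlonglongrightarrow> 0"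
        using loc_conv_pointwise[OF gconv psi.map_disc] loc_conv_pointwise[OF htconv phi.map_disc] by simp_all
      then have "(\<lambda>n. T (h (t n)) (\<psi> 0) * cnj (h (t n) (\<phi> 0))) \<longlonglongrightarrow> g (\<psi> 0) * cnj 0"
        by (rule tendsto_mult[OF _ tendsto_cnj])
      then show ?thesis by (simp add: composition_op_def)
    qed
    ultimately have "(\<lambda>n. hinner D (C\<psi> (T (h (t n)))) (C\<phi> (h (t n)))) \<longlonglongrightarrow> 0"
      unfolding hinner_dirichlet u_def v_def by (auto dest: tendsto_add)
    moreover have "hinner D (C\<psi> (T (h n))) (C\<phi> (h n)) = of_real ((hnorm D (T (h n)))\<^sup>2)" for n
      using T_inner[OF h Th, of n n] phi.D.inner_self[OF Th] by simp
    ultimately have "(\<lambda>n. Re (of_real ((hnorm D (T (h (t n))))\<^sup>2))) \<longlonglongrightarrow> Re 0"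
      by (intro tendsto_Re) simp
    then have "(\<lambda>n. (hnorm D (T (h (t n))))\<^sup>2) \<longlonglongrightarrow> 0" by simp
    then have "(\<lambda>n. sqrt ((hnorm D (T (h (t n))))\<^sup>2)) \<longlonglongrightarrow> sqrt 0" by (intro tendsto_intros)
    then have lim: "(\<lambda>n. hnorm D (T (h (t n)))) \<longlonglongrightarrow> 0" by (simp add: phi.D.hnorm_nonneg[OF Th])
    have "T (h n) = (\<lambda>x. T (F (s n)) x - T f x)" for n
      unfolding h_def by (rule phi.D.linear_op_diff[OF T_linear F f(1)])
    then have "(\<lambda>n. hnorm D (\<lambda>x. T (F ((s \<circ> t) n)) x - T f x)) \<longlonglongrightarrow> 0" using lim by simp
    moreover have "strict_mono (s \<circ> t)" using s t by (rule strict_mono_o)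
    ultimately show "\<exists>s g. strict_mono s \<and> g \<in> hcarrier D \<and> (\<lambda>n. hnorm D (\<lambda>x. T (F (s n)) x - g x)) \<longlonglongrightarrow> 0"
      using T_closed[OF f(1)] by blast
  qed
qed

end

section \<open>Peak functions at a boundary contact\<close>

lemma dyadic_scale:
  fixes \<rho> x :: real
  assumes \<rho>: "0 < \<rho>" and x: "\<rho> \<le> x"
  shows "\<exists>n::nat. 2 ^ n * \<rho> \<le> x \<and> x < 2 ^ Suc n * \<rho>"
proof -
  obtain m :: nat where m: "x / \<rho> < 2 ^ m" using real_arch_pow[of 2 "x / \<rho>"] by auto
  define n where "n = (LEAST n. x < 2 ^ Suc n * \<rho>)"
  have "x < 2 ^ m * \<rho>" using m \<rho> by (simp add: divide_less_eq)
  also have "\<dots> \<le> 2 ^ Suc m * \<rho>" using \<rho> by (intro mult_right_mono) auto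
  finally have "x < 2 ^ Suc m * \<rho>" .
  then have up: "x < 2 ^ Suc n * \<rho>" unfolding n_def by (rule LeastI)
  moreover have "2 ^ n * \<rho> \<le> x"
  proof (cases n)
    case (Suc k)
    then have "\<not> x < 2 ^ Suc k * \<rho>" using not_less_Least[of k "\<lambda>n. x < 2 ^ Suc n * \<rho>"] by (simp add: n_def)
    then show ?thesis using Suc by simp
  qed (use x in simp)
  ultimately show ?thesis by blast
qed

context negative_weight
begin

lemma weighted_area_ball_ge:
  assumes s: "0 < s" and t: "0 \<le> t"
    and near: "\<And>w. w \<in> ball p t \<Longrightarrow> w \<in> unit_disc \<and> 1 - (cmod w)\<^sup>2 \<le> s"
  shows "ennreal ((1 + \<alpha>) * s powr \<alpha> * t\<^sup>2) \<le> emeasure A (ball p t)"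
proof -
  have "ennreal ((1 + \<alpha>) * s powr \<alpha> * t\<^sup>2) = ennreal ((1 + \<alpha>) / pi * s powr \<alpha>) * emeasure lborel (ball p t)"
    using \<alpha>_gt t by (simp add: emeasure_lborel_complex_ball flip: ennreal_mult)
  also have "\<dots> = (\<integral>\<^sup>+z. ennreal ((1 + \<alpha>) / pi * s powr \<alpha>) * indicator (ball p t) z \<partial>lborel)"
    by (simp add: nn_integral_cmult_indicator)
  also have "\<dots> \<le> (\<integral>\<^sup>+z. ennreal ((1 + \<alpha>) / pi) * (ennreal ((1 - (cmod z)\<^sup>2) powr \<alpha>) * indicator unit_disc z * indicator (ball p t) z) \<partial>lborel)"
  proof (rule nn_integral_mono)
    fix z
    show "ennreal ((1 + \<alpha>) / pi * s powr \<alpha>) * indicator (ball p t) z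
      \<le> ennreal ((1 + \<alpha>) / pi) * (ennreal ((1 - (cmod z)\<^sup>2) powr \<alpha>) * indicator unit_disc z * indicator (ball p t) z)"
    proof (cases "z \<in> ball p t")
      case True
      then have z: "z \<in> unit_disc" "1 - (cmod z)\<^sup>2 \<le> s" using near by auto
      then have "0 < 1 - (cmod z)\<^sup>2" by (simp add: power_less_one_iff)
      then have "s powr \<alpha> \<le> (1 - (cmod z)\<^sup>2) powr \<alpha>"
        using z \<alpha>_less by (intro powr_mono2') auto
      then have "ennreal ((1 + \<alpha>) / pi * s powr \<alpha>) \<le> ennreal ((1 + \<alpha>) / pi * (1 - (cmod z)\<^sup>2) powr \<alpha>)"
        using \<alpha>_gt by (intro ennreal_leI mult_left_mono) auto
      also have "\<dots> = ennreal ((1 + \<alpha>) / pi) * ennreal ((1 - (cmod z)\<^sup>2) powr \<alpha>)"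
        using \<alpha>_gt by (intro ennreal_mult) auto
      finally show ?thesis using True z by (simp only: indicator_simps mult_1_right)
    qed simp
  qed
  also have "\<dots> = (\<integral>\<^sup>+z. indicator (ball p t) z \<partial>A)"
    by (rule nn_integral_weighted_area[OF \<alpha>_gt, symmetric]) measurable
  also have "\<dots> = emeasure A (ball p t)" by simp
  finally show ?thesis .
qed

text \<open>With \<open>\<rho> = \<bar>P\<bar> - 1\<close> the disc is divided into the shells \<open>2\<^sup>n \<rho> \<le> \<bar>P - w\<bar> < 2\<^sup>n\<^sup>+\<^sup>1 \<rho>\<close>. Their contributions
  are bounded by a geometric series of ratio \<open>2 powr (\<alpha> - 2)\<close>.\<close>

lemma kernel_integral_le:
  obtains C where "0 < C" "\<And>P. 1 < cmod P \<Longrightarrow>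
    (\<integral>\<^sup>+w. ennreal (1 / (cmod (P - w)) ^ 4) * indicator unit_disc w \<partial>A) \<le> ennreal (C * (cmod P - 1) powr (\<alpha> - 2))"
proof -
  obtain C where C: "0 < C" "\<And>p t. 0 < t \<Longrightarrow> emeasure A (ball p t) \<le> ennreal (C * t powr (2 + \<alpha>))"
    by (rule weighted_area_ball_le) blast
  define q where "q = 2 powr (\<alpha> - 2)"
  have q: "0 < q" "q < 1" unfolding q_def using \<alpha>_less powr_less_mono[of "\<alpha> - 2" 0 2] by auto
  show ?thesis
  proof
    show "0 < C * 2 powr (2 + \<alpha>) / (1 - q)" using C q by simp
    fix P :: complex assume P: "1 < cmod P"
    define \<rho> where "\<rho> = cmod P - 1"
    have \<rho>: "0 < \<rho>" using P by (simp add: \<rho>_def)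
    have "(\<integral>\<^sup>+w. ennreal (1 / (cmod (P - w)) ^ 4) * indicator unit_disc w \<partial>A)
        \<le> (\<integral>\<^sup>+w. (\<Sum>n. ennreal (1 / (2 ^ n * \<rho>) ^ 4) * indicator (ball P (2 ^ Suc n * \<rho>)) w) \<partial>A)"
    proof (rule nn_integral_mono)
      fix w
      show "ennreal (1 / (cmod (P - w)) ^ 4) * indicator unit_disc w
          \<le> (\<Sum>n. ennreal (1 / (2 ^ n * \<rho>) ^ 4) * indicator (ball P (2 ^ Suc n * \<rho>)) w)"
      proof (cases "w \<in> unit_disc")
        case True
        have "\<rho> \<le> cmod (P - w)" using norm_triangle_sub[of P w] True by (simp add: \<rho>_def)
        then obtain n where n: "2 ^ n * \<rho> \<le> cmod (P - w)" "cmod (P - w) < 2 ^ Suc n * \<rho>"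
          using dyadic_scale[OF \<rho>] by blast
        have pos: "0 < 2 ^ n * \<rho>" "0 < cmod (P - w)" using \<rho> \<open>\<rho> \<le> cmod (P - w)\<close> by auto
        have "1 / (cmod (P - w)) ^ 4 \<le> 1 / (2 ^ n * \<rho>) ^ 4"
          using n(1) pos \<rho> by (intro divide_left_mono power_mono mult_pos_pos[OF zero_less_power zero_less_power]) auto
        then have "ennreal (1 / (cmod (P - w)) ^ 4) \<le> ennreal (1 / (2 ^ n * \<rho>) ^ 4) * indicator (ball P (2 ^ Suc n * \<rho>)) w"
          using n(2) by (simp add: dist_norm ennreal_leI)
        also have "\<dots> \<le> (\<Sum>n. ennreal (1 / (2 ^ n * \<rho>) ^ 4) * indicator (ball P (2 ^ Suc n * \<rho>)) w)"
        proof -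
          have "f n \<le> (\<Sum>n. f n)" for f :: "nat \<Rightarrow> ennreal" using sum_le_suminf[of f "{n}"] by simp
          then show ?thesis .
        qed
        finally show ?thesis using True by simp
      qed simp
    qed
    also have "\<dots> = (\<Sum>n. \<integral>\<^sup>+w. ennreal (1 / (2 ^ n * \<rho>) ^ 4) * indicator (ball P (2 ^ Suc n * \<rho>)) w \<partial>A)"
      by (rule nn_integral_suminf) measurable
    also have "\<dots> \<le> (\<Sum>n. ennreal (C * 2 powr (2 + \<alpha>) * \<rho> powr (\<alpha> - 2) * q ^ n))"
    proof (rule suminf_le)
      fix n :: nat
      define y where "y = 2 ^ n * \<rho>"
      have y: "0 < y" using \<rho> by (simp add: y_def)
      have "(\<integral>\<^sup>+w. ennreal (1 / y ^ 4) * indicator (ball P (2 * y)) w \<partial>A) = ennreal (1 / y ^ 4) * emeasure A (ball P (2 * y))"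
        by (rule nn_integral_cmult_indicator) simp
      also have "\<dots> \<le> ennreal (1 / y ^ 4) * ennreal (C * (2 * y) powr (2 + \<alpha>))"
        using y by (intro mult_left_mono C) auto
      also have "\<dots> = ennreal (1 / y ^ 4 * (C * (2 * y) powr (2 + \<alpha>)))"
        using y C by (intro ennreal_mult[symmetric]) auto
      also have "1 / y ^ 4 * (C * (2 * y) powr (2 + \<alpha>)) = C * 2 powr (2 + \<alpha>) * y powr (\<alpha> - 2)"
      proof -
        have "y powr (2 + \<alpha>) = y powr (\<alpha> - 2) * y powr 4" unfolding powr_add[symmetric] by (simp add: add.commute)
        also have "y powr 4 = y ^ 4" using y by (simp add: powr_numeral)
        finally show ?thesis using y by (simp add: powr_mult)
      qed
      also have "y powr (\<alpha> - 2) = \<rho> powr (\<alpha> - 2) * q ^ n"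
      proof -
        have "(2 ^ n) powr (\<alpha> - 2) = (2 powr real n) powr (\<alpha> - 2)" by (simp add: powr_realpow)
        also have "\<dots> = q powr real n" by (simp add: q_def powr_powr mult.commute)
        also have "\<dots> = q ^ n" using q by (simp add: powr_realpow)
        finally show ?thesis using \<rho> by (simp add: y_def powr_mult)
      qed
      finally show "(\<integral>\<^sup>+w. ennreal (1 / (2 ^ n * \<rho>) ^ 4) * indicator (ball P (2 ^ Suc n * \<rho>)) w \<partial>A)
          \<le> ennreal (C * 2 powr (2 + \<alpha>) * \<rho> powr (\<alpha> - 2) * q ^ n)"
        by (simp add: y_def mult.assoc)
    qed auto
    also have "\<dots> = ennreal (C * 2 powr (2 + \<alpha>) * \<rho> powr (\<alpha> - 2) * (1 / (1 - q)))"
    proof (rule suminf_ennreal_eq)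
      show "0 \<le> C * 2 powr (2 + \<alpha>) * \<rho> powr (\<alpha> - 2) * q ^ n" for n using C q by simp
      show "(\<lambda>n. C * 2 powr (2 + \<alpha>) * \<rho> powr (\<alpha> - 2) * q ^ n) sums (C * 2 powr (2 + \<alpha>) * \<rho> powr (\<alpha> - 2) * (1 / (1 - q)))"
        using q by (intro sums_mult geometric_sums) auto
    qed
    finally show "(\<integral>\<^sup>+w. ennreal (1 / (cmod (P - w)) ^ 4) * indicator unit_disc w \<partial>A)
        \<le> ennreal (C * 2 powr (2 + \<alpha>) / (1 - q) * (cmod P - 1) powr (\<alpha> - 2))"
      by (simp add: \<rho>_def mult_ac)
  qed
qed

text \<open>The integral of \<open>\<bar>(1 + \<delta>) \<omega> - z\<bar>\<^sup>-\<^sup>4\<close> is of order \<open>\<delta> powr (\<alpha> - 2)\<close>, so that the numerator makes the norm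
  comparable to \<open>1\<close>.\<close>

definition peak :: "complex \<Rightarrow> real \<Rightarrow> complex \<Rightarrow> complex" where
  "peak \<omega> \<delta> = (\<lambda>z. if z \<in> unit_disc then of_real (\<delta> powr (1 - \<alpha> / 2)) / (of_real (1 + \<delta>) * \<omega> - z) else 0)"

lemma pole_dist:
  assumes "cmod \<omega> = 1" "0 < \<delta>" "z \<in> unit_disc"
  shows "1 - cmod z < cmod (of_real (1 + \<delta>) * \<omega> - z)"
proof -
  have "cmod (of_real (1 + \<delta>) * \<omega>) = 1 + \<delta>" using assms by (simp only: norm_mult norm_of_real) simp
  then show ?thesis using norm_triangle_sub[of "of_real (1 + \<delta>) * \<omega>" z] assms by simp
qed

lemma peak_has_derivative:
  assumes \<omega>: "cmod \<omega> = 1" "0 < \<delta>" and z: "z \<in> unit_disc"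
  shows "(peak \<omega> \<delta> has_field_derivative of_real (\<delta> powr (1 - \<alpha> / 2)) / (of_real (1 + \<delta>) * \<omega> - z)\<^sup>2) (at z)"
proof -
  have nz: "of_real (1 + \<delta>) * \<omega> - z \<noteq> 0" using pole_dist[OF assms] z by auto
  have "((\<lambda>z. of_real (\<delta> powr (1 - \<alpha> / 2)) / (of_real (1 + \<delta>) * \<omega> - z)) has_field_derivative
      of_real (\<delta> powr (1 - \<alpha> / 2)) / (of_real (1 + \<delta>) * \<omega> - z)\<^sup>2) (at z)"
    using nz by (auto intro!: derivative_eq_intros simp: power2_eq_square)
  then show ?thesis
    by (rule has_field_derivative_transform_within_open[OF _ open_ball z]) (simp add: peak_def)
qed

lemma disc_deriv_peak:
  assumes "cmod \<omega> = 1" "0 < \<delta>"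
  shows "disc_deriv (peak \<omega> \<delta>) z = (if z \<in> unit_disc then of_real (\<delta> powr (1 - \<alpha> / 2)) / (of_real (1 + \<delta>) * \<omega> - z)\<^sup>2 else 0)"
  using DERIV_imp_deriv[OF peak_has_derivative[OF assms]] by (simp add: disc_deriv_def)

text \<open>On the ball of radius \<open>\<delta> / 2\<close> about \<open>(1 - \<delta>) \<omega>\<close> the distance to the pole is at most \<open>3 \<delta>\<close>, and the
  weighted area of this ball is of order \<open>\<delta> powr (2 + \<alpha>)\<close>.\<close>

lemma peak_lower_bound:
  obtains c where "0 < c" "\<And>\<omega> \<delta>. \<lbrakk>cmod \<omega> = 1; 0 < \<delta>; \<delta> < 1; peak \<omega> \<delta> \<in> hcarrier D\<rbrakk> \<Longrightarrow> c \<le> (hnorm D (peak \<omega> \<delta>))\<^sup>2"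
proof
  define c where "c = (1 + \<alpha>) * 3 powr \<alpha> / (81 * 4)"
  show "0 < c" using \<alpha>_gt by (simp add: c_def)
  fix \<omega> :: complex and \<delta> :: real assume \<omega>: "cmod \<omega> = 1" and \<delta>: "0 < \<delta>" "\<delta> < 1" and D: "peak \<omega> \<delta> \<in> hcarrier D"
  define p where "p = of_real (1 - \<delta>) * \<omega>"
  define q where "q = of_real (1 + \<delta>) * \<omega>"
  have np: "cmod p = 1 - \<delta>" using \<omega> \<delta> unfolding p_def norm_mult norm_of_real by simp
  have qp: "cmod (q - p) = 2 * \<delta>"
  proof -
    have "q - p = of_real (2 * \<delta>) * \<omega>" by (simp add: p_def q_def algebra_simps)
    then show ?thesis using \<omega> \<delta> by (simp only: norm_mult norm_of_real)
  qed
  have near: "w \<in> unit_disc" "1 - cmod w \<le> 3/2 * \<delta>" "cmod (q - w) \<le> 3 * \<delta>" if w: "w \<in> ball p (\<delta> / 2)" for w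
  proof -
    have pw: "cmod (p - w) < \<delta> / 2" using w by (simp add: dist_norm)
    show "w \<in> unit_disc" using norm_triangle_sub[of w p] pw np \<delta> by (simp add: norm_minus_commute)
    show "1 - cmod w \<le> 3/2 * \<delta>" using norm_triangle_sub[of p w] pw np by simp
    have "cmod (q - w) \<le> cmod (q - p) + cmod (p - w)" using norm_triangle_ineq[of "q - p" "p - w"] by simp
    then show "cmod (q - w) \<le> 3 * \<delta>" using pw qp \<delta> by simp
  qed
  have near2: "w \<in> unit_disc \<and> 1 - (cmod w)\<^sup>2 \<le> 3 * \<delta>" if w: "w \<in> ball p (\<delta> / 2)" for w
  proof -
    have "1 - (cmod w)\<^sup>2 = (1 - cmod w) * (1 + cmod w)" by (simp add: power2_eq_square algebra_simps)
    also have "\<dots> \<le> (3/2 * \<delta>) * 2" using near[OF w] \<delta> by (intro mult_mono) auto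
    finally show ?thesis using near[OF w] by simp
  qed
  have "ennreal c = ennreal (\<delta> powr (2 - \<alpha>) / (3 * \<delta>) ^ 4) * ennreal ((1 + \<alpha>) * (3 * \<delta>) powr \<alpha> * (\<delta> / 2)\<^sup>2)"
  proof -
    have prod: "\<delta> powr (2 - \<alpha>) * \<delta> powr \<alpha> = \<delta>\<^sup>2"
      using \<delta> by (simp add: powr_numeral flip: powr_add)
    have "\<delta> powr (2 - \<alpha>) / (3 * \<delta>) ^ 4 * ((1 + \<alpha>) * (3 * \<delta>) powr \<alpha> * (\<delta> / 2)\<^sup>2)
        = (\<delta> powr (2 - \<alpha>) * \<delta> powr \<alpha>) * \<delta>\<^sup>2 * ((1 + \<alpha>) * 3 powr \<alpha>) / (81 * 4 * \<delta> ^ 4)"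
      using \<delta> by (simp add: powr_mult power_mult_distrib power_divide)
    also have "\<dots> = c"
      unfolding prod c_def using \<delta> by (simp add: power2_eq_square power4_eq_xxxx)
    finally have "\<delta> powr (2 - \<alpha>) / (3 * \<delta>) ^ 4 * ((1 + \<alpha>) * (3 * \<delta>) powr \<alpha> * (\<delta> / 2)\<^sup>2) = c" .
    then show ?thesis using \<delta> \<alpha>_gt by (simp flip: ennreal_mult)
  qed
  also have "\<dots> \<le> ennreal (\<delta> powr (2 - \<alpha>) / (3 * \<delta>) ^ 4) * emeasure A (ball p (\<delta> / 2))"
    using \<delta> by (intro mult_left_mono weighted_area_ball_ge near2) auto
  also have "\<dots> = (\<integral>\<^sup>+w. ennreal (\<delta> powr (2 - \<alpha>) / (3 * \<delta>) ^ 4) * indicator (ball p (\<delta> / 2)) w \<partial>A)"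
    by (rule nn_integral_cmult_indicator[symmetric]) simp
  also have "\<dots> \<le> (\<integral>\<^sup>+w. ennreal ((cmod (disc_deriv (peak \<omega> \<delta>) w))\<^sup>2) \<partial>A)"
  proof (rule nn_integral_mono)
    fix w
    show "ennreal (\<delta> powr (2 - \<alpha>) / (3 * \<delta>) ^ 4) * indicator (ball p (\<delta> / 2)) w \<le> ennreal ((cmod (disc_deriv (peak \<omega> \<delta>) w))\<^sup>2)"
    proof (cases "w \<in> ball p (\<delta> / 2)")
      case True
      have pos: "0 < cmod (q - w)" using pole_dist[OF \<omega> \<delta>(1) near(1)[OF True]] near(1)[OF True] by (auto simp: q_def)
      have sq: "(\<delta> powr (1 - \<alpha> / 2))\<^sup>2 = \<delta> powr (2 - \<alpha>)"
        using \<delta> by (simp add: power2_eq_square flip: powr_add)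
      have "(cmod (disc_deriv (peak \<omega> \<delta>) w))\<^sup>2 = \<delta> powr (2 - \<alpha>) / cmod (q - w) ^ 4"
        using near(1)[OF True] \<delta> sq
        by (simp add: disc_deriv_peak[OF \<omega> \<delta>(1)] norm_divide norm_power power_divide q_def flip: power_mult)
      moreover have "\<delta> powr (2 - \<alpha>) / (3 * \<delta>) ^ 4 \<le> \<delta> powr (2 - \<alpha>) / cmod (q - w) ^ 4"
        using near(3)[OF True] pos \<delta> by (intro divide_left_mono power_mono mult_pos_pos zero_less_power) auto
      ultimately show ?thesis using True by (simp add: ennreal_leI)
    qed simp
  qed
  also have "\<dots> \<le> ennreal ((hnorm D (peak \<omega> \<delta>))\<^sup>2)" by (rule dirichlet_deriv_nn_integral_le[OF D])
  finally show "c \<le> (hnorm D (peak \<omega> \<delta>))\<^sup>2" by (simp add: ennreal_le_iff)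
qed

end

context linear_fractional
begin

text \<open>On the line through \<open>0\<close> and \<open>\<omega>\<close> the function \<open>\<bar>c z + d\<bar>\<^sup>2 - \<bar>a z + b\<bar>\<^sup>2\<close> is a quadratic polynomial \<open>Q t\<close> that
  vanishes at \<open>t = 1\<close>. At \<open>t = 1 - s\<close> it is at least a multiple of \<open>s\<close>, because \<open>\<phi>\<close> maps a ball of
  radius \<open>s\<close> about \<open>(1 - s) \<omega>\<close> onto a set containing a comparable ball. Hence the zero is simple, \<open>Q\<close>
  changes its sign there, and \<open>\<bar>\<phi>\<bar>\<close> exceeds \<open>1\<close> at a linear rate beyond \<open>\<omega>\<close>.\<close>

lemma exterior_rate:
  assumes \<omega>: "cmod \<omega> = 1" and touch: "cmod (\<phi> \<omega>) = 1"
  obtains \<kappa> e where "0 < \<kappa>" "0 < e" "e \<le> 1"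
    "\<And>\<delta>. \<lbrakk>0 < \<delta>; \<delta> < e\<rbrakk> \<Longrightarrow> (cmod d - cmod c) / 2 \<le> cmod (c * (of_real (1 + \<delta>) * \<omega>) + d)"
    "\<And>\<delta>. \<lbrakk>0 < \<delta>; \<delta> < e\<rbrakk> \<Longrightarrow> 1 + \<kappa> * \<delta> \<le> cmod (\<phi> (of_real (1 + \<delta>) * \<omega>))"
proof -
  define P where "P = (cmod c)\<^sup>2 - (cmod a)\<^sup>2"
  define R where "R = (cmod d)\<^sup>2 - (cmod b)\<^sup>2"
  define S where "S = 2 * Re ((c * cnj d - a * cnj b) * \<omega>)"
  define m where "m = cmod d - cmod c"
  have m: "0 < m" using c_less_d by (simp add: m_def)
  define Q where "Q t = (cmod (c * (of_real t * \<omega>) + d))\<^sup>2 - (cmod (a * (of_real t * \<omega>) + b))\<^sup>2" for t :: real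
  have Q_poly: "Q t = P * t\<^sup>2 + S * t + R" for t
  proof -
    have *: "(cmod (x * (of_real t * \<omega>) + y))\<^sup>2 = (cmod x)\<^sup>2 * t\<^sup>2 + 2 * t * Re (x * cnj y * \<omega>) + (cmod y)\<^sup>2" for x y
    proof -
      have "(cmod (u + y))\<^sup>2 = (cmod u)\<^sup>2 + 2 * Re (u * cnj y) + (cmod y)\<^sup>2" for u
        unfolding cmod_power2 by (simp add: power2_eq_square algebra_simps)
      from this[of "x * (of_real t * \<omega>)"]
      show ?thesis using \<omega> by (simp add: norm_mult power_mult_distrib algebra_simps)
    qed
    show ?thesis unfolding Q_def * P_def R_def S_def by (simp add: algebra_simps)
  qed
  have "cmod (a * \<omega> + b) = cmod (c * \<omega> + d)"
    using touch den_nonzero[of \<omega>] \<omega> by (simp add: moebius_def norm_divide divide_eq_1_iff)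
  then have "Q 1 = 0" by (simp add: Q_def)
  then have S: "S = - P - R" using Q_poly[of 1] by simp
  have Q_factor: "Q t = (1 - t) * (R - P * t)" for t
    unfolding Q_poly S by (simp add: power2_eq_square algebra_simps)
  obtain k where k: "0 < k" "\<And>u s. \<lbrakk>0 < s; ball u s \<subseteq> unit_disc\<rbrakk> \<Longrightarrow> ball (\<phi> u) (k * s) \<subseteq> \<phi> ` ball u s"
    by (rule ball_subset_image) blast
  have inner: "m\<^sup>2 * k \<le> R - P * (1 - s)" if s: "0 < s" "s < 1" for s
  proof -
    define z where "z = of_real (1 - s) * \<omega>"
    have z: "cmod z = 1 - s" using \<omega> s unfolding z_def norm_mult norm_of_real by simp
    then have sub: "ball z s \<subseteq> unit_disc" using ball_subset_unit_disc[of z] by simp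
    have "ball (\<phi> z) (k * s) \<subseteq> unit_disc" using k(2)[OF s(1) sub] map_disc sub by blast
    then have "cmod (\<phi> z) + k * s \<le> 1"
      using k s unfolding ball_subset_ball_iff by (auto simp: mult_le_0_iff)
    then have "k * s \<le> 1 - cmod (\<phi> z)" by simp
    also have "\<dots> \<le> 1 - (cmod (\<phi> z))\<^sup>2"
      using map_cball[of z] z s by (simp add: power2_eq_square mult_left_le)
    finally have 1: "k * s \<le> 1 - (cmod (\<phi> z))\<^sup>2" .
    have "m\<^sup>2 * (k * s) \<le> (cmod (c * z + d))\<^sup>2 * (1 - (cmod (\<phi> z))\<^sup>2)"
      using 1 k s m den_ge[of z] z by (intro mult_mono power_mono) (auto simp: m_def)
    also have "\<dots> = Q (1 - s)"
    proof -
      have "Q (1 - s) = (cmod (c * z + d))\<^sup>2 - (cmod (a * z + b))\<^sup>2" by (simp only: Q_def z_def)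
      moreover have "c * z + d \<noteq> 0" using den_nonzero[of z] z s by simp
      ultimately show ?thesis by (simp add: moebius_def norm_divide power_divide right_diff_distrib)
    qed
    also have "\<dots> = s * (R - P * (1 - s))" by (simp add: Q_factor)
    finally have "s * (m\<^sup>2 * k) \<le> s * (R - P * (1 - s))" by (simp add: mult_ac)
    then show ?thesis using s by simp
  qed
  define \<mu> where "\<mu> = m\<^sup>2 * k"
  have \<mu>: "0 < \<mu>" using m k by (simp add: \<mu>_def)
  have RP: "\<mu> \<le> R - P"
  proof (rule tendsto_lowerbound)
    show "((\<lambda>s. R - P * (1 - s)) \<longlongrightarrow> R - P) (at_right 0)" by (auto intro!: tendsto_eq_intros)
    show "eventually (\<lambda>s. \<mu> \<le> R - P * (1 - s)) (at_right 0)"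
      using inner unfolding \<mu>_def eventually_at_right_field by (intro exI[of _ 1]) auto
  qed simp
  define M where "M = 2 * cmod c + cmod d"
  have M: "0 < M" using c_less_d norm_ge_zero[of c] unfolding M_def by linarith
  define \<kappa> where "\<kappa> = min 1 (\<mu> / (6 * M\<^sup>2))"
  define e where "e = min 1 (min (\<mu> / (2 * (1 + \<bar>P\<bar>))) (m / (2 * (1 + cmod c))))"
  have \<kappa>: "0 < \<kappa>" "\<kappa> \<le> 1" "\<kappa> \<le> \<mu> / (6 * M\<^sup>2)" using \<mu> M by (auto simp: \<kappa>_def)
  have e: "0 < e" "e \<le> 1" using \<mu> m by (auto simp: e_def add_pos_nonneg)
  have small: "\<bar>P\<bar> * \<delta> \<le> \<mu> / 2" "cmod c * \<delta> \<le> m / 2" if "0 < \<delta>" "\<delta> < e" for \<delta>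
  proof -
    have "\<delta> \<le> \<mu> / (2 * (1 + \<bar>P\<bar>))" "\<delta> \<le> m / (2 * (1 + cmod c))" using that by (auto simp: e_def)
    then have "\<delta> * (2 * (1 + \<bar>P\<bar>)) \<le> \<mu>" "\<delta> * (2 * (1 + cmod c)) \<le> m"
      by (simp_all add: pos_le_divide_eq add_pos_nonneg)
    then show "\<bar>P\<bar> * \<delta> \<le> \<mu> / 2" "cmod c * \<delta> \<le> m / 2" using that by (simp_all add: algebra_simps)
  qed
  show ?thesis
  proof (rule that[OF \<kappa>(1) e])
    fix \<delta> :: real assume \<delta>: "0 < \<delta>" "\<delta> < e"
    define q where "q = of_real (1 + \<delta>) * \<omega>"
    have nq: "cmod q = 1 + \<delta>" using \<omega> \<delta> unfolding q_def norm_mult norm_of_real by simp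
    have cq: "cmod (c * q) = cmod c + cmod c * \<delta>" unfolding norm_mult nq by (simp add: algebra_simps)
    have "cmod d \<le> cmod (c * q + d) + cmod (c * q)"
      using norm_triangle_sub[of d "- (c * q)"] by (simp add: add.commute)
    then show den: "(cmod d - cmod c) / 2 \<le> cmod (c * (of_real (1 + \<delta>) * \<omega>) + d)"
    proof -
      have "x \<le> y + (z + w) \<Longrightarrow> w \<le> (x - z) / 2 \<Longrightarrow> (x - z) / 2 \<le> y" for x y z w :: real by simp
      from this[OF _ small(2)[OF \<delta>, unfolded m_def]] show ?thesis
        using \<open>cmod d \<le> cmod (c * q + d) + cmod (c * q)\<close> unfolding cq q_def[symmetric] by blast
    qed
    then have den0: "c * q + d \<noteq> 0" using c_less_d unfolding q_def by auto
    have "cmod (c * q + d) \<le> cmod (c * q) + cmod d" by (rule norm_triangle_ineq)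
    also have "\<dots> \<le> M" unfolding cq M_def using \<delta> e by (simp add: mult_left_le)
    finally have denM: "cmod (c * q + d) \<le> M" .
    have "P * \<delta> \<le> \<mu> / 2" using small(1)[OF \<delta>] \<delta> by (smt (verit) abs_ge_self mult_right_mono)
    then have "\<mu> / 2 \<le> R - P * (1 + \<delta>)" using RP by (simp add: algebra_simps)
    then have "\<delta> * (\<mu> / 2) \<le> \<delta> * (R - P * (1 + \<delta>))" using \<delta> by (intro mult_left_mono) auto
    also have "\<dots> = - Q (1 + \<delta>)" by (simp add: Q_factor)
    also have "\<dots> = (cmod (c * q + d))\<^sup>2 * ((cmod (\<phi> q))\<^sup>2 - 1)"
    proof -
      have "Q (1 + \<delta>) = (cmod (c * q + d))\<^sup>2 - (cmod (a * q + b))\<^sup>2" by (simp only: Q_def q_def)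
      then show ?thesis using den0 by (simp add: moebius_def norm_divide power_divide right_diff_distrib)
    qed
    finally have *: "\<delta> * (\<mu> / 2) \<le> (cmod (c * q + d))\<^sup>2 * ((cmod (\<phi> q))\<^sup>2 - 1)" .
    have "0 < (cmod (\<phi> q))\<^sup>2 - 1"
    proof (rule ccontr)
      assume "\<not> 0 < (cmod (\<phi> q))\<^sup>2 - 1"
      then have "(cmod (c * q + d))\<^sup>2 * ((cmod (\<phi> q))\<^sup>2 - 1) \<le> 0" by (intro mult_nonneg_nonpos) auto
      then show False using * \<delta> \<mu> by (smt (verit) half_gt_zero mult_pos_pos)
    qed
    then have "(cmod (c * q + d))\<^sup>2 * ((cmod (\<phi> q))\<^sup>2 - 1) \<le> M\<^sup>2 * ((cmod (\<phi> q))\<^sup>2 - 1)"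
      using denM by (intro mult_right_mono power_mono) auto
    with * have "\<delta> * (\<mu> / 2) \<le> M\<^sup>2 * ((cmod (\<phi> q))\<^sup>2 - 1)" by linarith
    then have "3 * (\<mu> / (6 * M\<^sup>2)) * \<delta> \<le> (cmod (\<phi> q))\<^sup>2 - 1"
      using M by (simp add: divide_le_eq) (simp add: mult_ac)
    moreover have "3 * \<kappa> * \<delta> \<le> 3 * (\<mu> / (6 * M\<^sup>2)) * \<delta>" using \<kappa> \<delta> by (intro mult_right_mono) auto
    ultimately have 2: "1 + 3 * \<kappa> * \<delta> \<le> (cmod (\<phi> q))\<^sup>2" by linarith
    have "(\<kappa> * \<delta>) * (\<kappa> * \<delta>) \<le> (\<kappa> * \<delta>) * 1"
      using \<kappa> \<delta> e by (intro mult_left_mono mult_le_one) auto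
    then have "(1 + \<kappa> * \<delta>)\<^sup>2 \<le> (cmod (\<phi> q))\<^sup>2"
      using 2 by (simp add: power2_eq_square algebra_simps)
    then show "1 + \<kappa> * \<delta> \<le> cmod (\<phi> (of_real (1 + \<delta>) * \<omega>))"
      unfolding q_def by (rule power2_le_imp_le) simp
  qed
qed

end

context dirichlet_composition
begin

text \<open>The preimage is \<open>peak \<omega> \<delta> \<circ> \<phi>\<inverse>\<close>, a linear fractional function with pole \<open>P = \<phi> ((1 + \<delta>) \<omega>)\<close>. Since
  \<open>\<bar>P\<bar> - 1 \<ge> \<kappa> \<delta>\<close>, the integral of \<open>\<bar>P - w\<bar>\<^sup>-\<^sup>4\<close> has the same order \<open>\<delta> powr (\<alpha> - 2)\<close> as that of the
  corresponding kernel with the original pole.\<close>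

lemma peak_preimage:
  assumes \<omega>: "cmod \<omega> = 1" and touch: "cmod (\<phi> \<omega>) = 1"
  obtains B e where "0 < B" "0 < e" "e \<le> 1" "\<And>\<delta>. \<lbrakk>0 < \<delta>; \<delta> < e\<rbrakk> \<Longrightarrow>
    \<exists>f\<in>hcarrier D. composition_op \<phi> f = peak \<omega> \<delta> \<and> hnorm D f \<le> B"
proof -
  obtain \<kappa> e where \<kappa>: "0 < \<kappa>" and e: "0 < e" "e \<le> 1"
    and den: "\<And>\<delta>. \<lbrakk>0 < \<delta>; \<delta> < e\<rbrakk> \<Longrightarrow> (cmod d - cmod c) / 2 \<le> cmod (c * (of_real (1 + \<delta>) * \<omega>) + d)"
    and rate: "\<And>\<delta>. \<lbrakk>0 < \<delta>; \<delta> < e\<rbrakk> \<Longrightarrow> 1 + \<kappa> * \<delta> \<le> cmod (\<phi> (of_real (1 + \<delta>) * \<omega>))"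
    by (rule exterior_rate[OF \<omega> touch]) blast
  obtain C where C: "0 < C" "\<And>P. 1 < cmod P \<Longrightarrow>
    (\<integral>\<^sup>+w. ennreal (1 / (cmod (P - w)) ^ 4) * indicator unit_disc w \<partial>A) \<le> ennreal (C * (cmod P - 1) powr (\<alpha> - 2))"
    by (rule kernel_integral_le) blast
  define m where "m = (cmod d - cmod c) / 2"
  have m: "0 < m" using c_less_d by (simp add: m_def)
  define B2 where "B2 = (cmod a / m)\<^sup>2 + (cmod \<Delta> / m\<^sup>2)\<^sup>2 * C * \<kappa> powr (\<alpha> - 2)"
  have B2: "0 \<le> B2" using C by (simp add: B2_def)
  show ?thesis
  proof (rule that[of "1 + sqrt B2" e])
    show "0 < 1 + sqrt B2" using B2 by (intro add_pos_nonneg) auto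
    fix \<delta> :: real assume \<delta>: "0 < \<delta>" "\<delta> < e"
    define q where "q = of_real (1 + \<delta>) * \<omega>"
    define P where "P = \<phi> q"
    define N where "N = \<delta> powr (1 - \<alpha> / 2)"
    have N: "0 < N" "N \<le> 1"
      using \<delta> e \<alpha>_less powr_mono'[of 0 "1 - \<alpha> / 2" \<delta>] by (auto simp: N_def)
    have N2: "N\<^sup>2 = \<delta> powr (2 - \<alpha>)"
      using \<delta> by (simp add: N_def power2_eq_square flip: powr_add)
    have mq: "m \<le> cmod (c * q + d)" using den[OF \<delta>] by (simp add: m_def q_def)
    then have dq: "c * q + d \<noteq> 0" using m by auto
    have P1: "1 + \<kappa> * \<delta> \<le> cmod P" using rate[OF \<delta>] by (simp add: P_def q_def)
    then have P: "1 < cmod P" using \<kappa> \<delta> by (smt (verit) mult_pos_pos)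
    have Pw: "P - w \<noteq> 0" if "w \<in> unit_disc" for w using P that by auto
    define f where "f w = (if w \<in> unit_disc then of_real N * (a - c * w) / ((P - w) * (c * q + d)) else 0)" for w
    define K where "K = of_real N * \<Delta> / (c * q + d)\<^sup>2"
    have acP: "a - c * P = \<Delta> / (c * q + d)"
      using dq by (simp add: P_def moebius_def divide_simps) (simp add: algebra_simps)
    have der: "(f has_field_derivative K / (P - w)\<^sup>2) (at w)" if w: "w \<in> unit_disc" for w
    proof -
      have "((\<lambda>w. of_real N * (a - c * w) / ((P - w) * (c * q + d))) has_field_derivative
          of_real N * (a - c * P) / (c * q + d) / (P - w)\<^sup>2) (at w)"
        using Pw[OF w] dq
        by (auto intro!: derivative_eq_intros simp: divide_simps power2_eq_square) (simp add: algebra_simps)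
      moreover have "of_real N * (a - c * P) / (c * q + d) = K"
        by (simp add: acP K_def power2_eq_square)
      ultimately have "((\<lambda>w. of_real N * (a - c * w) / ((P - w) * (c * q + d))) has_field_derivative K / (P - w)\<^sup>2) (at w)"
        by simp
      then show ?thesis
        by (rule has_field_derivative_transform_within_open[OF _ open_ball w]) (simp add: f_def)
    qed
    have "\<exists>f'. (f has_field_derivative f') (at w)" if "w \<in> unit_disc" for w using der[OF that] by blast
    then have hol: "f holomorphic_on unit_disc" by (simp add: holomorphic_on_open)
    note [measurable] = measurable_disc_deriv[OF hol]
    have dd: "disc_deriv f w = (if w \<in> unit_disc then K / (P - w)\<^sup>2 else 0)" for w
      using DERIV_imp_deriv[OF der] by (simp add: disc_deriv_def)
    have nK: "(cmod K)\<^sup>2 \<le> \<delta> powr (2 - \<alpha>) * (cmod \<Delta> / m\<^sup>2)\<^sup>2"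
    proof -
      have "cmod K \<le> N * (cmod \<Delta> / m\<^sup>2)"
        using N m mq unfolding K_def norm_divide norm_mult norm_power norm_of_real
        by (auto intro!: frac_le power_mono)
      then have "(cmod K)\<^sup>2 \<le> (N * (cmod \<Delta> / m\<^sup>2))\<^sup>2" by (intro power_mono) auto
      then show ?thesis by (simp only: power_mult_distrib N2)
    qed
    have "(\<integral>\<^sup>+w. ennreal ((cmod (disc_deriv f w))\<^sup>2) \<partial>A)
        = (\<integral>\<^sup>+w. ennreal ((cmod K)\<^sup>2) * (ennreal (1 / (cmod (P - w)) ^ 4) * indicator unit_disc w) \<partial>A)"
      by (intro nn_integral_cong) (auto simp: dd norm_divide norm_power power_divide indicator_def simp flip: power_mult ennreal_mult)
    also have "\<dots> = ennreal ((cmod K)\<^sup>2) * (\<integral>\<^sup>+w. ennreal (1 / (cmod (P - w)) ^ 4) * indicator unit_disc w \<partial>A)"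
      by (rule nn_integral_cmult) measurable
    also have "\<dots> \<le> ennreal ((cmod K)\<^sup>2) * ennreal (C * (cmod P - 1) powr (\<alpha> - 2))"
      by (intro mult_left_mono C P) auto
    also have "\<dots> = ennreal ((cmod K)\<^sup>2 * (C * (cmod P - 1) powr (\<alpha> - 2)))"
      using C by (intro ennreal_mult[symmetric]) auto
    also have "\<dots> \<le> ennreal ((cmod \<Delta> / m\<^sup>2)\<^sup>2 * C * \<kappa> powr (\<alpha> - 2))"
    proof (rule ennreal_leI)
      have "(cmod P - 1) powr (\<alpha> - 2) \<le> (\<kappa> * \<delta>) powr (\<alpha> - 2)"
        using P1 \<kappa> \<delta> \<alpha>_less by (intro powr_mono2') auto
      also have "\<dots> = \<kappa> powr (\<alpha> - 2) * \<delta> powr (\<alpha> - 2)" using \<kappa> \<delta> by (intro powr_mult)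
      finally have "(cmod K)\<^sup>2 * (C * (cmod P - 1) powr (\<alpha> - 2))
          \<le> (\<delta> powr (2 - \<alpha>) * (cmod \<Delta> / m\<^sup>2)\<^sup>2) * (C * (\<kappa> powr (\<alpha> - 2) * \<delta> powr (\<alpha> - 2)))"
        using nK C by (intro mult_mono) auto
      also have "\<dots> = (cmod \<Delta> / m\<^sup>2)\<^sup>2 * C * \<kappa> powr (\<alpha> - 2) * (\<delta> powr (2 - \<alpha>) * \<delta> powr (\<alpha> - 2))"
        by (simp only: mult_ac)
      also have "\<delta> powr (2 - \<alpha>) * \<delta> powr (\<alpha> - 2) = 1" using \<delta> by (simp flip: powr_add)
      finally show "(cmod K)\<^sup>2 * (C * (cmod P - 1) powr (\<alpha> - 2)) \<le> (cmod \<Delta> / m\<^sup>2)\<^sup>2 * C * \<kappa> powr (\<alpha> - 2)" by simp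
    qed
    finally have int: "(\<integral>\<^sup>+w. ennreal ((cmod (disc_deriv f w))\<^sup>2) \<partial>A) \<le> ennreal ((cmod \<Delta> / m\<^sup>2)\<^sup>2 * C * \<kappa> powr (\<alpha> - 2))" .
    then have "(\<integral>\<^sup>+w. ennreal ((cmod (disc_deriv f w))\<^sup>2) \<partial>A) < \<infinity>" by (rule order.strict_trans1) simp
    then have "integrable A (\<lambda>w. (cmod (disc_deriv f w))\<^sup>2)" by (intro integrableI_bounded) auto
    then have fD: "f \<in> hcarrier D" using hol by (auto simp: hcarrier_dirichlet_iff f_def)
    have f0: "(cmod (f 0))\<^sup>2 \<le> (cmod a / m)\<^sup>2"
    proof (rule power_mono)
      have "cmod (f 0) = N * cmod a / (cmod P * cmod (c * q + d))"
        using N by (simp add: f_def norm_divide norm_mult)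
      also have "\<dots> \<le> 1 * cmod a / (1 * m)"
        using N P mq m by (intro frac_le mult_mono) auto
      finally show "cmod (f 0) \<le> cmod a / m" by simp
    qed simp
    have "(hnorm D f)\<^sup>2 \<le> B2"
      using int f0 C unfolding dirichlet_deriv_nn_integral[OF fD] hnorm_sq_dirichlet B2_def
      by (subst (asm) ennreal_le_iff) auto
    then have "hnorm D f \<le> sqrt B2" by (rule real_le_rsqrt)
    moreover have "composition_op \<phi> f = peak \<omega> \<delta>"
    proof
      fix z
      show "composition_op \<phi> f z = peak \<omega> \<delta> z"
      proof (cases "z \<in> unit_disc")
        case True
        have dz: "c * z + d \<noteq> 0" by (rule den_nonzero_disc[OF True])
        have acz: "a - c * \<phi> z = \<Delta> / (c * z + d)"
          using dz by (simp add: moebius_def divide_simps) (simp add: algebra_simps)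
        have Pz: "P - \<phi> z = \<Delta> * (q - z) / ((c * q + d) * (c * z + d))"
          unfolding P_def by (rule moebius_diff[OF dq dz])
        have "q - z \<noteq> 0" using pole_dist[OF \<omega> \<delta>(1) True] True by (auto simp: q_def)
        then have "of_real N * (a - c * \<phi> z) / ((P - \<phi> z) * (c * q + d)) = of_real N / (q - z)"
          unfolding acz Pz using dz dq det_nonzero by (simp add: divide_simps)
        then show ?thesis using True map_disc[OF True] by (simp add: composition_op_def f_def peak_def N_def q_def)
      qed (simp add: composition_op_def peak_def)
    qed
    ultimately show "\<exists>f\<in>hcarrier D. composition_op \<phi> f = peak \<omega> \<delta> \<and> hnorm D f \<le> 1 + sqrt B2"
      using fD by force
  qed (use e in auto)
qed

end

section \<open>Noncompactness at a common boundary contact\<close>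

context two_compositions
begin

text \<open>With \<open>C\<phi> (F n) = h n = C\<psi> (G n)\<close> the inner products \<open>\<langle>G n, T (F n) - T (F m)\<rangle>\<close> are
  \<open>\<langle>h n, h n\<rangle> - \<langle>h n, h m\<rangle>\<close>. The first term is bounded below, and the second tends to \<open>0\<close> as \<open>n \<rightarrow> \<infinity>\<close>
  because \<open>h n\<close> is bounded and its derivatives tend to \<open>0\<close> pointwise.\<close>

lemma T_ess_norm_pos:
  assumes \<omega>: "cmod \<omega> = 1" and touch: "cmod (\<phi> \<omega>) = 1" "cmod (\<psi> \<omega>) = 1"
  shows "0 < ess_norm D T"
proof -
  obtain B1 e1 where B1: "0 < B1" and e1: "0 < e1" "e1 \<le> 1" and pre1: "\<And>\<delta>. \<lbrakk>0 < \<delta>; \<delta> < e1\<rbrakk> \<Longrightarrow>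
    \<exists>f\<in>hcarrier D. C\<phi> f = phi.peak \<omega> \<delta> \<and> hnorm D f \<le> B1"
    by (rule phi.peak_preimage[OF \<omega> touch(1)]) blast
  obtain B2 e2 where B2: "0 < B2" and e2: "0 < e2" "e2 \<le> 1" and pre2: "\<And>\<delta>. \<lbrakk>0 < \<delta>; \<delta> < e2\<rbrakk> \<Longrightarrow>
    \<exists>f\<in>hcarrier D. C\<psi> f = phi.peak \<omega> \<delta> \<and> hnorm D f \<le> B2"
    by (rule psi.peak_preimage[OF \<omega> touch(2)]) blast
  define e where "e = min e1 e2"
  have e: "0 < e" "e \<le> 1" "e \<le> e1" "e \<le> e2" using e1 e2 by (auto simp: e_def)
  define \<delta> where "\<delta> n = e / real (n + 2)" for n
  have \<delta>: "0 < \<delta> n" "\<delta> n < e" "\<delta> n < 1" for n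
  proof -
    show 1: "0 < \<delta> n" using e by (simp add: \<delta>_def)
    show 2: "\<delta> n < e" using e by (simp add: \<delta>_def divide_less_eq)
    show "\<delta> n < 1" using 2 e by simp
  qed
  have \<delta>_lim: "\<delta> \<longlonglongrightarrow> 0"
  proof -
    have "(\<lambda>n. e / real (n + 2)) \<longlonglongrightarrow> 0"
      by (rule LIMSEQ_ignore_initial_segment[OF lim_const_over_n])
    then show ?thesis by (simp add: \<delta>_def[abs_def])
  qed
  define h where "h n = phi.peak \<omega> (\<delta> n)" for n
  have "\<exists>f\<in>hcarrier D. C\<phi> f = h n \<and> hnorm D f \<le> B1" for n
    unfolding h_def using pre1[OF \<delta>(1)[of n]] \<delta>(2)[of n] e by simp
  then obtain F where F: "\<And>n. F n \<in> hcarrier D" "\<And>n. C\<phi> (F n) = h n" "\<And>n. hnorm D (F n) \<le> B1" by metis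
  have "\<exists>f\<in>hcarrier D. C\<psi> f = h n \<and> hnorm D f \<le> B2" for n
    unfolding h_def using pre2[OF \<delta>(1)[of n]] \<delta>(2)[of n] e by simp
  then obtain G where G: "\<And>n. G n \<in> hcarrier D" "\<And>n. C\<psi> (G n) = h n" "\<And>n. hnorm D (G n) \<le> B2" by metis
  obtain K where K: "0 < K" "\<And>f. f \<in> hcarrier D \<Longrightarrow> C\<phi> f \<in> hcarrier D"
    "\<And>f. f \<in> hcarrier D \<Longrightarrow> hnorm D (C\<phi> f) \<le> K * hnorm D f"
    by (rule phi.composition_bounded) blast
  have h: "h n \<in> hcarrier D" for n using K(2)[OF F(1)[of n]] F(2) by simp
  have hK: "hnorm D (h n) \<le> K * B1" for n
  proof -
    have "hnorm D (h n) \<le> K * hnorm D (F n)" using K(3)[OF F(1)[of n]] F(2) by simp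
    also have "\<dots> \<le> K * B1" by (rule mult_left_mono[OF F(3) less_imp_le[OF K(1)]])
    finally show ?thesis .
  qed
  obtain c where c: "0 < c" and lower: "\<And>\<omega> \<delta>. \<lbrakk>cmod \<omega> = 1; 0 < \<delta>; \<delta> < 1; phi.peak \<omega> \<delta> \<in> hcarrier D\<rbrakk> \<Longrightarrow> c \<le> (hnorm D (phi.peak \<omega> \<delta>))\<^sup>2"
    by (rule phi.peak_lower_bound) blast
  have hc: "c \<le> (hnorm D (h n))\<^sup>2" for n
    unfolding h_def by (rule lower[OF \<omega> \<delta>(1) \<delta>(3)]) (use h in \<open>simp add: h_def\<close>)
  define N where "N n = \<delta> n powr (1 - \<alpha> / 2)" for n
  have N: "0 \<le> N n" for n by (simp add: N_def)
  have N_lim: "N \<longlonglongrightarrow> 0"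
    unfolding N_def[abs_def]
    by (rule tendsto_zero_powrI[OF \<delta>_lim tendsto_const]) (use \<delta>(1) phi.\<alpha>_less in \<open>auto intro!: always_eventually less_imp_le\<close>)
  have pole: "1 - cmod z \<le> cmod (of_real (1 + \<delta> n) * \<omega> - z)" if "z \<in> unit_disc" for z n
    using phi.pole_dist[OF \<omega> \<delta>(1) that] by (rule less_imp_le)
  have weak: "(\<lambda>n. hinner D (h n) (h m)) \<longlonglongrightarrow> 0" for m
  proof -
    have meas: "disc_deriv (h n) \<in> borel_measurable A" for n
      using measurable_disc_deriv[of "h n"] h[of n] by (simp add: hcarrier_dirichlet_iff measurable_def)
    have int: "integrable A (\<lambda>z. (cmod (disc_deriv (h n) z))\<^sup>2)" for n
      using h[of n] by (simp add: hcarrier_dirichlet_iff)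
    have "(\<lambda>n. LINT z|A. cmod (disc_deriv (h n) z) * cmod (disc_deriv (h m) z)) \<longlonglongrightarrow> 0"
    proof (rule L2_product_tendsto_0[OF meas meas int _ int])
      show "(LINT z|A. (cmod (disc_deriv (h n) z))\<^sup>2) \<le> (K * B1)\<^sup>2" for n
        by (rule phi.dirichlet_integral_le[OF h hK])
      fix z
      show "(\<lambda>n. disc_deriv (h n) z) \<longlonglongrightarrow> 0"
      proof (cases "z \<in> unit_disc")
        case True
        show ?thesis
        proof (rule Lim_null_comparison)
          show "eventually (\<lambda>n. norm (disc_deriv (h n) z) \<le> N n / (1 - cmod z)\<^sup>2) sequentially"
          proof (intro always_eventually allI)
            fix n
            have "norm (disc_deriv (h n) z) = N n / (cmod (of_real (1 + \<delta> n) * \<omega> - z))\<^sup>2"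
              unfolding h_def phi.disc_deriv_peak[OF \<omega> \<delta>(1)] N_def using True by (simp add: norm_divide norm_power)
            also have "\<dots> \<le> N n / (1 - cmod z)\<^sup>2"
              using pole[OF True, of n] True N by (intro divide_left_mono power_mono mult_pos_pos) (auto intro: order.strict_trans2[of 0 "1 - cmod z"])
            finally show "norm (disc_deriv (h n) z) \<le> N n / (1 - cmod z)\<^sup>2" .
          qed
          show "(\<lambda>n. N n / (1 - cmod z)\<^sup>2) \<longlonglongrightarrow> 0"
            using tendsto_divide[OF N_lim tendsto_const, of "(1 - cmod z)\<^sup>2"] True by simp
        qed
      qed (simp add: disc_deriv_def)
    qed
    then have "(\<lambda>n. LINT z|A. disc_deriv (h n) z * cnj (disc_deriv (h m) z)) \<longlonglongrightarrow> 0"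
    proof (rule Lim_null_comparison[rotated])
      show "eventually (\<lambda>n. norm (LINT z|A. disc_deriv (h n) z * cnj (disc_deriv (h m) z))
          \<le> (LINT z|A. cmod (disc_deriv (h n) z) * cmod (disc_deriv (h m) z))) sequentially"
      proof (intro always_eventually allI)
        fix n
        show "norm (LINT z|A. disc_deriv (h n) z * cnj (disc_deriv (h m) z))
          \<le> (LINT z|A. cmod (disc_deriv (h n) z) * cmod (disc_deriv (h m) z))"
          using integral_norm_bound[of A "\<lambda>z. disc_deriv (h n) z * cnj (disc_deriv (h m) z)"] by (simp add: norm_mult)
      qed
    qed
    moreover have "(\<lambda>n. h n 0 * cnj (h m 0)) \<longlonglongrightarrow> 0"
    proof -
      have "(\<lambda>n. h n 0) \<longlonglongrightarrow> 0"
      proof (rule Lim_null_comparison[OF _ N_lim], intro always_eventually allI)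
        fix n
        have "norm (h n 0) = N n / cmod (of_real (1 + \<delta> n) * \<omega> - 0)"
          by (simp add: h_def phi.peak_def N_def norm_divide)
        also have "\<dots> \<le> N n / 1" using pole[of 0 n] N by (intro divide_left_mono) auto
        finally show "norm (h n 0) \<le> N n" by simp
      qed
      then show ?thesis by (rule tendsto_mult_left_zero)
    qed
    ultimately show ?thesis unfolding hinner_dirichlet by (auto dest: tendsto_add)
  qed
  show ?thesis
  proof (rule phi.D.ess_norm_pos[OF T_linear F(1) F(3) _ B1])
    show "0 < c / 2 / B2" using c B2 by simp
    fix m
    have "eventually (\<lambda>n. cmod (hinner D (h n) (h m)) < c / 2) sequentially"
      using tendsto_norm_zero[OF weak, of m] c by (intro order_tendstoD(2)) auto
    then show "eventually (\<lambda>n. c / 2 / B2 \<le> hnorm D (\<lambda>x. T (F n) x - T (F m) x)) sequentially"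
    proof (rule eventually_mono)
      fix n assume small: "cmod (hinner D (h n) (h m)) < c / 2"
      let ?d = "\<lambda>x. T (F n) x - T (F m) x"
      have d: "?d \<in> hcarrier D" by (rule phi.D.diff_closed[OF T_closed[OF F(1)] T_closed[OF F(1)]])
      have "hinner D (G n) ?d = hinner D (h n) (h n) - hinner D (h n) (h m)"
      proof -
        have "hinner D (G n) (T (F k)) = hinner D (h n) (h k)" for k
          using T_inner[OF F(1)[of k] G(1)[of n]] by (simp only: F(2) G(2))
        then show ?thesis
          using phi.D.inner_diff_right[OF T_closed[OF F(1)[of n]] T_closed[OF F(1)[of m]] G(1)[of n]] by simp
      qed
      then have "cmod (hinner D (h n) (h n)) - cmod (hinner D (h n) (h m)) \<le> cmod (hinner D (G n) ?d)"
        by (simp add: norm_triangle_ineq2)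
      moreover have "cmod (hinner D (h n) (h n)) = (hnorm D (h n))\<^sup>2"
        unfolding phi.D.inner_self[OF h] norm_of_real by simp
      ultimately have "c / 2 \<le> cmod (hinner D (G n) ?d)" using hc[of n] small by linarith
      also have "\<dots> \<le> hnorm D (G n) * hnorm D ?d" by (rule phi.D.Cauchy_Schwarz[OF G(1) d])
      also have "\<dots> \<le> B2 * hnorm D ?d" by (rule mult_right_mono[OF G(3) phi.D.hnorm_nonneg[OF d]])
      finally show "c / 2 / B2 \<le> hnorm D ?d" using B2 by (simp add: divide_le_eq mult.commute)
    qed
  qed
qed

end

section \<open>Local averages of the counting function\<close>

lemma eventually_near_circle:
  assumes "R < 1" "\<And>z. \<lbrakk>z \<in> unit_disc; R < cmod z\<rbrakk> \<Longrightarrow> P z"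
  shows "eventually P (filtercomap cmod (at_left 1))"
  unfolding eventually_filtercomap
proof (intro exI conjI allI impI)
  show "eventually (\<lambda>s. R < s \<and> s < 1) (at_left 1)"
    using assms(1) by (intro eventually_conj eventually_at_left_field[THEN iffD2] exI[of _ R]) auto
  fix z assume "R < cmod z \<and> cmod z < 1"
  then show "P z" using assms(2) by simp
qed

lemma ennreal_divide_le:
  assumes "x \<le> ennreal p" "ennreal q \<le> y" "0 \<le> p" "0 < q"
  shows "x / y \<le> ennreal (p / q)"
proof -
  have "x / y \<le> ennreal p / y" by (rule divide_right_mono_ennreal[OF assms(1)])
  also have "\<dots> \<le> ennreal p / ennreal q"
  proof (cases y)
    case (real v)
    have "q \<le> v" using assms(2) unfolding real(2) using real(1) by (simp only: ennreal_le_iff)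
    then have v: "q \<le> v" "0 < v" using assms(4) by auto
    have "ennreal p / ennreal v = ennreal (p / v)" using assms v by (intro divide_ennreal)
    also have "\<dots> \<le> ennreal (p / q)" using assms v by (intro ennreal_leI divide_left_mono) auto
    also have "\<dots> = ennreal p / ennreal q" using assms by (intro divide_ennreal[symmetric])
    finally show ?thesis unfolding real(2) .
  qed simp
  also have "\<dots> = ennreal (p / q)" using assms by (intro divide_ennreal)
  finally show ?thesis .
qed

lemma ennreal_divide_ge:
  assumes "ennreal p \<le> x" "y \<le> ennreal q" "0 \<le> p" "0 < q" "0 < y"
  shows "ennreal (p / q) \<le> x / y"
proof -
  have "ennreal (p / q) = ennreal p / ennreal q" using assms by (intro divide_ennreal[symmetric])
  also have "\<dots> \<le> x / ennreal q" by (rule divide_right_mono_ennreal[OF assms(1)])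
  also have "\<dots> \<le> x / y"
  proof (cases y)
    case (real v)
    have v: "v \<le> q" "0 < v"
      using assms(2,4,5) unfolding real(2) by (simp_all only: ennreal_le_iff less_imp_le ennreal_less_zero_iff)
    have "inverse (ennreal q) \<le> inverse (ennreal v)"
      using v assms by (simp add: inverse_ennreal ennreal_leI)
    then show ?thesis unfolding divide_ennreal_def real(2) by (rule mult_left_mono) simp
  next
    case top
    then show ?thesis using assms(2) by (simp add: top_unique)
  qed
  finally show ?thesis .
qed

lemma one_minus_pseudo_hyp_dist_sq:
  assumes "1 - cnj z * w \<noteq> 0"
  shows "1 - (pseudo_hyp_dist z w)\<^sup>2 = (1 - (cmod z)\<^sup>2) * (1 - (cmod w)\<^sup>2) / (cmod (1 - cnj z * w))\<^sup>2"
proof -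
  have "(cmod (1 - cnj z * w))\<^sup>2 - (cmod (z - w))\<^sup>2 = (1 - (cmod z)\<^sup>2) * (1 - (cmod w)\<^sup>2)"
    unfolding cmod_power2 by (simp add: power2_eq_square algebra_simps)
  then show ?thesis
    using assms by (simp add: pseudo_hyp_dist_def norm_divide power_divide diff_divide_distrib[symmetric] field_simps)
qed

lemma bergman_denominator_ge:
  assumes "z \<in> unit_disc" "w \<in> unit_disc"
  shows "1 - cmod z \<le> cmod (1 - cnj z * w)"
proof -
  have "cmod (cnj z * w) \<le> cmod z" using assms by (simp add: norm_mult mult_left_le)
  then show ?thesis using norm_triangle_ineq2[of 1 "cnj z * w"] by simp
qed

lemma pseudo_hyp_dist_less_1:
  assumes z: "z \<in> unit_disc" and w: "w \<in> unit_disc"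
  shows "pseudo_hyp_dist z w < 1"
proof -
  have nz: "0 < cmod (1 - cnj z * w)" using bergman_denominator_ge[OF assms] z by auto
  have "0 < 1 - (pseudo_hyp_dist z w)\<^sup>2"
    using z w nz by (subst one_minus_pseudo_hyp_dist_sq) (auto simp: power_less_one_iff)
  then have "(pseudo_hyp_dist z w)\<^sup>2 < 1\<^sup>2" by simp
  then show ?thesis by (rule power2_less_imp_less) simp
qed

lemma bergman_dist_less_iff:
  assumes "0 \<le> pseudo_hyp_dist z w" "pseudo_hyp_dist z w < 1"
  shows "bergman_dist z w < r \<longleftrightarrow> pseudo_hyp_dist z w < tanh r"
proof -
  let ?p = "pseudo_hyp_dist z w"
  have "bergman_dist z w < r \<longleftrightarrow> ln ((1 + ?p) / (1 - ?p)) < 2 * r" by (auto simp: bergman_dist_def)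
  also have "\<dots> \<longleftrightarrow> (1 + ?p) / (1 - ?p) < exp (2 * r)"
    using assms by (subst ln_less_cancel_iff[symmetric]) auto
  also have "\<dots> \<longleftrightarrow> 1 + ?p < exp (2 * r) * (1 - ?p)" using assms by (simp add: divide_less_eq)
  also have "\<dots> \<longleftrightarrow> ?p * (exp (2 * r) + 1) < exp (2 * r) - 1" by (auto simp: algebra_simps)
  also have "\<dots> \<longleftrightarrow> ?p < (exp (2 * r) - 1) / (exp (2 * r) + 1)"
    by (rule pos_less_divide_eq[symmetric]) (simp add: add_pos_pos)
  also have "(exp (2 * r) - 1) / (exp (2 * r) + 1) = tanh r"
  proof -
    have "exp (2 * r) = exp r * exp r" by (simp flip: exp_add)
    then show ?thesis
      by (simp add: tanh_altdef exp_minus divide_simps add_pos_pos)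
  qed
  finally show ?thesis .
qed

text \<open>From \<open>\<bar>z - w\<bar> < tanh r \<bar>1 - cnj z w\<bar>\<close> and \<open>1 - cnj z w = (1 - \<bar>z\<bar>\<^sup>2) + cnj z (z - w)\<close>; the term with
  \<open>z - w\<close> is absorbed on the left.\<close>

lemma bergman_disc_subset_ball:
  assumes z: "z \<in> unit_disc" and r: "0 < r"
  shows "bergman_disc z r \<subseteq> ball z (2 * tanh r / (1 - tanh r) * (1 - cmod z))"
proof
  fix w assume "w \<in> bergman_disc z r"
  then have w: "w \<in> unit_disc" and d: "bergman_dist z w < r" by (auto simp: bergman_disc_def)
  have t: "0 < tanh r" "tanh r < 1" using r tanh_real_lt_1[of r] by auto
  have nz: "0 < cmod (1 - cnj z * w)" using bergman_denominator_ge[OF z w] z by auto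
  have "pseudo_hyp_dist z w < tanh r"
    using bergman_dist_less_iff[OF _ pseudo_hyp_dist_less_1[OF z w], of r] d by (simp add: pseudo_hyp_dist_def)
  then have 1: "cmod (z - w) < tanh r * cmod (1 - cnj z * w)"
    using nz by (simp add: pseudo_hyp_dist_def norm_divide divide_less_eq)
  have "1 - cnj z * w = of_real (1 - (cmod z)\<^sup>2) + cnj z * (z - w)"
    using complex_norm_square[of z] by (simp add: algebra_simps)
  then have "cmod (1 - cnj z * w) \<le> cmod (of_real (1 - (cmod z)\<^sup>2)) + cmod (cnj z * (z - w))"
    by (metis norm_triangle_ineq)
  also have "cmod (of_real (1 - (cmod z)\<^sup>2)) = 1 - (cmod z)\<^sup>2"
    unfolding norm_of_real using z by (simp add: power_le_one)
  also have "cmod (cnj z * (z - w)) \<le> cmod (z - w)"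
    using z by (simp add: norm_mult mult_left_le_one_le)
  also have "1 - (cmod z)\<^sup>2 \<le> 2 * (1 - cmod z)"
  proof -
    have "0 \<le> (1 - cmod z)\<^sup>2" by simp
    then show ?thesis by (simp add: power2_diff)
  qed
  finally have "tanh r * cmod (1 - cnj z * w) \<le> tanh r * (2 * (1 - cmod z) + cmod (z - w))"
    using t by (intro mult_left_mono) auto
  with 1 have "cmod (z - w) * (1 - tanh r) < 2 * tanh r * (1 - cmod z)" by (simp add: algebra_simps)
  then show "w \<in> ball z (2 * tanh r / (1 - tanh r) * (1 - cmod z))"
    using t by (simp add: dist_norm field_simps)
qed

lemma ball_subset_bergman_disc:
  assumes z: "z \<in> unit_disc" and r: "0 < r"
  shows "ball z (tanh r * (1 - cmod z)) \<subseteq> bergman_disc z r"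
proof
  have t: "0 < tanh r" "tanh r < 1" using r tanh_real_lt_1[of r] by auto
  fix w assume "w \<in> ball z (tanh r * (1 - cmod z))"
  then have d: "cmod (z - w) < tanh r * (1 - cmod z)" by (simp add: dist_norm)
  also have "\<dots> \<le> 1 * (1 - cmod z)" using t z by (intro mult_right_mono) auto
  finally have "w \<in> ball z (1 - cmod z)" by (simp add: dist_norm)
  then have w: "w \<in> unit_disc" using ball_subset_unit_disc by blast
  have nz: "0 < cmod (1 - cnj z * w)" using bergman_denominator_ge[OF z w] z by auto
  have "cmod (z - w) < tanh r * cmod (1 - cnj z * w)"
    using d bergman_denominator_ge[OF z w] t by (smt (verit) mult_left_mono)
  then have "pseudo_hyp_dist z w < tanh r"
    using nz by (simp add: pseudo_hyp_dist_def norm_divide divide_less_eq)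
  then have "bergman_dist z w < r"
    using bergman_dist_less_iff[OF _ pseudo_hyp_dist_less_1[OF z w], of r] by (simp add: pseudo_hyp_dist_def)
  then show "w \<in> bergman_disc z r" using w by (simp add: bergman_disc_def)
qed

lemma sets_bergman_disc: "bergman_disc z r \<in> sets borel"
proof -
  have "(\<lambda>w. bergman_dist z w) \<in> borel_measurable borel"
    unfolding bergman_dist_def pseudo_hyp_dist_def by measurable
  then have "{w \<in> space borel. w \<in> unit_disc \<and> bergman_dist z w < r} \<in> sets borel"
    by measurable
  then show ?thesis by (simp add: bergman_disc_def)
qed

context negative_weight
begin

lemma weighted_area_bergman_disc_le:
  assumes r: "0 < r"
  obtains C where "0 < C" "\<And>z. z \<in> unit_disc \<Longrightarrow> emeasure A (bergman_disc z r) \<le> ennreal (C * (1 - cmod z) powr (2 + \<alpha>))"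
proof -
  obtain C where C: "0 < C" "\<And>p t. 0 < t \<Longrightarrow> emeasure A (ball p t) \<le> ennreal (C * t powr (2 + \<alpha>))"
    by (rule weighted_area_ball_le) blast
  define K where "K = 2 * tanh r / (1 - tanh r)"
  have K: "0 < K" using r tanh_real_lt_1[of r] by (simp add: K_def)
  show ?thesis
  proof (rule that[of "C * K powr (2 + \<alpha>)"])
    show "0 < C * K powr (2 + \<alpha>)" using C K by simp
    fix z assume z: "z \<in> unit_disc"
    have "emeasure A (bergman_disc z r) \<le> emeasure A (ball z (K * (1 - cmod z)))"
      using bergman_disc_subset_ball[OF z r] by (intro emeasure_mono) (auto simp: K_def)
    also have "\<dots> \<le> ennreal (C * (K * (1 - cmod z)) powr (2 + \<alpha>))" using K z by (intro C) simp
    also have "\<dots> = ennreal (C * K powr (2 + \<alpha>) * (1 - cmod z) powr (2 + \<alpha>))"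
      using K z by (simp add: powr_mult mult.assoc)
    finally show "emeasure A (bergman_disc z r) \<le> ennreal (C * K powr (2 + \<alpha>) * (1 - cmod z) powr (2 + \<alpha>))" .
  qed
qed

lemma weighted_area_bergman_disc_ge:
  assumes r: "0 < r"
  obtains c where "0 < c" "\<And>z. z \<in> unit_disc \<Longrightarrow> ennreal (c * (1 - cmod z) powr (2 + \<alpha>)) \<le> emeasure A (bergman_disc z r)"
proof (rule that[of "(1 + \<alpha>) * 4 powr \<alpha> * (tanh r)\<^sup>2"])
  have t: "0 < tanh r" "tanh r < 1" using r tanh_real_lt_1[of r] by auto
  show "0 < (1 + \<alpha>) * 4 powr \<alpha> * (tanh r)\<^sup>2" using t \<alpha>_gt by simp
  fix z assume z: "z \<in> unit_disc"
  define s where "s = 1 - cmod z"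
  have s: "0 < s" using z by (simp add: s_def)
  have "s powr (2 + \<alpha>) = s\<^sup>2 * s powr \<alpha>" using s by (simp add: powr_add powr_numeral)
  then have "ennreal ((1 + \<alpha>) * 4 powr \<alpha> * (tanh r)\<^sup>2 * s powr (2 + \<alpha>)) = ennreal ((1 + \<alpha>) * (4 * s) powr \<alpha> * (tanh r * s)\<^sup>2)"
    using s by (simp add: powr_mult power_mult_distrib mult_ac)
  also have "\<dots> \<le> emeasure A (ball z (tanh r * s))"
  proof (rule weighted_area_ball_ge)
    fix w assume w: "w \<in> ball z (tanh r * s)"
    then have "w \<in> bergman_disc z r" using ball_subset_bergman_disc[OF z r] by (auto simp: s_def)
    then have w1: "w \<in> unit_disc" by (simp add: bergman_disc_def)
    have "tanh r * s \<le> 1 * s" using t s by (intro mult_right_mono) auto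
    then have "cmod (z - w) < s" using w by (simp add: dist_norm)
    then have "1 - cmod w \<le> 2 * s" using norm_triangle_sub[of z w] by (simp add: s_def)
    moreover have "1 - (cmod w)\<^sup>2 \<le> 2 * (1 - cmod w)"
    proof -
      have "0 \<le> (1 - cmod w)\<^sup>2" by simp
      then show ?thesis by (simp add: power2_diff)
    qed
    ultimately show "w \<in> unit_disc \<and> 1 - (cmod w)\<^sup>2 \<le> 4 * s" using w1 by simp
  qed (use s t in auto)
  also have "\<dots> \<le> emeasure A (bergman_disc z r)"
    using ball_subset_bergman_disc[OF z r] by (intro emeasure_mono) (auto simp: s_def sets_bergman_disc)
  finally show "ennreal ((1 + \<alpha>) * 4 powr \<alpha> * (tanh r)\<^sup>2 * (1 - cmod z) powr (2 + \<alpha>)) \<le> emeasure A (bergman_disc z r)"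
    by (simp add: s_def)
qed

end

text \<open>There is a single preimage, and it is simple because \<open>(\<phi> u - \<phi> z) / (u - z)\<close> has no zeros. The values
  of \<open>\<eta>\<close> outside the disc are left open: a composition of fractions agrees with the fraction of the
  product matrix only where no denominator vanishes.\<close>

lemma (in linear_fractional) nevanlinna_moebius:
  assumes \<eta>: "\<And>u. u \<in> unit_disc \<Longrightarrow> \<eta> u = \<phi> u" and z: "z \<in> unit_disc"
  shows "nevanlinna \<eta> \<alpha> (\<phi> z) = ennreal ((1 - (cmod z)\<^sup>2) powr \<alpha>)"
proof -
  have set: "{u \<in> unit_disc. \<eta> u = \<phi> z} = {z}"
    using \<eta> z moebius_inj by (auto simp: inj_on_def)
  have "zorder (\<lambda>u. \<eta> u - \<phi> z) z = 1"
  proof (rule simple_zeroI[OF open_ball z])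
    show "(\<lambda>u. \<Delta> / ((c * u + d) * (c * z + d))) holomorphic_on unit_disc"
      using den_nonzero_disc z by (intro holomorphic_intros) auto
    show "\<Delta> / ((c * z + d) * (c * z + d)) \<noteq> 0"
      using det_nonzero den_nonzero_disc[OF z] by simp
    fix u assume u: "u \<in> unit_disc"
    show "\<eta> u - \<phi> z = \<Delta> / ((c * u + d) * (c * z + d)) * (u - z)"
      unfolding \<eta>[OF u] moebius_diff[OF den_nonzero_disc[OF u] den_nonzero_disc[OF z]] by simp
  qed
  then show ?thesis unfolding nevanlinna_def set by simp
qed

context dirichlet_composition
begin

text \<open>Solving for the preimage, \<open>1 - \<bar>\<phi>\<inverse> w\<bar>\<^sup>2\<close> is at least a multiple of \<open>\<rho>\<^sup>2 - \<bar>w - c0\<bar>\<^sup>2\<close>, where \<open>c0\<close> and \<open>\<rho>\<close>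
  are the centre and the radius of the image disc. The affine map of the image disc onto the unit
  disc reduces the claim to the weighted area of a ball.\<close>

lemma nevanlinna_integral_ball_le:
  assumes \<eta>: "\<And>u. u \<in> unit_disc \<Longrightarrow> \<eta> u = \<phi> u"
  obtains C where "0 < C" "\<And>p t. 0 < t \<Longrightarrow>
    (\<integral>\<^sup>+w\<in>ball p t \<inter> \<eta> ` unit_disc. nevanlinna \<eta> \<alpha> w \<partial>area_measure) \<le> ennreal (C * t powr (2 + \<alpha>))"
proof -
  obtain C where C: "0 < C" "\<And>p t. 0 < t \<Longrightarrow>
    (\<integral>\<^sup>+z\<in>ball p t \<inter> unit_disc. ennreal ((1 - (cmod z)\<^sup>2) powr \<alpha>) \<partial>lborel) \<le> ennreal (C * t powr (2 + \<alpha>))"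
    by (rule weight_integral_ball_le[OF \<alpha>_gt \<alpha>_less]) blast
  define E where "E = (cmod d)\<^sup>2 - (cmod c)\<^sup>2"
  define F where "F = (cmod a)\<^sup>2 - (cmod b)\<^sup>2"
  define l where "l = d * cnj b - c * cnj a"
  define c0 where "c0 = cnj l / of_real E"
  define \<rho>2 where "\<rho>2 = F / E + (cmod c0)\<^sup>2"
  define m where "m = cmod d - cmod c"
  define k where "k = E * m\<^sup>2 / (cmod \<Delta>)\<^sup>2"
  have m: "0 < m" using c_less_d by (simp add: m_def)
  have E: "0 < E" unfolding E_def using c_less_d by (simp add: power_strict_mono)
  have k: "0 < k" using E m det_nonzero by (simp add: k_def)
  \<comment> \<open>Completing the square: the image of the disc is \<open>{w. \<bar>w - c0\<bar>\<^sup>2 < \<rho>2}\<close>, and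
    \<open>1 - \<bar>\<phi>\<inverse> w\<bar>\<^sup>2\<close> is the left-hand side divided by \<open>\<bar>a - c w\<bar>\<^sup>2\<close>.\<close>
  have disc: "(cmod (a - c * w))\<^sup>2 - (cmod (d * w - b))\<^sup>2 = E * (\<rho>2 - (cmod (w - c0))\<^sup>2)" for w
  proof -
    have "(cmod (a - c * w))\<^sup>2 - (cmod (d * w - b))\<^sup>2 = F + 2 * Re (l * w) - E * (cmod w)\<^sup>2"
      unfolding cmod_power2 E_def F_def l_def by (simp add: power2_eq_square algebra_simps)
    moreover have "(cmod (w - c0))\<^sup>2 = (cmod w)\<^sup>2 - 2 * Re (cnj c0 * w) + (cmod c0)\<^sup>2"
      unfolding cmod_power2 by (simp add: power2_eq_square algebra_simps)
    moreover have "E * Re (cnj c0 * w) = Re (l * w)" using E by (simp add: c0_def)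
    ultimately have "(cmod (a - c * w))\<^sup>2 - (cmod (d * w - b))\<^sup>2 = F + E * ((cmod c0)\<^sup>2 - (cmod (w - c0))\<^sup>2)"
      by (simp only: right_diff_distrib distrib_left)
    also have "\<dots> = E * (\<rho>2 - (cmod (w - c0))\<^sup>2)" using E by (simp add: \<rho>2_def distrib_left right_diff_distrib)
    finally show ?thesis .
  qed
  have image: "k * (\<rho>2 - (cmod (\<phi> u - c0))\<^sup>2) \<le> 1 - (cmod u)\<^sup>2" "0 < \<rho>2 - (cmod (\<phi> u - c0))\<^sup>2"
    if u: "u \<in> unit_disc" for u
  proof -
    have dn: "c * u + d \<noteq> 0" by (rule den_nonzero_disc[OF u])
    have 1: "a - c * \<phi> u = \<Delta> / (c * u + d)" and 2: "d * \<phi> u - b = \<Delta> * u / (c * u + d)"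
      using dn by (simp_all add: moebius_def divide_simps) (simp_all add: algebra_simps)
    have eq: "E * (\<rho>2 - (cmod (\<phi> u - c0))\<^sup>2) = (cmod \<Delta>)\<^sup>2 / (cmod (c * u + d))\<^sup>2 * (1 - (cmod u)\<^sup>2)"
      unfolding disc[symmetric] 1 2 by (simp add: norm_divide norm_mult power_divide power_mult_distrib right_diff_distrib)
    have u1: "0 < 1 - (cmod u)\<^sup>2" using u by (simp add: power_less_one_iff)
    have "0 < E * (\<rho>2 - (cmod (\<phi> u - c0))\<^sup>2)"
      unfolding eq using dn det_nonzero u1 by simp
    then show "0 < \<rho>2 - (cmod (\<phi> u - c0))\<^sup>2" using E by (simp add: zero_less_mult_iff)
    have "k * (\<rho>2 - (cmod (\<phi> u - c0))\<^sup>2) = m\<^sup>2 / (cmod \<Delta>)\<^sup>2 * (E * (\<rho>2 - (cmod (\<phi> u - c0))\<^sup>2))"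
      by (simp add: k_def)
    also have "\<dots> = m\<^sup>2 / (cmod (c * u + d))\<^sup>2 * (1 - (cmod u)\<^sup>2)"
      unfolding eq using det_nonzero by simp
    also have "\<dots> \<le> 1 * (1 - (cmod u)\<^sup>2)"
    proof (rule mult_right_mono)
      have "m\<^sup>2 \<le> (cmod (c * u + d))\<^sup>2" using den_ge[of u] u m by (intro power_mono) (auto simp: m_def)
      then show "m\<^sup>2 / (cmod (c * u + d))\<^sup>2 \<le> 1" using dn by (simp add: divide_le_eq_1)
    qed (use u1 in simp)
    finally show "k * (\<rho>2 - (cmod (\<phi> u - c0))\<^sup>2) \<le> 1 - (cmod u)\<^sup>2" by simp
  qed
  define \<rho> where "\<rho> = sqrt \<rho>2"
  have "0 < \<rho>2" using image(2)[of 0] by (smt (verit) centre_in_ball zero_le_power2 zero_less_one)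
  then have \<rho>: "0 < \<rho>" "\<rho>\<^sup>2 = \<rho>2" by (auto simp: \<rho>_def)
  define g where "g w = ennreal ((1 - (cmod ((w - c0) / of_real \<rho>))\<^sup>2) powr \<alpha>) * indicator unit_disc ((w - c0) / of_real \<rho>)" for w
  have [measurable]: "g \<in> borel_measurable borel"
  proof -
    have "(\<lambda>v. ennreal ((1 - (cmod v)\<^sup>2) powr \<alpha>) * indicator unit_disc v) \<in> borel_measurable borel" by measurable
    moreover have "(\<lambda>w. (w - c0) / of_real \<rho>) \<in> borel_measurable borel" by measurable
    ultimately show ?thesis unfolding g_def[abs_def] by (rule measurable_compose[rotated])
  qed
  have bound: "nevanlinna \<eta> \<alpha> w \<le> ennreal ((k * \<rho>2) powr \<alpha>) * g w" if w: "w \<in> \<eta> ` unit_disc" for w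
  proof -
    obtain u where u: "u \<in> unit_disc" "w = \<phi> u" using w \<eta> by auto
    define v where "v = (w - c0) / of_real \<rho>"
    have vv: "\<rho>2 * (1 - (cmod v)\<^sup>2) = \<rho>2 - (cmod (\<phi> u - c0))\<^sup>2"
      using \<rho> \<open>0 < \<rho>2\<close> by (simp add: v_def u norm_divide power_divide right_diff_distrib)
    then have pos: "0 < 1 - (cmod v)\<^sup>2" using image(2)[OF u(1)] \<open>0 < \<rho>2\<close> by (metis zero_less_mult_pos)
    then have "(cmod v)\<^sup>2 < 1\<^sup>2" by simp
    then have v1: "v \<in> unit_disc" using power2_less_imp_less[of "cmod v" 1] by simp
    have "(1 - (cmod u)\<^sup>2) powr \<alpha> \<le> (k * (\<rho>2 * (1 - (cmod v)\<^sup>2))) powr \<alpha>"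
      unfolding vv using image[OF u(1)] k \<alpha>_less by (intro powr_mono2') auto
    also have "\<dots> = (k * \<rho>2) powr \<alpha> * (1 - (cmod v)\<^sup>2) powr \<alpha>"
      using k \<open>0 < \<rho>2\<close> pos by (simp add: powr_mult mult.assoc)
    finally have "ennreal ((1 - (cmod u)\<^sup>2) powr \<alpha>) \<le> ennreal ((k * \<rho>2) powr \<alpha>) * ennreal ((1 - (cmod v)\<^sup>2) powr \<alpha>)"
      by (subst ennreal_mult[symmetric]) (auto intro: ennreal_leI)
    moreover have "nevanlinna \<eta> \<alpha> (\<phi> u) = ennreal ((1 - (cmod u)\<^sup>2) powr \<alpha>)"
      by (rule nevanlinna_moebius[OF _ u(1)]) (rule \<eta>)
    ultimately show ?thesis using v1 by (simp add: g_def v_def u(2))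
  qed
  define K where "K = (k * \<rho>2) powr \<alpha> / pi * (\<rho>2 * C * (1 / \<rho>) powr (2 + \<alpha>))"
  show ?thesis
  proof (rule that)
    show "0 < K" using k \<open>0 < \<rho>2\<close> \<rho> C by (simp add: K_def)
    fix p and t :: real assume t: "0 < t"
    have "(\<integral>\<^sup>+w\<in>ball p t \<inter> \<eta> ` unit_disc. nevanlinna \<eta> \<alpha> w \<partial>area_measure)
        \<le> (\<integral>\<^sup>+w. ennreal ((k * \<rho>2) powr \<alpha>) * g w * indicator (ball p t) w \<partial>area_measure)"
      by (rule nn_integral_mono) (use bound in \<open>auto simp: indicator_def\<close>)
    also have "\<dots> = (\<integral>\<^sup>+w. ennreal (1 / pi) * indicator unit_disc w * (ennreal ((k * \<rho>2) powr \<alpha>) * g w * indicator (ball p t) w) \<partial>lborel)"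
      by (rule nn_integral_area_measure) measurable
    also have "\<dots> \<le> (\<integral>\<^sup>+w. ennreal ((k * \<rho>2) powr \<alpha> / pi) * (g w * indicator (ball p t) w) \<partial>lborel)"
    proof (rule nn_integral_mono)
      fix w
      have "ennreal ((k * \<rho>2) powr \<alpha> / pi) = ennreal (1 / pi) * ennreal ((k * \<rho>2) powr \<alpha>)"
        by (subst ennreal_mult[symmetric]) auto
      then show "ennreal (1 / pi) * indicator unit_disc w * (ennreal ((k * \<rho>2) powr \<alpha>) * g w * indicator (ball p t) w)
        \<le> ennreal ((k * \<rho>2) powr \<alpha> / pi) * (g w * indicator (ball p t) w)"
        by (cases "w \<in> unit_disc") (simp_all add: mult.assoc)
    qed
    also have "\<dots> = ennreal ((k * \<rho>2) powr \<alpha> / pi) * (\<integral>\<^sup>+w. g w * indicator (ball p t) w \<partial>lborel)"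
      by (rule nn_integral_cmult) measurable
    also have "(\<integral>\<^sup>+w. g w * indicator (ball p t) w \<partial>lborel)
        = (\<integral>\<^sup>+w. g w * indicator (ball p t) w \<partial>density (distr lborel borel (\<lambda>v. c0 + \<rho> *\<^sub>R v)) (\<lambda>_. ennreal (\<bar>\<rho>\<bar> ^ DIM(complex))))"
      using \<rho> by (subst lborel_affine[of \<rho> c0]) auto
    also have "\<dots> = (\<integral>\<^sup>+v. ennreal \<rho>2 * (g (c0 + \<rho> *\<^sub>R v) * indicator (ball p t) (c0 + \<rho> *\<^sub>R v)) \<partial>lborel)"
      using \<rho> by (subst nn_integral_density, simp, simp, subst nn_integral_distr) auto
    also have "\<dots> = ennreal \<rho>2 * (\<integral>\<^sup>+v. g (c0 + \<rho> *\<^sub>R v) * indicator (ball p t) (c0 + \<rho> *\<^sub>R v) \<partial>lborel)"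
      by (rule nn_integral_cmult) measurable
    also have "(\<integral>\<^sup>+v. g (c0 + \<rho> *\<^sub>R v) * indicator (ball p t) (c0 + \<rho> *\<^sub>R v) \<partial>lborel)
        = (\<integral>\<^sup>+v\<in>ball ((p - c0) / of_real \<rho>) (t / \<rho>) \<inter> unit_disc. ennreal ((1 - (cmod v)\<^sup>2) powr \<alpha>) \<partial>lborel)"
    proof (rule nn_integral_cong)
      fix v :: complex
      have "p - (c0 + \<rho> *\<^sub>R v) = of_real \<rho> * ((p - c0) / of_real \<rho> - v)"
      proof -
        have "of_real \<rho> * ((p - c0) / of_real \<rho>) = p - c0" using \<rho> by simp
        then show ?thesis by (simp only: right_diff_distrib scaleR_conv_of_real diff_diff_eq)
      qed
      then have "dist p (c0 + \<rho> *\<^sub>R v) = \<rho> * dist ((p - c0) / of_real \<rho>) v"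
        using \<rho> by (simp add: dist_norm norm_mult del: of_real_mult)
      then have "c0 + \<rho> *\<^sub>R v \<in> ball p t \<longleftrightarrow> v \<in> ball ((p - c0) / of_real \<rho>) (t / \<rho>)"
        using \<rho> by (simp add: pos_less_divide_eq mult.commute)
      then have ind: "indicator (ball p t) (c0 + \<rho> *\<^sub>R v) = (indicator (ball ((p - c0) / of_real \<rho>) (t / \<rho>)) v :: ennreal)"
        unfolding indicator_def by (simp only:)
      have v: "(c0 + \<rho> *\<^sub>R v - c0) / of_real \<rho> = v" using \<rho> by (simp add: scaleR_conv_of_real)
      show "g (c0 + \<rho> *\<^sub>R v) * indicator (ball p t) (c0 + \<rho> *\<^sub>R v)
          = ennreal ((1 - (cmod v)\<^sup>2) powr \<alpha>) * indicator (ball ((p - c0) / of_real \<rho>) (t / \<rho>) \<inter> unit_disc) v"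
        unfolding g_def v ind by (simp only: indicator_inter_arith mult_ac)
    qed
    also have "ennreal ((k * \<rho>2) powr \<alpha> / pi) * (ennreal \<rho>2 * \<dots>) \<le> ennreal ((k * \<rho>2) powr \<alpha> / pi) * (ennreal \<rho>2 * ennreal (C * (t / \<rho>) powr (2 + \<alpha>)))"
      using t \<rho> by (intro mult_left_mono C) auto
    also have "\<dots> = ennreal ((k * \<rho>2) powr \<alpha> / pi * (\<rho>2 * (C * (t / \<rho>) powr (2 + \<alpha>))))"
      using \<open>0 < \<rho>2\<close> C(1) by (simp flip: ennreal_mult)
    also have "(t / \<rho>) powr (2 + \<alpha>) = (1 / \<rho>) powr (2 + \<alpha>) * t powr (2 + \<alpha>)"
      using t \<rho> by (simp flip: powr_mult)
    also have "(k * \<rho>2) powr \<alpha> / pi * (\<rho>2 * (C * ((1 / \<rho>) powr (2 + \<alpha>) * t powr (2 + \<alpha>)))) = K * t powr (2 + \<alpha>)"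
      by (simp add: K_def)
    finally show "(\<integral>\<^sup>+w\<in>ball p t \<inter> \<eta> ` unit_disc. nevanlinna \<eta> \<alpha> w \<partial>area_measure) \<le> ennreal (K * t powr (2 + \<alpha>))" .
  qed
qed

definition local_average :: "(complex \<Rightarrow> complex) \<Rightarrow> real \<Rightarrow> complex \<Rightarrow> ennreal" where
  "local_average \<eta> r z = (\<integral>\<^sup>+w\<in>bergman_disc z r \<inter> \<eta> ` unit_disc. nevanlinna \<eta> \<alpha> w \<partial>area_measure)
      / emeasure A (bergman_disc z r)"

lemma local_average_Limsup_finite:
  assumes \<eta>: "\<And>u. u \<in> unit_disc \<Longrightarrow> \<eta> u = \<phi> u" and r: "0 < r"
  shows "Limsup (filtercomap cmod (at_left 1)) (local_average \<eta> r) < \<infinity>"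
proof -
  obtain C where C: "0 < C" "\<And>p t. 0 < t \<Longrightarrow>
    (\<integral>\<^sup>+w\<in>ball p t \<inter> \<eta> ` unit_disc. nevanlinna \<eta> \<alpha> w \<partial>area_measure) \<le> ennreal (C * t powr (2 + \<alpha>))"
    by (rule nevanlinna_integral_ball_le[OF \<eta>]) blast+
  obtain c1 where c1: "0 < c1" "\<And>z. z \<in> unit_disc \<Longrightarrow> ennreal (c1 * (1 - cmod z) powr (2 + \<alpha>)) \<le> emeasure A (bergman_disc z r)"
    by (rule weighted_area_bergman_disc_ge[OF r]) blast
  define K where "K = 2 * tanh r / (1 - tanh r)"
  have K: "0 < K" using r tanh_real_lt_1[of r] by (simp add: K_def)
  have "Limsup (filtercomap cmod (at_left 1)) (local_average \<eta> r) \<le> ennreal (C * K powr (2 + \<alpha>) / c1)"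
  proof (rule Limsup_bounded, rule eventually_near_circle)
    fix z :: complex assume z: "z \<in> unit_disc"
    define s where "s = 1 - cmod z"
    have s: "0 < s" using z by (simp add: s_def)
    have "(\<integral>\<^sup>+w\<in>bergman_disc z r \<inter> \<eta> ` unit_disc. nevanlinna \<eta> \<alpha> w \<partial>area_measure)
        \<le> (\<integral>\<^sup>+w\<in>ball z (K * s) \<inter> \<eta> ` unit_disc. nevanlinna \<eta> \<alpha> w \<partial>area_measure)"
      using bergman_disc_subset_ball[OF z r] by (intro nn_integral_mono) (auto simp: indicator_def K_def s_def)
    also have "\<dots> \<le> ennreal (C * (K * s) powr (2 + \<alpha>))" using K s by (intro C) simp
    finally have num: "(\<integral>\<^sup>+w\<in>bergman_disc z r \<inter> \<eta> ` unit_disc. nevanlinna \<eta> \<alpha> w \<partial>area_measure) \<le> ennreal (C * (K * s) powr (2 + \<alpha>))" .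
    have "local_average \<eta> r z \<le> ennreal (C * (K * s) powr (2 + \<alpha>) / (c1 * s powr (2 + \<alpha>)))"
      unfolding local_average_def using num c1(2)[OF z] C c1(1) s by (intro ennreal_divide_le) (auto simp: s_def)
    also have "C * (K * s) powr (2 + \<alpha>) / (c1 * s powr (2 + \<alpha>)) = C * K powr (2 + \<alpha>) / c1"
      using K s by (simp add: powr_mult)
    finally show "local_average \<eta> r z \<le> ennreal (C * K powr (2 + \<alpha>) / c1)" .
  qed (rule zero_less_one)
  then show ?thesis by (rule order.strict_trans1) simp
qed

text \<open>The image of the closed disc lies in \<open>\<bar>w\<bar> \<le> R\<close> for some \<open>R < 1\<close>, and hyperbolic discs about points
  close to the circle do not reach this set.\<close>

lemma local_average_Limsup_zero:
  assumes \<eta>: "\<And>u. u \<in> unit_disc \<Longrightarrow> \<eta> u = \<phi> u" and r: "0 < r"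
    and inside: "\<And>\<xi>. cmod \<xi> = 1 \<Longrightarrow> cmod (\<phi> \<xi>) \<noteq> 1"
  shows "Limsup (filtercomap cmod (at_left 1)) (local_average \<eta> r) = 0"
proof -
  obtain w0 where w0: "w0 \<in> cball 0 1" and max: "\<forall>z\<in>cball 0 1. cmod (\<phi> z) \<le> cmod (\<phi> w0)"
    using continuous_attains_sup[OF compact_cball, of 0 1 "\<lambda>z. cmod (\<phi> z)"] continuous_on_norm[OF moebius_continuous] by auto
  define R where "R = cmod (\<phi> w0)"
  have R: "R < 1"
  proof (cases "cmod w0 = 1")
    case True
    then show ?thesis using inside[OF True] map_cball[of w0] by (simp add: R_def)
  next
    case False
    then have "w0 \<in> unit_disc" using w0 by auto
    then show ?thesis using map_disc by (auto simp: R_def)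
  qed
  define K where "K = 2 * tanh r / (1 - tanh r)"
  have K: "0 < K" using r tanh_real_lt_1[of r] by (simp add: K_def)
  have "Limsup (filtercomap cmod (at_left 1)) (local_average \<eta> r) \<le> 0"
  proof (rule Limsup_bounded, rule eventually_near_circle)
    show "1 - (1 - R) / (1 + K) < 1" using R K by simp
    fix z :: complex assume z: "z \<in> unit_disc" and near: "1 - (1 - R) / (1 + K) < cmod z"
    have "(1 - cmod z) * (1 + K) < 1 - R"
      using near K by (simp add: less_divide_eq[symmetric] pos_less_divide_eq[symmetric]) 
    then have far: "R < cmod z - K * (1 - cmod z)" by (simp add: algebra_simps)
    have "bergman_disc z r \<inter> \<eta> ` unit_disc = {}"
    proof (rule ccontr)
      assume "bergman_disc z r \<inter> \<eta> ` unit_disc \<noteq> {}"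
      then obtain u where u: "u \<in> unit_disc" "\<phi> u \<in> bergman_disc z r" using \<eta> by auto
      then have "cmod (z - \<phi> u) < K * (1 - cmod z)"
        using bergman_disc_subset_ball[OF z r] by (auto simp: K_def dist_norm)
      moreover have "cmod (\<phi> u) \<le> R" using max u by (auto simp: R_def)
      ultimately show False using far norm_triangle_sub[of z "\<phi> u"] by linarith
    qed
    then show "local_average \<eta> r z \<le> 0" by (simp add: local_average_def)
  qed
  then show ?thesis by simp
qed

text \<open>At \<open>z = \<phi> ((1 - s) \<xi>)\<close> one has \<open>k s \<le> 1 - \<bar>z\<bar> \<le> upper_lip s\<close>. Hence the hyperbolic disc contains a ball
  of radius \<open>x s\<close> that consists of images of points within \<open>s / 2\<close> of \<open>(1 - s) \<xi>\<close>, where the counting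
  function is at least \<open>(3 s) powr \<alpha>\<close>. Its integral over the ball and the weighted area of the
  hyperbolic disc are both of order \<open>s powr (2 + \<alpha>)\<close>.\<close>

lemma local_average_Limsup_pos:
  assumes \<eta>: "\<And>u. u \<in> unit_disc \<Longrightarrow> \<eta> u = \<phi> u" and r: "0 < r"
    and \<xi>: "cmod \<xi> = 1" and touch: "cmod (\<phi> \<xi>) = 1"
  shows "0 < Limsup (filtercomap cmod (at_left 1)) (local_average \<eta> r)"
proof -
  obtain k where k: "0 < k" "\<And>u s. \<lbrakk>0 < s; ball u s \<subseteq> unit_disc\<rbrakk> \<Longrightarrow> ball (\<phi> u) (k * s) \<subseteq> \<phi> ` ball u s"
    by (rule ball_subset_image) blast
  obtain C where C: "0 < C" "\<And>z. z \<in> unit_disc \<Longrightarrow> emeasure A (bergman_disc z r) \<le> ennreal (C * (1 - cmod z) powr (2 + \<alpha>))"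
    by (rule weighted_area_bergman_disc_le[OF r]) blast
  have t: "0 < tanh r" "tanh r < 1" using r tanh_real_lt_1[of r] by auto
  define x where "x = min (k / 2) (tanh r * k)"
  have x: "0 < x" using k t by (simp add: x_def)
  define c1 where "c1 = 3 powr \<alpha> * x\<^sup>2 / (C * upper_lip powr (2 + \<alpha>))"
  have c1: "0 < c1" using x C upper_lip_pos by (simp add: c1_def)
  have main: "ennreal c1 \<le> local_average \<eta> r (\<phi> (of_real (1 - s) * \<xi>))" if s: "0 < s" "s < 1" for s
  proof -
    define u where "u = of_real (1 - s) * \<xi>"
    have nu: "cmod u = 1 - s" using \<xi> s unfolding u_def norm_mult norm_of_real by simp
    have u: "u \<in> unit_disc" using nu s by simp
    define z where "z = \<phi> u"
    have z: "z \<in> unit_disc" unfolding z_def by (rule map_disc[OF u])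
    have sub: "ball u s \<subseteq> unit_disc" using ball_subset_unit_disc[of u] nu by simp
    have "ball z (k * s) \<subseteq> unit_disc" 
    proof -
      have "ball z (k * s) \<subseteq> \<phi> ` ball u s" unfolding z_def by (rule k(2)[OF s(1) sub])
      also have "\<dots> \<subseteq> unit_disc" by (rule image_subsetI, rule map_disc, rule subsetD[OF sub])
      finally show ?thesis .
    qed
    then have "cmod z + k * s \<le> 1"
      using k s unfolding ball_subset_ball_iff by (auto simp: mult_le_0_iff)
    then have Hopf: "k * s \<le> 1 - cmod z" by simp
    have "cmod (\<phi> \<xi>) \<le> cmod z + cmod (\<phi> \<xi> - z)" by (rule norm_triangle_sub)
    moreover have "cmod (\<phi> \<xi> - z) \<le> upper_lip * cmod (\<xi> - u)"
      unfolding z_def using \<xi> nu s by (intro moebius_lipschitz) auto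
    moreover have "cmod (\<xi> - u) = s"
    proof -
      have "\<xi> - u = of_real s * \<xi>" by (simp add: u_def algebra_simps)
      then show ?thesis using \<xi> s by (simp add: norm_mult)
    qed
    ultimately have lip: "1 - cmod z \<le> upper_lip * s" using touch by simp
    have xs1: "x * s \<le> tanh r * (1 - cmod z)"
    proof -
      have "x * s \<le> tanh r * k * s" using s by (intro mult_right_mono) (auto simp: x_def)
      also have "\<dots> \<le> tanh r * (1 - cmod z)" using Hopf t by (simp add: mult.assoc)
      finally show ?thesis .
    qed
    have small: "ball u (s / 2) \<subseteq> unit_disc" by (rule order_trans[OF subset_ball sub]) (use s in simp)
    have xs2: "ball z (x * s) \<subseteq> \<phi> ` ball u (s / 2)"
    proof -
      have "x * s \<le> k * (s / 2)" using s by (simp add: x_def min_mult_distrib_right)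
      then have "ball z (x * s) \<subseteq> ball z (k * (s / 2))" by (rule subset_ball)
      also have "\<dots> \<subseteq> \<phi> ` ball u (s / 2)" unfolding z_def using s small by (intro k(2)) auto
      finally show ?thesis .
    qed
    have "ennreal ((3 * s) powr \<alpha> * (x * s)\<^sup>2) = ennreal ((3 * s) powr \<alpha>) * ennreal (1 / pi) * emeasure lborel (ball z (x * s))"
      using x s by (simp add: emeasure_lborel_complex_ball flip: ennreal_mult)
    also have "\<dots> = (\<integral>\<^sup>+w. ennreal ((3 * s) powr \<alpha>) * ennreal (1 / pi) * indicator (ball z (x * s)) w \<partial>lborel)"
      by (simp add: nn_integral_cmult_indicator)
    also have "\<dots> = (\<integral>\<^sup>+w. ennreal (1 / pi) * indicator unit_disc w * (ennreal ((3 * s) powr \<alpha>) * indicator (ball z (x * s)) w) \<partial>lborel)"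
    proof (rule nn_integral_cong)
      fix w
      have "w \<in> unit_disc" if "w \<in> ball z (x * s)"
      proof -
        have "w \<in> \<phi> ` ball u (s / 2)" using xs2 that by (rule subsetD)
        then obtain v where "w = \<phi> v" "v \<in> ball u (s / 2)" by (rule imageE)
        then show ?thesis using map_disc[OF subsetD[OF small]] by simp
      qed
      then show "ennreal ((3 * s) powr \<alpha>) * ennreal (1 / pi) * indicator (ball z (x * s)) w
        = ennreal (1 / pi) * indicator unit_disc w * (ennreal ((3 * s) powr \<alpha>) * indicator (ball z (x * s)) w)"
        by (cases "w \<in> ball z (x * s)") (simp_all add: mult.commute)
    qed
    also have "\<dots> = (\<integral>\<^sup>+w. ennreal ((3 * s) powr \<alpha>) * indicator (ball z (x * s)) w \<partial>area_measure)"
      by (rule nn_integral_area_measure[symmetric]) measurable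
    also have "\<dots> \<le> (\<integral>\<^sup>+w\<in>bergman_disc z r \<inter> \<eta> ` unit_disc. nevanlinna \<eta> \<alpha> w \<partial>area_measure)"
    proof (rule nn_integral_mono)
      fix w
      show "ennreal ((3 * s) powr \<alpha>) * indicator (ball z (x * s)) w \<le> nevanlinna \<eta> \<alpha> w * indicator (bergman_disc z r \<inter> \<eta> ` unit_disc) w"
      proof (cases "w \<in> ball z (x * s)")
        case True
        obtain v where v: "v \<in> ball u (s / 2)" "w = \<phi> v" using subsetD[OF xs2 True] by (rule imageE)
        have v1: "v \<in> unit_disc" by (rule subsetD[OF small v(1)])
        have "w \<in> ball z (tanh r * (1 - cmod z))" using True xs1 by simp
        then have mem: "w \<in> bergman_disc z r" by (rule subsetD[OF ball_subset_bergman_disc[OF z r]])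
        have img: "w \<in> \<eta> ` unit_disc" using v v1 \<eta> by auto
        have "1 - cmod v \<le> 3 / 2 * s"
          using v norm_triangle_sub[of u v] nu by (simp add: dist_norm)
        moreover have "1 - (cmod v)\<^sup>2 \<le> 2 * (1 - cmod v)"
        proof -
          have "0 \<le> (1 - cmod v)\<^sup>2" by simp
          then show ?thesis by (simp add: power2_diff)
        qed
        moreover have "0 < 1 - (cmod v)\<^sup>2" using v1 by (simp add: power_less_one_iff)
        ultimately have "(3 * s) powr \<alpha> \<le> (1 - (cmod v)\<^sup>2) powr \<alpha>"
          using \<alpha>_less by (intro powr_mono2') auto
        then have "ennreal ((3 * s) powr \<alpha>) \<le> ennreal ((1 - (cmod v)\<^sup>2) powr \<alpha>)" by (rule ennreal_leI)
        also have "\<dots> = nevanlinna \<eta> \<alpha> w"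
          unfolding v(2) by (rule nevanlinna_moebius[OF _ v1, symmetric]) (rule \<eta>)
        finally have "ennreal ((3 * s) powr \<alpha>) \<le> nevanlinna \<eta> \<alpha> w" .
        then show ?thesis using True mem img by simp
      qed simp
    qed
    finally have num: "ennreal ((3 * s) powr \<alpha> * (x * s)\<^sup>2) \<le> (\<integral>\<^sup>+w\<in>bergman_disc z r \<inter> \<eta> ` unit_disc. nevanlinna \<eta> \<alpha> w \<partial>area_measure)" .
    have "emeasure A (bergman_disc z r) \<le> ennreal (C * (1 - cmod z) powr (2 + \<alpha>))" by (rule C(2)[OF z])
    also have "\<dots> \<le> ennreal (C * (upper_lip * s) powr (2 + \<alpha>))"
      using lip z C \<alpha>_gt by (intro ennreal_leI mult_left_mono powr_mono2) auto
    finally have den: "emeasure A (bergman_disc z r) \<le> ennreal (C * (upper_lip * s) powr (2 + \<alpha>))" .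
    have "s powr (2 + \<alpha>) = s\<^sup>2 * s powr \<alpha>" using s by (simp add: powr_add powr_numeral)
    then have "c1 = (3 * s) powr \<alpha> * (x * s)\<^sup>2 / (C * (upper_lip * s) powr (2 + \<alpha>))"
      using s upper_lip_pos by (simp add: c1_def powr_mult power_mult_distrib)
    also have "ennreal \<dots> \<le> local_average \<eta> r z"
      unfolding local_average_def
    proof (rule ennreal_divide_ge[OF num den])
      obtain c2 where c2: "0 < c2" "\<And>z. z \<in> unit_disc \<Longrightarrow> ennreal (c2 * (1 - cmod z) powr (2 + \<alpha>)) \<le> emeasure A (bergman_disc z r)"
        by (rule weighted_area_bergman_disc_ge[OF r]) blast
      have "0 < ennreal (c2 * (1 - cmod z) powr (2 + \<alpha>))" using c2(1) z by simp
      then show "0 < emeasure A (bergman_disc z r)" using c2(2)[OF z] by (rule order.strict_trans2)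
    qed (use C s upper_lip_pos in auto)
    finally show ?thesis by (simp add: z_def u_def)
  qed
  show ?thesis
  proof (rule ccontr)
    assume "\<not> ?thesis"
    then have "Limsup (filtercomap cmod (at_left 1)) (local_average \<eta> r) < ennreal c1" using c1 by simp
    then have "eventually (\<lambda>z. local_average \<eta> r z < ennreal c1) (filtercomap cmod (at_left 1))" by (rule Limsup_lessD)
    then obtain Q where Q: "eventually Q (at_left (1 :: real))" "\<And>z. Q (cmod z) \<Longrightarrow> local_average \<eta> r z < ennreal c1"
      unfolding eventually_filtercomap by blast
    then obtain R where R: "R < 1" "\<And>y. \<lbrakk>R < y; y < 1\<rbrakk> \<Longrightarrow> Q y"
      unfolding eventually_at_left_field by blast
    define s where "s = min (1/2) ((1 - R) / (2 * upper_lip))"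
    have s: "0 < s" "s < 1" "upper_lip * s < 1 - R"
    proof -
      show "0 < s" using R upper_lip_pos by (simp add: s_def)
      show "s < 1" by (simp add: s_def)
      have "upper_lip * s \<le> upper_lip * ((1 - R) / (2 * upper_lip))"
        using upper_lip_pos by (intro mult_left_mono) (auto simp: s_def)
      also have "\<dots> = (1 - R) / 2" using upper_lip_pos by simp
      also have "\<dots> < 1 - R" using R by simp
      finally show "upper_lip * s < 1 - R" .
    qed
    define u where "u = of_real (1 - s) * \<xi>"
    have nu: "cmod u = 1 - s" using \<xi> s unfolding u_def norm_mult norm_of_real by simp
    have "\<xi> - u = of_real s * \<xi>" by (simp add: u_def algebra_simps)
    then have "cmod (\<xi> - u) = s" using \<xi> s by (simp add: norm_mult)
    then have "cmod (\<phi> \<xi> - \<phi> u) \<le> upper_lip * s"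
      using moebius_lipschitz[of \<xi> u] \<xi> nu s by simp
    then have "R < cmod (\<phi> u)" using norm_triangle_sub[of "\<phi> \<xi>" "\<phi> u"] touch s by linarith
    moreover have "cmod (\<phi> u) < 1" using map_disc[of u] nu s by simp
    ultimately have "local_average \<eta> r (\<phi> u) < ennreal c1" using Q(2) R(2) by blast
    then show False using main[OF s(1,2)] by (simp add: u_def)
  qed
qed

end

section \<open>Comparison of the essential norm with the local averages\<close>

lemma ennreal_comparable:
  fixes E L :: ennreal
  assumes E: "E < \<infinity>" and L: "L < \<infinity>" and iff: "E = 0 \<longleftrightarrow> L = 0"
  shows "\<exists>m M :: real. m > 0 \<and> M > 0 \<and> ennreal m * L \<le> E\<^sup>2 \<and> E\<^sup>2 \<le> ennreal M * L"
proof (cases "L = 0")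
  case True
  then have "E = 0" using iff by simp
  then show ?thesis using True by (intro exI[of _ 1]) simp
next
  case False
  obtain x where x: "E = ennreal x" "0 \<le> x" using E by (cases E) auto
  obtain y where y: "L = ennreal y" "0 \<le> y" using L by (cases L) auto
  have pos: "0 < x" "0 < y" using False iff x y by (auto simp: less_le)
  have "ennreal (x\<^sup>2 / y) * L = E\<^sup>2"
    using pos by (simp add: x y ennreal_power flip: ennreal_mult)
  then show ?thesis using pos by (intro exI[of _ "x\<^sup>2 / y"]) simp
qed

theorem theorem5p14:
  fixes \<alpha> r :: real
    and a b c d a' b' c' d' :: complex
    and \<phi> \<psi> \<tau> :: "complex \<Rightarrow> complex"
  assumes "-1 < \<alpha>" and "\<alpha> < 0"
    and "moebius_self_map a b c d" and "\<phi> = moebius a b c d"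
    and "moebius_self_map a' b' c' d'" and "\<psi> = moebius a' b' c' d'"
    and "\<tau> = krein_adjoint a' b' c' d'"
    and "r > 0"
  shows "let
      E = ess_norm (dirichlet_space \<alpha>)
            (adjoint_op (dirichlet_space \<alpha>) (composition_op \<psi>) \<circ> composition_op \<phi>);
      L = Limsup (filtercomap cmod (at_left 1)) (\<lambda>z.
            (\<integral>\<^sup>+w\<in>bergman_disc z r \<inter> (\<phi> \<circ> \<tau>) ` unit_disc.
                nevanlinna (\<phi> \<circ> \<tau>) \<alpha> w \<partial>area_measure)
            / emeasure (weighted_area \<alpha>) (bergman_disc z r))
    in \<exists>m M :: real. m > 0 \<and> M > 0 \<and> ennreal m * L \<le> E\<^sup>2 \<and> E\<^sup>2 \<le> ennreal M * L"
proof -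
  interpret W: negative_weight \<alpha> by unfold_locales (use assms in auto)
  interpret two_compositions \<alpha> a b c d a' b' c' d' by unfold_locales (use assms in auto)
  interpret K: linear_fractional "cnj a'" "- cnj c'" "- cnj b'" "cnj d'"
    by unfold_locales (rule psi.krein_self_map)
  define p q s t where "p = a * cnj a' + b * - cnj b'" and "q = a * - cnj c' + b * cnj d'"
    and "s = c * cnj a' + d * - cnj b'" and "t = c * - cnj c' + d * cnj d'"
  have comp: "linear_fractional p q s t" "\<And>z. cmod z \<le> 1 \<Longrightarrow> moebius p q s t z = \<phi> (\<tau> z)"
    using phi.moebius_compose[OF K.linear_fractional_axioms]
    by (simp_all add: p_def q_def s_def t_def assms krein_adjoint_def)
  interpret eta: dirichlet_composition \<alpha> p q s t
    by (intro dirichlet_composition.intro W.negative_weight_axioms comp(1))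
  have \<eta>: "(\<phi> \<circ> \<tau>) u = moebius p q s t u" if "u \<in> unit_disc" for u
    using comp(2)[of u] that by simp
  define L where "L = Limsup (filtercomap cmod (at_left 1)) (eta.local_average (\<phi> \<circ> \<tau>) r)"
  define E where "E = ess_norm (dirichlet_space \<alpha>) T"
  have "E < \<infinity>" unfolding E_def by (rule ess_norm_T_finite)
  moreover have "L < \<infinity>"
    unfolding L_def by (rule eta.local_average_Limsup_finite[OF _ assms(8)]) (rule \<eta>)
  moreover have "E = 0 \<longleftrightarrow> L = 0"
  proof (cases "\<exists>\<omega>. cmod \<omega> = 1 \<and> cmod (\<phi> \<omega>) = 1 \<and> cmod (\<psi> \<omega>) = 1")
    case True
    then obtain \<omega> where \<omega>: "cmod \<omega> = 1" "cmod (\<phi> \<omega>) = 1" "cmod (\<psi> \<omega>) = 1" by blast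
    have "0 < E" unfolding E_def using \<omega> assms by (intro T_ess_norm_pos) auto
    moreover have "\<tau> (\<psi> \<omega>) = \<omega>"
      using psi.krein_inverse_circle[of \<omega>] \<omega> assms by simp
    then have touch: "cmod (moebius p q s t (\<psi> \<omega>)) = 1" using comp(2)[of "\<psi> \<omega>"] \<omega> by simp
    have "0 < L"
      unfolding L_def by (rule eta.local_average_Limsup_pos[OF _ assms(8) \<omega>(3) touch]) (rule \<eta>)
    ultimately show ?thesis by (auto simp: zero_less_iff_neq_zero)
  next
    case False
    have "compact_op (dirichlet_space \<alpha>) T"
      by (rule T_compact) (use False assms in blast)
    then have "E = 0" unfolding E_def by (rule W.D.ess_norm_compact)
    moreover have inside: "cmod (moebius p q s t \<xi>) \<noteq> 1" if \<xi>: "cmod \<xi> = 1" for \<xi>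
    proof
      assume touch: "cmod (moebius p q s t \<xi>) = 1"
      define \<omega> where "\<omega> = \<tau> \<xi>"
      have \<phi>\<omega>: "cmod (\<phi> \<omega>) = 1" using touch comp(2)[of \<xi>] \<xi> by (simp add: \<omega>_def)
      have "cmod \<omega> \<le> 1" using K.map_cball[of \<xi>] \<xi> by (simp add: \<omega>_def assms krein_adjoint_def)
      moreover have "\<not> cmod \<omega> < 1" using phi.map_disc[of \<omega>] \<phi>\<omega> assms by auto
      ultimately have \<omega>: "cmod \<omega> = 1" by simp
      have "krein_adjoint (cnj a') (- cnj c') (- cnj b') (cnj d') \<omega> = \<xi>"
        using K.krein_inverse_circle[of \<xi>] \<xi> \<omega> by (simp add: \<omega>_def assms krein_adjoint_def)
      then have "\<psi> \<omega> = \<xi>" by (simp add: krein_adjoint_def assms)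
      then show False using False \<omega> \<phi>\<omega> \<xi> by blast
    qed
    have "L = 0"
      unfolding L_def by (rule eta.local_average_Limsup_zero[OF _ assms(8)]) (rule \<eta>, assumption, rule inside)
    ultimately show ?thesis by simp
  qed
  ultimately have "\<exists>m M :: real. m > 0 \<and> M > 0 \<and> ennreal m * L \<le> E\<^sup>2 \<and> E\<^sup>2 \<le> ennreal M * L"
    by (rule ennreal_comparable)
  then show ?thesis
    unfolding Let_def E_def L_def T_def eta.local_average_def[abs_def] assms(4,6) .
qed

end
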